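(* Let $H(\mathbb Z)$ be the integer Heisenberg group and $H(\mathbb R)$ the real Heisenberg group, and let $$V=\left\{\begin{bmatrix}0&a&0\\0&0&c\\0&0&0\end{bmatrix}:a,c\in\mathbb R\right\},$$ a subspace of the Lie algebra of $H(\mathbb R)$. Let $\Phi$ be any norm on $V$ and let $d_\Phi$ be the associated Carnot-Carathéodory metric on $H(\mathbb R)$. Then, given any Cayley graph of $H(\mathbb Z)$ (with respect to a finite generating set), with edge set $E$, there exist stationary random edge weights $w:E\to\mathbb R_{\ge0}$ such that the resulting FPP metric $T$ satisfies, almost surely, $$\left(H(\mathbb Z),\tfrac1nT\right)\xrightarrow[n\to\infty]{}(H(\mathbb R),d_\Phi)$$ in the sense of pointed Gromov-Hausdorff convergence, with the identity elements as basepoints.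
   Context: $H(\mathbb R)$ is the group of real upper triangular $3\times3$ matrices with $1$s on the diagonal, and $H(\mathbb Z)\subset H(\mathbb R)$ is the subgroup of matrices with integer entries. **Carnot-Carathéodory metric.** Left translation of $V$ gives a left-invariant distribution on $H(\mathbb R)$, and $\Phi$ extends by left translation to all vectors of the distribution. An absolutely continuous path $\xi:[a,b]\to H(\mathbb R)$ is *admissible* if $\xi'(t)$ lies in the distribution for a.e. $t$; its length is $\int_a^b\Phi(\xi'(t))\,dt$, and $d_\Phi(x,y)$ is the infimum of the lengths of admissible paths from $x$ to $y$. **FPP.** The Cayley graph of a group $\Gamma$ with finite generating set $S$ has vertex set $\Gamma$ and edge set $E=\{\{g,gs\}:g\in\Gamma,s\in S\}$. A random function $w:E\to[0,\infty)$ is *stationary* if for all $f_1,\dots,f_k\in E$ and $g\in\Gamma$ the vectors $(w(f_1),\dots,w(f_k))$ and $(w(g^{-1}f_1),\dots,w(g^{-1}f_k))$ have the same law. For an edge path $\gamma=(f_1,\dots,f_k)$ put $T(\gamma)=\sum_iw(f_i)$; $T(x,y)$ is the infimum of $T(\gamma)$ over edge paths $\gamma$ from $x$ to $y$, a random pseudo-metric on $\Gamma$. Pointed Gromov-Hausdorff convergence of pseudo-metric spaces means that of the associated metric quotients. *)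

theory Defs
  imports "HOL-Probability.Probability" "HOL-Algebra.Generated_Groups"
begin

section \<open>The Heisenberg groups\<close>

text \<open>\<open>heisenberg_group \<int>\<close> is the integer Heisenberg group and
  \<open>heisenberg_group \<real>\<close> the real one.\<close>

definition heisenberg_group :: "real set \<Rightarrow> (real^3^3) monoid" where
  "heisenberg_group R =
    \<lparr>carrier = {vector [vector [1, a, b], vector [0, 1, c], vector [0, 0, 1]] | a b c.
                 a \<in> R \<and> b \<in> R \<and> c \<in> R},
     monoid.mult = (**), one = mat 1\<rparr>"

abbreviation HZ :: "(real^3^3) monoid" where "HZ \<equiv> heisenberg_group \<int>"
abbreviation HR :: "(real^3^3) monoid" where "HR \<equiv> heisenberg_group \<real>"

section \<open>Carnot-Caratheodory metrics\<close>

definition horizontal :: "(real^3^3) set" where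
  "horizontal = {vector [vector [0, a, 0], vector [0, 0, c], vector [0, 0, 0]] | a c. True}"

definition norm_on :: "'v::real_vector set \<Rightarrow> ('v \<Rightarrow> real) \<Rightarrow> bool" where
  "norm_on V \<Phi> \<longleftrightarrow>
    (\<forall>v\<in>V. 0 \<le> \<Phi> v) \<and>
    (\<forall>v\<in>V. \<Phi> v = 0 \<longleftrightarrow> v = 0) \<and>
    (\<forall>c. \<forall>v\<in>V. \<Phi> (c *\<^sub>R v) = \<bar>c\<bar> * \<Phi> v) \<and>
    (\<forall>u\<in>V. \<forall>v\<in>V. \<Phi> (u + v) \<le> \<Phi> u + \<Phi> v)"

text \<open>In a matrix group the differential of left translation by \<open>x\<close> is \<open>v \<mapsto> x ** v\<close>.\<close>

definition distribution :: "real^3^3 \<Rightarrow> (real^3^3) set" where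
  "distribution x = (\<lambda>v. x ** v) ` horizontal"

definition translated_norm :: "(real^3^3 \<Rightarrow> real) \<Rightarrow> real^3^3 \<Rightarrow> real^3^3 \<Rightarrow> real" where
  "translated_norm \<Phi> x u = \<Phi> (matrix_inv x ** u)"

definition absolutely_continuous_path ::
    "real \<Rightarrow> real \<Rightarrow> (real \<Rightarrow> 'v::real_normed_vector) \<Rightarrow> bool" where
  "absolutely_continuous_path a b \<xi> \<longleftrightarrow>
    (\<forall>\<epsilon>>0. \<exists>\<delta>>0. \<forall>(k::nat) s t.
      (\<forall>i<k. a \<le> s i \<and> s i \<le> t i \<and> t i \<le> b) \<longrightarrow>
      disjoint_family_on (\<lambda>i. {s i<..<t i}) {..<k} \<longrightarrow>
      (\<Sum>i<k. t i - s i) < \<delta> \<longrightarrow>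
      (\<Sum>i<k. norm (\<xi> (t i) - \<xi> (s i))) < \<epsilon>)"

definition admissible :: "real \<Rightarrow> real \<Rightarrow> (real \<Rightarrow> real^3^3) \<Rightarrow> bool" where
  "admissible a b \<xi> \<longleftrightarrow>
    \<xi> ` {a..b} \<subseteq> carrier HR \<and>
    absolutely_continuous_path a b \<xi> \<and>
    (AE t in lebesgue_on {a..b}.
      \<xi> differentiable (at t within {a..b}) \<and>
      vector_derivative \<xi> (at t within {a..b}) \<in> distribution (\<xi> t))"

definition path_length_wrt ::
    "(real^3^3 \<Rightarrow> real) \<Rightarrow> real \<Rightarrow> real \<Rightarrow> (real \<Rightarrow> real^3^3) \<Rightarrow> real" where
  "path_length_wrt \<Phi> a b \<xi> =
    (LINT t|lebesgue_on {a..b}.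
      translated_norm \<Phi> (\<xi> t) (vector_derivative \<xi> (at t within {a..b})))"

text \<open>On \<open>carrier HR\<close> the set below is nonempty (Chow) and bounded below by 0.\<close>

definition cc_dist :: "(real^3^3 \<Rightarrow> real) \<Rightarrow> real^3^3 \<Rightarrow> real^3^3 \<Rightarrow> real" where
  "cc_dist \<Phi> x y =
    Inf {path_length_wrt \<Phi> a b \<xi> | a b \<xi>. a \<le> b \<and> admissible a b \<xi> \<and> \<xi> a = x \<and> \<xi> b = y}"

section \<open>First-passage percolation on Cayley graphs\<close>

definition cayley_edges :: "('g, 'm) monoid_scheme \<Rightarrow> 'g set \<Rightarrow> 'g set set" where
  "cayley_edges G S = {{g, g \<otimes>\<^bsub>G\<^esub> s} | g s. g \<in> carrier G \<and> s \<in> S}"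

definition translate_edge :: "('g, 'm) monoid_scheme \<Rightarrow> 'g \<Rightarrow> 'g set \<Rightarrow> 'g set" where
  "translate_edge G g f = (\<lambda>x. g \<otimes>\<^bsub>G\<^esub> x) ` f"

fun edge_path :: "'g set set \<Rightarrow> 'g \<Rightarrow> 'g set list \<Rightarrow> 'g \<Rightarrow> bool" where
  "edge_path E x [] y \<longleftrightarrow> x = y"
| "edge_path E x (f # fs) y \<longleftrightarrow> f \<in> E \<and> (\<exists>z. f = {x, z} \<and> edge_path E z fs y)"

text \<open>For nonnegative weights the set below is bounded below by 0, and it is nonempty when the edges
  are those of a Cayley graph of a generating set and \<open>x\<close>, \<open>y\<close> lie in the group.\<close>

definition passage_time :: "'g set set \<Rightarrow> ('g set \<Rightarrow> real) \<Rightarrow> 'g \<Rightarrow> 'g \<Rightarrow> real" where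
  "passage_time E w x y = Inf {sum_list (map w \<gamma>) | \<gamma>. edge_path E x \<gamma> y}"

text \<open>HOL cannot quantify existentially over the type of the sample space. To assert that weights
  with some property exist, one may take the sample space in the type \<open>'e \<Rightarrow> real\<close>: it contains
  the path space of the weights, so the law of every such family can be realised on it.\<close>

definition random_weights :: "'e set \<Rightarrow> 'o measure \<Rightarrow> ('e \<Rightarrow> 'o \<Rightarrow> real) \<Rightarrow> bool" where
  "random_weights E M w \<longleftrightarrow>
    (\<forall>e\<in>E. w e \<in> borel_measurable M \<and> (\<forall>\<omega>\<in>space M. 0 \<le> w e \<omega>))"

definition stationary ::
    "('g, 'm) monoid_scheme \<Rightarrow> 'g set set \<Rightarrow> 'o measure \<Rightarrow> ('g set \<Rightarrow> 'o \<Rightarrow> real) \<Rightarrow> bool" where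
  "stationary G E M w \<longleftrightarrow>
    (\<forall>(k::nat) f. \<forall>g\<in>carrier G. (\<forall>i<k. f i \<in> E) \<longrightarrow>
      distr M (\<Pi>\<^sub>M i\<in>{..<k}. borel) (\<lambda>\<omega>. \<lambda>i\<in>{..<k}. w (f i) \<omega>) =
      distr M (\<Pi>\<^sub>M i\<in>{..<k}. borel)
        (\<lambda>\<omega>. \<lambda>i\<in>{..<k}. w (translate_edge G (inv\<^bsub>G\<^esub> g) (f i)) \<omega>))"

section \<open>Pointed Gromov-Hausdorff convergence\<close>

definition zero_dist_rel :: "'a set \<Rightarrow> ('a \<Rightarrow> 'a \<Rightarrow> real) \<Rightarrow> ('a \<times> 'a) set" where
  "zero_dist_rel X d = {(x, y). x \<in> X \<and> y \<in> X \<and> d x y = 0}"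

text \<open>The choice of representatives in \<open>quotient_dist\<close> is immaterial when \<open>d\<close> is a pseudo-metric.\<close>

definition quotient_dist :: "('a \<Rightarrow> 'a \<Rightarrow> real) \<Rightarrow> 'a set \<Rightarrow> 'a set \<Rightarrow> real" where
  "quotient_dist d A B = d (SOME x. x \<in> A) (SOME y. y \<in> B)"

text \<open>Pointed Gromov-Hausdorff convergence of metric spaces \<open>(X n, d n, p n)\<close> to \<open>(Y, e, q)\<close>,
  in the form of Burago-Burago-Ivanov, \<^emph>\<open>A Course in Metric Geometry\<close>, Definition 8.1.1:
  for all \<open>r, \<epsilon> > 0\<close> and all large \<open>n\<close>, there is a map from the \<open>r\<close>-ball in \<open>X n\<close>
  to \<open>Y\<close> that preserves base points, has distortion less than \<open>\<epsilon>\<close>, and whose image has an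
  \<open>\<epsilon>\<close>-neighbourhood containing the \<open>(r - \<epsilon>)\<close>-ball in \<open>Y\<close>.\<close>

definition pointed_GH_tendsto ::
    "(nat \<Rightarrow> 'a set) \<Rightarrow> (nat \<Rightarrow> 'a \<Rightarrow> 'a \<Rightarrow> real) \<Rightarrow> (nat \<Rightarrow> 'a) \<Rightarrow>
     'b set \<Rightarrow> ('b \<Rightarrow> 'b \<Rightarrow> real) \<Rightarrow> 'b \<Rightarrow> bool" where
  "pointed_GH_tendsto X d p Y e q \<longleftrightarrow>
    (\<forall>r>0. \<forall>\<epsilon>>0. \<forall>\<^sub>F n in sequentially.
      let B = {x \<in> X n. d n (p n) x < r} in
      \<exists>f \<in> B \<rightarrow> Y.
        f (p n) = q \<and>
        (\<forall>x\<in>B. \<forall>y\<in>B. \<bar>e (f x) (f y) - d n x y\<bar> < \<epsilon>) \<and>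
        {y \<in> Y. e q y < r - \<epsilon>} \<subseteq> {y \<in> Y. \<exists>x\<in>B. e (f x) y < \<epsilon>})"

text \<open>Convergence of pseudo-metric spaces is convergence of the associated metric quotients.\<close>

definition pointed_GH_tendsto_pseudo ::
    "(nat \<Rightarrow> 'a set) \<Rightarrow> (nat \<Rightarrow> 'a \<Rightarrow> 'a \<Rightarrow> real) \<Rightarrow> (nat \<Rightarrow> 'a) \<Rightarrow>
     'b set \<Rightarrow> ('b \<Rightarrow> 'b \<Rightarrow> real) \<Rightarrow> 'b \<Rightarrow> bool" where
  "pointed_GH_tendsto_pseudo X d p Y e q \<longleftrightarrow>
    pointed_GH_tendsto
      (\<lambda>n. X n // zero_dist_rel (X n) (d n))
      (\<lambda>n. quotient_dist (d n))
      (\<lambda>n. zero_dist_rel (X n) (d n) `` {p n})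
      (Y // zero_dist_rel Y e) (quotient_dist e) (zero_dist_rel Y e `` {q})"

end

theory Submission
  imports Defs
begin

text \<open>The proof follows one idea: define the weights as distances in an image of the group. Let
\<open>d\<close> be the Carnot-Caratheodory distance and let \<open>collapse\<close> be a random map from \<open>H(\<int>)\<close> to
\<open>H(\<real>)\<close> that moves every point by an amount sublinear in its distance from the origin. Put
\<open>w {x, y} = d (collapse x) (collapse y)\<close>. By the triangle inequality every path from \<open>x\<close> to
\<open>y\<close> weighs at least \<open>d (collapse x) (collapse y)\<close>, which is \<open>d x y\<close> up to a sublinear error. So the
lower bound \<open>T \<ge> d\<close> is automatic, and \<open>collapse\<close> only has to create enough cheap roads for the
upper bound.

Here is how it does so. The group is written additively in exponential coordinates (type \<open>heis\<close>), where a
point has a horizontal part in the plane and a vertical part. Fix two generators \<open>s1\<close>, \<open>s2\<close> with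
independent horizontal parts. For each nonzero rational slope, numbered by a level \<open>k\<close>, a staircase of
steps \<open>s1\<close> and \<open>\<plusminus> s2\<close> has horizontal increment \<open>dir k\<close> per period. The linear functional \<open>F k\<close> on the
integer points vanishes on the period, and it separates the vertices of the staircase. The points at which
\<open>F k\<close> takes a prescribed value modulo a large number \<open>gap k\<close> are the base points of highways. The other
residues of the vertices of a period form, together with this one, the walls of level \<open>k\<close>, and
\<open>collapse\<close> sends all vertices of a period to one point next to its base point. Following the
staircase for one period then costs only the jump from one such point to the next, which after the correction
\<open>shift k\<close> is a horizontal segment of length \<open>N (dir k)\<close>: the highway has the speed that
the norm prescribes (\<open>highway_period_cost\<close>). Where walls of several levels meet, the highest level wins.

A traveller on a highway of level \<open>k\<close>, or along the generators, is disturbed by the walls of higher level. Each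
crossing costs at most \<open>toll j\<close>, while the density of the walls of level \<open>j\<close> is about
\<open>1 / gap j\<close> with \<open>gap j\<close> larger than \<open>toll j\<close> by a factor of at least \<open>2 ^ j\<close>. Summed over the
levels, the disturbance per period of the highway is at most \<open>1 / 2 ^ k\<close> plus a sublinear term (\<open>crossing_cost\<close>). The same
smallness and the Borel-Cantelli lemma show that, almost surely, a wall of a high level \<open>j\<close> stays at distance at
least \<open>2 ^ j * toll j\<close> from the origin (\<open>AE_good\<close>), and this makes the displacement of
\<open>collapse\<close> sublinear (\<open>collapse_sublinear\<close>). On this event the rest of the argument is deterministic.

From highways to all displacements: commutators of the generators reach every point at bounded
speed (\<open>bounded_speed_id\<close>); the property \<open>reach g L\<close> says that dilated copies of \<open>g\<close> can be
traversed at cost \<open>L\<close> asymptotically. It holds for highway directions, it passes to limits and hence to all horizontal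
vectors, since the slopes are dense, and it is additive; so it holds for polygons and finally for
every \<open>g\<close> with \<open>L\<close> its distance from the origin (\<open>reach_rho\<close>). A finite net of the unit ball makes the
estimate uniform: \<open>\<bar>T x y - d x y\<bar> \<le> \<epsilon> (\<bar>x\<bar> + \<bar>y\<bar>) + C\<close> (\<open>T_approximates_rho\<close>), and then the dilations by
\<open>1 / n\<close> are the maps required for Gromov-Hausdorff convergence (\<open>rescaled_approximation\<close>).

Stationarity holds because translating the group by \<open>g\<close> only rotates the residue that positions the walls of
level \<open>j\<close> by \<open>F j g\<close>, and these residues are uniform and independent (\<open>distr_translate\<close>).

The distance \<open>d\<close> itself is handled through polygons: \<open>rho g\<close> is the infimum of the lengths of the polygons with
horizontal sides from \<open>0\<close> to \<open>g\<close>, and \<open>cc_dist_eq_rho\<close> identifies it with the infimum over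
admissible paths. An absolutely continuous horizontal path is compared with an inscribed polygon; the two
endpoints differ by a central element that tends to \<open>0\<close> with the mesh.\<close>

section \<open>Exponential coordinates on the Heisenberg group\<close>

text \<open>The standard area form of the plane. It is the cocycle of the group law below and, half of it, the
area that a horizontal path sweeps out.\<close>

definition det2 :: "real \<times> real \<Rightarrow> real \<times> real \<Rightarrow> real" where
  "det2 v w = fst v * snd w - fst w * snd v"

lemma det2_simps [simp]:
  "det2 (u + v) w = det2 u w + det2 v w" "det2 w (u + v) = det2 w u + det2 w v"
  "det2 (u - v) w = det2 u w - det2 v w" "det2 w (u - v) = det2 w u - det2 w v"
  "det2 (- v) w = - det2 v w" "det2 w (- v) = - det2 w v"
  "det2 0 w = 0" "det2 w 0 = 0" "det2 v v = 0"
  "det2 (c *\<^sub>R v) w = c * det2 v w" "det2 w (c *\<^sub>R v) = c * det2 w v"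
  by (auto simp: det2_def algebra_simps)

lemma det2_commute: "det2 v w = - det2 w v"
  by (simp add: det2_def)

lemma det2_basis_expansion:
  assumes "det2 p q \<noteq> 0"
  shows "v = (det2 v q / det2 p q) *\<^sub>R p + (det2 p v / det2 p q) *\<^sub>R q"
proof -
  have "fst v * det2 p q = det2 v q * fst p + det2 p v * fst q"
       "snd v * det2 p q = det2 v q * snd p + det2 p v * snd q"
    by (auto simp: det2_def algebra_simps)
  then show ?thesis using assms by (auto simp: prod_eq_iff field_simps)
qed

text \<open>Logarithms of upper triangular matrices. The group is not commutative, but additive notation makes
its laws available through the type class \<open>group_add\<close>; left division is written \<open>- x + y\<close>.\<close>

datatype heis = Heis (hor: "real \<times> real") (ver: real)

instantiation heis :: group_add
begin
definition zero_heis_def: "0 = Heis 0 0"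
definition plus_heis_def: "x + y = Heis (hor x + hor y) (ver x + ver y + det2 (hor x) (hor y) / 2)"
definition uminus_heis_def: "- x = Heis (- hor x) (- ver x)"
definition minus_heis_def: "x - y = x + (- y :: heis)"
instance
  by standard (auto simp: zero_heis_def plus_heis_def uminus_heis_def minus_heis_def add_divide_distrib)
end

lemma heis_sel_simps [simp]:
  "hor 0 = 0" "ver 0 = 0" "hor (x + y) = hor x + hor y"
  "ver (x + y) = ver x + ver y + det2 (hor x) (hor y) / 2"
  "hor (- x) = - hor x" "ver (- x) = - ver x"
  by (auto simp: zero_heis_def plus_heis_def uminus_heis_def)

lemma heis_diff_simps [simp]:
  "hor (x - y) = hor x - hor y"
  "ver (x - y) = ver x - ver y - det2 (hor x) (hor y) / 2"
  unfolding minus_heis_def heis_sel_simps by simp_all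

lemma heis_eqI: "hor x = hor y \<Longrightarrow> ver x = ver y \<Longrightarrow> x = y"
  by (rule heis.expand) simp

text \<open>The one-parameter subgroup through \<open>g\<close>; on natural numbers it gives the multiples of \<open>g\<close>.\<close>

definition smul :: "real \<Rightarrow> heis \<Rightarrow> heis" where
  "smul s g = Heis (s *\<^sub>R hor g) (s * ver g)"

text \<open>The dilations of the group: automorphisms that scale the horizontal plane by \<open>s\<close> and hence
areas by \<open>s\<^sup>2\<close>.\<close>

definition dil :: "real \<Rightarrow> heis \<Rightarrow> heis" where
  "dil s g = Heis (s *\<^sub>R hor g) (s\<^sup>2 * ver g)"

lemma smul_sel [simp]: "hor (smul s g) = s *\<^sub>R hor g" "ver (smul s g) = s * ver g"
  by (auto simp: smul_def)

lemma dil_sel [simp]: "hor (dil s g) = s *\<^sub>R hor g" "ver (dil s g) = s\<^sup>2 * ver g"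
  by (auto simp: dil_def)

lemma smul_add: "smul (s + t) g = smul s g + smul t g"
  by (rule heis_eqI) (auto simp: algebra_simps)

lemma smul_0 [simp]: "smul 0 g = 0" and smul_1 [simp]: "smul 1 g = g"
  and smul_minus: "smul (- s) g = - smul s g"
  by (auto intro!: heis_eqI)

lemma dil_plus: "dil s (g + h) = dil s g + dil s h"
  by (rule heis_eqI) (auto simp: algebra_simps power2_eq_square)

lemma dil_uminus: "dil s (- g) = - dil s g"
  by (rule heis_eqI) auto

lemma dil_dil: "dil s (dil t g) = dil (s * t) g"
  by (rule heis_eqI) (auto simp: algebra_simps power2_eq_square)

lemma dil_1 [simp]: "dil 1 g = g" and dil_0_right [simp]: "dil s 0 = 0"
  by (auto intro!: heis_eqI)

text \<open>Conjugation changes an element only by a central one, bilinear in the horizontal parts. This is why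
bounded errors can be moved past long displacements at a sublinear price.\<close>

lemma conj_eq: "- g + h + g = h + Heis 0 (det2 (hor h) (hor g))"
  by (rule heis_eqI) (auto simp: det2_commute[of "hor g"])

lemma smul_conj: "smul s (g + h - g) = g + smul s h - g"
  by (rule heis_eqI) (auto simp: algebra_simps det2_commute[of "hor g"])

lemma commutator_eq: "g + h - g - h = Heis 0 (det2 (hor g) (hor h))"
  by (rule heis_eqI) (auto simp: algebra_simps det2_commute[of "hor h"])

section \<open>The Carnot-Caratheodory norm through horizontal polygons\<close>

text \<open>The endpoint of the polygon that starts at \<open>0\<close> and has the straight horizontal sides \<open>vs\<close>.\<close>

definition polygon :: "(real \<times> real) list \<Rightarrow> heis" where
  "polygon vs = sum_list (map (\<lambda>v. Heis v 0) vs)"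

lemma polygon_simps [simp]:
  "polygon [] = 0" "polygon (v # vs) = Heis v 0 + polygon vs"
  "polygon (vs @ ws) = polygon vs + polygon ws"
  by (auto simp: polygon_def)

lemma polygon_reverse: "polygon (rev (map uminus vs)) = - polygon vs"
proof (induction vs)
  case (Cons v vs)
  have "Heis (- v) 0 = - Heis v 0" by (rule heis_eqI) auto
  then show ?case using Cons by (simp add: minus_add)
qed simp

lemma polygon_dil: "polygon (map (scaleR s) vs) = dil s (polygon vs)"
proof (induction vs)
  case (Cons v vs)
  have "Heis (s *\<^sub>R v) 0 = dil s (Heis v 0)" by (rule heis_eqI) auto
  then show ?case using Cons by (simp add: dil_plus)
qed simp

locale plane_norm =
  fixes N :: "real \<times> real \<Rightarrow> real"
  assumes N_norm: "norm_on UNIV N"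
begin

lemma N_nonneg [simp]: "0 \<le> N v" and N_eq_0 [simp]: "N v = 0 \<longleftrightarrow> v = 0"
  and N_scale [simp]: "N (c *\<^sub>R v) = \<bar>c\<bar> * N v" and N_triangle: "N (u + v) \<le> N u + N v"
  using N_norm unfolding norm_on_def by blast+

lemma N_0 [simp]: "N 0 = 0" by simp

lemma N_minus [simp]: "N (- v) = N v"
  using N_scale[of "-1" v] by simp

lemma N_triangle_sub: "N (u - v) \<le> N u + N v"
  using N_triangle[of u "- v"] by simp

definition N_basis :: real where "N_basis = N (1, 0) + N (0, 1)"

lemma N_basis_pos: "0 < N_basis"
proof -
  have "((1, 0) :: real \<times> real) \<noteq> 0" by (simp add: zero_prod_def)
  then have "0 < N (1, 0)" using N_nonneg[of "(1, 0)"] N_eq_0[of "(1, 0)"] by linarith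
  then show ?thesis using N_nonneg[of "(0, 1)"] unfolding N_basis_def by linarith
qed

lemma N_le_coords: "N v \<le> \<bar>fst v\<bar> * N (1, 0) + \<bar>snd v\<bar> * N (0, 1)"
proof -
  have "v = fst v *\<^sub>R (1, 0) + snd v *\<^sub>R (0, 1)" by (simp add: prod_eq_iff)
  then show ?thesis
    using N_triangle[of "fst v *\<^sub>R (1, 0)" "snd v *\<^sub>R (0, 1)"] by (metis N_scale)
qed

lemma N_le_norm: "N v \<le> N_basis * norm v"
proof -
  have "N v \<le> \<bar>fst v\<bar> * N (1, 0) + \<bar>snd v\<bar> * N (0, 1)" by (rule N_le_coords)
  also have "\<dots> \<le> norm v * N (1, 0) + norm v * N (0, 1)"
    using norm_fst_le[of "fst v" "snd v"] norm_snd_le[of "snd v" "fst v"]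
    by (intro add_mono mult_right_mono) (auto simp: real_norm_def[symmetric] simp del: real_norm_def)
  finally show ?thesis by (simp add: N_basis_def algebra_simps)
qed

lemma N_lipschitz: "\<bar>N u - N v\<bar> \<le> N_basis * norm (u - v)"
proof -
  have "N u \<le> N (u - v) + N v" using N_triangle[of "u - v" v] by simp
  moreover have "N v \<le> N (v - u) + N u" using N_triangle[of "v - u" u] by simp
  moreover have "N (v - u) = N (u - v)" using N_minus[of "u - v"] by simp
  ultimately show ?thesis using N_le_norm[of "u - v"] by linarith
qed

lemma continuous_on_N: "continuous_on A N"
proof -
  have "N_basis-lipschitz_on A N"
    using N_lipschitz N_basis_pos by (auto simp: lipschitz_on_def dist_norm)
  then show ?thesis by (rule lipschitz_on_continuous_on)
qed

lemma ex_norm_le_N: "\<exists>k>0. \<forall>v. norm v \<le> k * N v"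
proof -
  have ne: "sphere (0 :: real \<times> real) 1 \<noteq> {}"
    using vector_choose_size[of 1, where ?'a = "real \<times> real"] by auto
  obtain u where u: "u \<in> sphere 0 1" "\<And>v. v \<in> sphere 0 1 \<Longrightarrow> N u \<le> N v"
    using continuous_attains_inf[OF compact_sphere ne continuous_on_N] by blast
  have Nu: "0 < N u" using u(1) N_nonneg[of u] N_eq_0[of u] by (metis less_eq_real_def norm_zero
      mem_sphere_0 zero_neq_one)
  have "norm v \<le> 1 / N u * N v" for v
  proof (cases "v = 0")
    case False
    have "N u \<le> N ((1 / norm v) *\<^sub>R v)" by (rule u) (use False in auto)
    then show ?thesis using False Nu by (simp add: field_simps)
  qed simp
  then show ?thesis using Nu by (intro exI[of _ "1 / N u"]) auto
qed

definition norm_const :: real where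
  "norm_const = (SOME k. k > 0 \<and> (\<forall>v. norm v \<le> k * N v))"

lemma norm_const: "0 < norm_const" "norm v \<le> norm_const * N v"
  using someI_ex[OF ex_norm_le_N[unfolded Bex_def]] unfolding norm_const_def by blast+

definition det2_const :: real where "det2_const = 2 * norm_const\<^sup>2"

lemma det2_const_pos: "0 < det2_const"
  using norm_const by (simp add: det2_const_def)

lemma det2_le: "\<bar>det2 v w\<bar> \<le> det2_const * (N v * N w)"
proof -
  have "\<bar>det2 v w\<bar> \<le> \<bar>fst v\<bar> * \<bar>snd w\<bar> + \<bar>fst w\<bar> * \<bar>snd v\<bar>"
    unfolding det2_def abs_mult[symmetric] by linarith
  also have "\<dots> \<le> norm v * norm w + norm w * norm v"
    using norm_fst_le[of "fst v" "snd v"] norm_snd_le[of "snd v" "fst v"]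
      norm_fst_le[of "fst w" "snd w"] norm_snd_le[of "snd w" "fst w"]
    by (intro add_mono mult_mono) auto
  also have "\<dots> = 2 * (norm v * norm w)" by simp
  also have "\<dots> \<le> 2 * ((norm_const * N v) * (norm_const * N w))"
    using norm_const by (intro mult_left_mono mult_mono) auto
  finally show ?thesis by (simp add: det2_const_def power2_eq_square algebra_simps)
qed

abbreviation plen :: "(real \<times> real) list \<Rightarrow> real" where
  "plen vs \<equiv> sum_list (map N vs)"

lemma plen_nonneg: "0 \<le> plen vs"
  by (intro sum_list_nonneg) auto

text \<open>The length of a shortest horizontal polygon, which is the Carnot-Caratheodory norm; see \<open>cc_dist_eq_rho\<close> below.\<close>

definition rho :: "heis \<Rightarrow> real" where
  "rho g = Inf {plen vs | vs. polygon vs = g}"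

lemma polygon_lens_bdd: "bdd_below {plen vs | vs. polygon vs = g}"
  using plen_nonneg by (auto intro!: bdd_belowI[of _ 0])

lemma rho_le_plen: "polygon vs = g \<Longrightarrow> rho g \<le> plen vs"
  unfolding rho_def by (intro cInf_lower polygon_lens_bdd) auto

definition ver_const :: real where "ver_const = 2 * N_basis"

lemma ver_const_pos: "0 < ver_const"
  using N_basis_pos by (simp add: ver_const_def)

text \<open>Going around a rectangle produces a central element whose height is the area, so a central element of height
\<open>z\<close> costs only a multiple of \<open>sqrt \<bar>z\<bar>\<close>.\<close>

lemma ex_polygon: "\<exists>vs. polygon vs = g \<and> plen vs \<le> N (hor g) + ver_const * sqrt \<bar>ver g\<bar>"
proof -
  define s t where "s = sqrt \<bar>ver g\<bar>" and "t = (if ver g \<ge> 0 then s else - s)"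
  have st: "s * t = ver g" "\<bar>t\<bar> = s" "s \<ge> 0" by (auto simp: s_def t_def)
  \<comment> \<open>One side for the horizontal part, then once around a rectangle of area \<open>ver g\<close>.\<close>
  define vs where "vs = [hor g, (s, 0), (0, t), (- s, 0), (0, - t)]"
  have "polygon vs = g"
    by (rule heis_eqI) (auto simp: vs_def det2_def st zero_prod_def)
  moreover have "N (s, 0) = s * N (1, 0)" "N (- s, 0) = s * N (1, 0)"
    "N (0, t) = s * N (0, 1)" "N (0, - t) = s * N (0, 1)"
    using N_scale[of s "(1,0)"] N_scale[of "-s" "(1,0)"] N_scale[of t "(0,1)"] N_scale[of "-t" "(0,1)"] st
    by auto
  then have "plen vs = N (hor g) + ver_const * s"
    by (simp add: vs_def ver_const_def N_basis_def algebra_simps)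
  ultimately show ?thesis unfolding s_def by auto
qed

lemma polygon_lens_nonempty: "{plen vs | vs. polygon vs = g} \<noteq> {}"
  using ex_polygon[of g] by auto

lemma rho_le: "rho g \<le> N (hor g) + ver_const * sqrt \<bar>ver g\<bar>"
  using ex_polygon[of g] rho_le_plen by (metis order_trans)

lemma rho_lessD: "rho g < L \<Longrightarrow> \<exists>vs. polygon vs = g \<and> plen vs < L"
  unfolding rho_def using cInf_lessD[OF polygon_lens_nonempty] by blast

lemma rho_greatest: "(\<And>vs. polygon vs = g \<Longrightarrow> L \<le> plen vs) \<Longrightarrow> L \<le> rho g"
  unfolding rho_def using polygon_lens_nonempty by (intro cInf_greatest) auto

lemma rho_nonneg [simp]: "0 \<le> rho g"
  by (intro rho_greatest plen_nonneg)

lemma rho_0 [simp]: "rho 0 = 0"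
  using rho_le_plen[of "[]" 0] rho_nonneg[of 0] by simp

lemma rho_hor_le: "rho (Heis v 0) \<le> N v"
  using rho_le[of "Heis v 0"] by simp

lemma rho_triangle: "rho (g + h) \<le> rho g + rho h"
proof (rule field_le_epsilon)
  fix e :: real assume "e > 0"
  obtain vs where "polygon vs = g" "plen vs < rho g + e / 2"
    using rho_lessD[of g "rho g + e / 2"] \<open>e > 0\<close> by auto
  moreover obtain ws where "polygon ws = h" "plen ws < rho h + e / 2"
    using rho_lessD[of h "rho h + e / 2"] \<open>e > 0\<close> by auto
  ultimately show "rho (g + h) \<le> rho g + rho h + e"
    using rho_le_plen[of "vs @ ws" "g + h"] by simp
qed

lemma rho_minus [simp]: "rho (- g) = rho g"
proof -
  have "rho (- h) \<le> rho h" for h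
  proof (rule rho_greatest)
    fix vs assume "polygon vs = h"
    moreover have "plen (rev (map uminus vs)) = plen vs"
      by (simp add: rev_map[symmetric] o_def sum_list_rev)
    ultimately show "rho (- h) \<le> plen vs"
      using rho_le_plen[of "rev (map uminus vs)" "- h"] polygon_reverse[of vs] by metis
  qed
  from this[of g] this[of "- g"] show ?thesis by simp
qed

lemma rho_minus_commute: "rho (- x + y) = rho (- y + x)"
  using rho_minus[of "- x + y"] by (simp add: minus_add)

lemma rho_triangle_via: "rho (- x + z) \<le> rho (- x + y) + rho (- y + z)"
  using rho_triangle[of "- x + y" "- y + z"] by (simp add: add.assoc)

lemma N_hor_le_rho: "N (hor g) \<le> rho g"
proof (rule rho_greatest)
  have "N (hor (polygon vs)) \<le> plen vs" for vs
    by (induction vs) (auto intro: order_trans[OF N_triangle])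
  then show "\<And>vs. polygon vs = g \<Longrightarrow> N (hor g) \<le> plen vs" by blast
qed

text \<open>The vertical coordinate is a swept area, so it grows at most quadratically in the length.\<close>

lemma ver_le_rho: "\<bar>ver g\<bar> \<le> det2_const * (rho g)\<^sup>2"
proof -
  have hp: "N (hor (polygon vs)) \<le> plen vs" for vs
    by (induction vs) (auto intro: order_trans[OF N_triangle])
  have poly: "\<bar>ver (polygon vs)\<bar> \<le> det2_const * (plen vs)\<^sup>2" for vs
  proof (induction vs)
    case (Cons v vs)
    have "\<bar>det2 v (hor (polygon vs))\<bar> \<le> det2_const * (N v * plen vs)"
      using det2_const_pos
      by (intro order_trans[OF det2_le] mult_left_mono hp) auto
    then have "\<bar>ver (polygon (v # vs))\<bar> \<le> det2_const * (plen vs)\<^sup>2 + det2_const * (N v * plen vs)"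
      using Cons by simp
    also have "\<dots> \<le> det2_const * (plen (v # vs))\<^sup>2"
    proof -
      have "(plen vs)\<^sup>2 + N v * plen vs \<le> (plen (v # vs))\<^sup>2"
        using mult_nonneg_nonneg[OF N_nonneg[of v] plen_nonneg[of vs]]
        by (simp add: power2_sum)
      then show ?thesis
        using det2_const_pos by (simp only: distrib_left[symmetric] mult_le_cancel_left_pos)
    qed
    finally show ?case .
  qed simp
  have "sqrt (\<bar>ver g\<bar> / det2_const) \<le> rho g"
  proof (rule rho_greatest)
    fix vs assume "polygon vs = g"
    then have "\<bar>ver g\<bar> / det2_const \<le> (plen vs)\<^sup>2"
      using poly[of vs] det2_const_pos by (simp add: field_simps)
    then show "sqrt (\<bar>ver g\<bar> / det2_const) \<le> plen vs"
      using plen_nonneg by (intro real_le_lsqrt) auto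
  qed
  then have "\<bar>ver g\<bar> / det2_const \<le> (rho g)\<^sup>2"
    by (rule sqrt_le_D)
  then show ?thesis using det2_const_pos by (simp add: field_simps)
qed

lemma rho_dil: assumes "s \<ge> 0" shows "rho (dil s g) = s * rho g"
proof -
  have le: "rho (dil s g) \<le> s * rho g" if "s > 0" for s g
  proof -
    have "rho (dil s g) / s \<le> rho g"
    proof (rule rho_greatest)
      fix vs assume vs: "polygon vs = g"
      have "plen (map (scaleR s) vs) = s * plen vs"
        using that by (simp add: o_def sum_list_const_mult)
      then show "rho (dil s g) / s \<le> plen vs"
        using rho_le_plen[of "map (scaleR s) vs" "dil s g"] vs that by (simp add: polygon_dil field_simps)
    qed
    then show ?thesis using that by (simp add: field_simps)
  qed
  show ?thesis
  proof (cases "s = 0")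
    case True then show ?thesis using heis_eqI[of "dil 0 g" 0] by simp
  next
    case False
    then have s: "s > 0" using assms by simp
    have "rho (dil (1/s) (dil s g)) \<le> 1/s * rho (dil s g)" by (rule le) (use s in simp)
    then show ?thesis using le[OF s, of g] s by (simp add: dil_dil field_simps)
  qed
qed

definition conj_const :: real where "conj_const = ver_const * sqrt det2_const"

lemma conj_const_pos: "0 < conj_const"
  using ver_const_pos det2_const_pos by (simp add: conj_const_def)

text \<open>The central correction caused by conjugation is a product of two lengths, and central elements cost only
the square root of their height.\<close>

lemma rho_conj_le: "rho (- g + h + g) \<le> rho h + conj_const * sqrt (rho h * N (hor g))"
proof -
  have "rho (Heis 0 (det2 (hor h) (hor g))) \<le> ver_const * sqrt \<bar>det2 (hor h) (hor g)\<bar>"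
    using rho_le[of "Heis 0 (det2 (hor h) (hor g))"] by simp
  also have "\<dots> \<le> ver_const * sqrt (det2_const * (rho h * N (hor g)))"
    using ver_const_pos det2_const_pos
    by (intro mult_left_mono real_sqrt_le_mono order_trans[OF det2_le] mult_right_mono N_hor_le_rho) auto
  finally show ?thesis
    using rho_triangle[of h "Heis 0 (det2 (hor h) (hor g))"]
    by (simp add: conj_eq conj_const_def real_sqrt_mult)
qed

end

section \<open>Calculus of absolutely continuous paths\<close>

text \<open>Finite families of intervals indexed by an arbitrary finite set occur when the intervals come from a
tagged division.\<close>

lemma absolutely_continuous_path_family:
  assumes "absolutely_continuous_path a b f" and "\<epsilon> > 0"
  shows "\<exists>\<delta>>0. \<forall>(I :: 'i set) s t. finite I \<longrightarrow> (\<forall>i\<in>I. a \<le> s i \<and> s i \<le> t i \<and> t i \<le> b) \<longrightarrow>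
      disjoint_family_on (\<lambda>i. {s i<..<t i}) I \<longrightarrow> (\<Sum>i\<in>I. t i - s i) < \<delta> \<longrightarrow>
      (\<Sum>i\<in>I. norm (f (t i) - f (s i))) < \<epsilon>"
proof -
  obtain \<delta> where \<delta>: "\<delta> > 0" "\<forall>(k::nat) s t.
      (\<forall>i<k. a \<le> s i \<and> s i \<le> t i \<and> t i \<le> b) \<longrightarrow>
      disjoint_family_on (\<lambda>i. {s i<..<t i}) {..<k} \<longrightarrow>
      (\<Sum>i<k. t i - s i) < \<delta> \<longrightarrow> (\<Sum>i<k. norm (f (t i) - f (s i))) < \<epsilon>"
    using assms(1)[unfolded absolutely_continuous_path_def, THEN spec, THEN mp, OF assms(2)] by blast
  show ?thesis
  proof (intro exI[of _ \<delta>] conjI allI impI)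
    fix I :: "'i set" and s t
    assume I: "finite I" "\<forall>i\<in>I. a \<le> s i \<and> s i \<le> t i \<and> t i \<le> b"
      "disjoint_family_on (\<lambda>i. {s i<..<t i}) I" "(\<Sum>i\<in>I. t i - s i) < \<delta>"
    obtain h where "bij_betw h {0..<card I} I"
      using ex_bij_betw_nat_finite[OF I(1)] by blast
    then have h: "bij_betw h {..<card I} I" by (simp add: atLeast0LessThan)
    have mem: "h i \<in> I" if "i < card I" for i using h that by (auto simp: bij_betw_def)
    have sum: "(\<Sum>i<card I. F (h i)) = (\<Sum>i\<in>I. F i)" for F :: "'i \<Rightarrow> real"
      by (rule sum.reindex_bij_betw[OF h])
    have "(\<Sum>i<card I. norm (f (t (h i)) - f (s (h i)))) < \<epsilon>"
    proof (rule \<delta>(2)[rule_format])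
      show "disjoint_family_on (\<lambda>i. {s (h i)<..<t (h i)}) {..<card I}"
        unfolding disjoint_family_on_def
      proof (intro ballI impI)
        fix i j assume "i \<in> {..<card I}" "j \<in> {..<card I}" "i \<noteq> j"
        then have "h i \<noteq> h j" "h i \<in> I" "h j \<in> I" using h mem by (auto simp: bij_betw_def inj_on_def)
        then show "{s (h i)<..<t (h i)} \<inter> {s (h j)<..<t (h j)} = {}"
          using I(3) by (simp add: disjoint_family_on_def)
      qed
      show "(\<Sum>i<card I. t (h i) - s (h i)) < \<delta>"
        using I(4) sum[of "\<lambda>i. t i - s i"] by simp
    qed (use I(2) mem in simp)
    then show "(\<Sum>i\<in>I. norm (f (t i) - f (s i))) < \<epsilon>"
      using sum[of "\<lambda>i. norm (f (t i) - f (s i))"] by simp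
  qed (rule \<delta>(1))
qed

lemma absolutely_continuous_path_subinterval:
  assumes "absolutely_continuous_path a b f" "a \<le> a'" "b' \<le> b"
  shows "absolutely_continuous_path a' b' f"
  unfolding absolutely_continuous_path_def
proof (intro allI impI)
  fix \<epsilon> :: real assume e: "\<epsilon> > 0"
  obtain \<delta> where \<delta>: "\<delta> > 0" "\<forall>(k::nat) s t.
      (\<forall>i<k. a \<le> s i \<and> s i \<le> t i \<and> t i \<le> b) \<longrightarrow>
      disjoint_family_on (\<lambda>i. {s i<..<t i}) {..<k} \<longrightarrow>
      (\<Sum>i<k. t i - s i) < \<delta> \<longrightarrow> (\<Sum>i<k. norm (f (t i) - f (s i))) < \<epsilon>"
    using assms(1)[unfolded absolutely_continuous_path_def, THEN spec, THEN mp, OF e] by blast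
  show "\<exists>\<delta>>0. \<forall>(k::nat) s t. (\<forall>i<k. a' \<le> s i \<and> s i \<le> t i \<and> t i \<le> b') \<longrightarrow>
      disjoint_family_on (\<lambda>i. {s i<..<t i}) {..<k} \<longrightarrow>
      (\<Sum>i<k. t i - s i) < \<delta> \<longrightarrow> (\<Sum>i<k. norm (f (t i) - f (s i))) < \<epsilon>"
  proof (intro exI[of _ \<delta>] conjI allI impI)
    fix k :: nat and s t
    assume "\<forall>i<k. a' \<le> s i \<and> s i \<le> t i \<and> t i \<le> b'" and "disjoint_family_on (\<lambda>i. {s i<..<t i}) {..<k}"
      and "(\<Sum>i<k. t i - s i) < \<delta>"
    moreover have "\<forall>i<k. a \<le> s i \<and> s i \<le> t i \<and> t i \<le> b" using calculation(1) assms(2,3) by force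
    ultimately show "(\<Sum>i<k. norm (f (t i) - f (s i))) < \<epsilon>" using \<delta>(2) by blast
  qed (rule \<delta>(1))
qed

lemma lipschitz_imp_absolutely_continuous_path:
  assumes "K-lipschitz_on {a..b} f"
  shows "absolutely_continuous_path a b f"
  unfolding absolutely_continuous_path_def
proof (intro allI impI)
  fix \<epsilon> :: real assume e: "\<epsilon> > 0"
  have K: "K \<ge> 0" using assms by (rule lipschitz_on_nonneg)
  show "\<exists>\<delta>>0. \<forall>(k::nat) s t. (\<forall>i<k. a \<le> s i \<and> s i \<le> t i \<and> t i \<le> b) \<longrightarrow>
      disjoint_family_on (\<lambda>i. {s i<..<t i}) {..<k} \<longrightarrow>
      (\<Sum>i<k. t i - s i) < \<delta> \<longrightarrow> (\<Sum>i<k. norm (f (t i) - f (s i))) < \<epsilon>"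
  proof (intro exI[of _ "\<epsilon> / (K + 1)"] conjI allI impI)
    fix k :: nat and s t
    assume *: "\<forall>i<k. a \<le> s i \<and> s i \<le> t i \<and> t i \<le> b" "(\<Sum>i<k. t i - s i) < \<epsilon> / (K + 1)"
    have "(\<Sum>i<k. norm (f (t i) - f (s i))) \<le> (\<Sum>i<k. K * (t i - s i))"
      using *(1) by (intro sum_mono) (force simp: dist_norm[symmetric] dist_real_def intro: order_trans[OF lipschitz_onD[OF assms]])
    also have "\<dots> = K * (\<Sum>i<k. t i - s i)" by (simp add: sum_distrib_left)
    also have "\<dots> \<le> K * (\<epsilon> / (K + 1))" using * K by (intro mult_left_mono) auto
    also have "\<dots> < \<epsilon>" using K e by (simp add: field_simps)
    finally show "(\<Sum>i<k. norm (f (t i) - f (s i))) < \<epsilon>" .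
  qed (use K e in auto)
qed

text \<open>Henstock's gauge makes this direct: on the exceptional null set, a gauge that stays in a thin open superset makes
the increments of \<open>f\<close> small by absolute continuity; elsewhere \<open>f\<close> is close to its linear approximation.\<close>

lemma absolutely_continuous_path_has_integral:
  fixes f :: "real \<Rightarrow> 'v::euclidean_space"
  assumes ab: "a \<le> b" and AC: "absolutely_continuous_path a b f" and Z: "negligible Z"
    and der: "\<And>t. t \<in> {a..b} - Z \<Longrightarrow> (f has_vector_derivative f' t) (at t within {a..b})"
  shows "(f' has_integral f b - f a) {a..b}"
proof -
  \<comment> \<open>On \<open>Z\<close> nothing is known about \<open>f'\<close>; the value \<open>0\<close> makes the Riemann sum over \<open>Z\<close> vanish.\<close>
  define g where "g t = (if t \<in> Z then 0 else f' t)" for t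
  have "(g has_integral f b - f a) (cbox a b)"
    unfolding has_integral
  proof (intro allI impI)
    fix e :: real assume e: "e > 0"
    define e' where "e' = e / 2 / (b - a + 1)"
    have e': "e' > 0" using e ab by (simp add: e'_def)
    obtain \<delta> where \<delta>: "\<delta> > 0" "\<forall>(I :: (real \<times> real set) set) s t. finite I \<longrightarrow> (\<forall>i\<in>I. a \<le> s i \<and> s i \<le> t i \<and> t i \<le> b) \<longrightarrow>
      disjoint_family_on (\<lambda>i. {s i<..<t i}) I \<longrightarrow> (\<Sum>i\<in>I. t i - s i) < \<delta> \<longrightarrow>
      (\<Sum>i\<in>I. norm (f (t i) - f (s i))) < e / 2"
      using absolutely_continuous_path_family[OF AC half_gt_zero[OF e]] by blast
    have Zs: "Z \<in> sets lebesgue" and Z0: "emeasure lebesgue Z = 0"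
      using Z by (auto simp: negligible_iff_null_sets)
    obtain T where T: "open T" "Z \<subseteq> T" "T - Z \<in> lmeasurable" "emeasure lebesgue (T - Z) < ennreal \<delta>"
      using sets_lebesgue_outer_open[OF Zs \<delta>(1)] by blast
    have "emeasure lebesgue T = emeasure lebesgue (T - Z)"
      using emeasure_Diff_null_set[of Z lebesgue T] Z T(1) by (auto simp: negligible_iff_null_sets)
    then have Te: "emeasure lebesgue T < ennreal \<delta>" using T(4) by simp
    then have Tm: "T \<in> lmeasurable" using T(1) by (auto intro!: fmeasurableI simp: less_top[symmetric] top_unique)
    then have Tmd: "measure lebesgue T < \<delta>" using Te \<delta>(1)
      by (metis emeasure_eq_measure2 ennreal_less_iff measure_nonneg)
    have "\<exists>d>0. (x \<in> Z \<longrightarrow> ball x d \<subseteq> T) \<and>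
       (x \<in> {a..b} - Z \<longrightarrow> (\<forall>y\<in>{a..b}. \<bar>y - x\<bar> < d \<longrightarrow> norm (f y - f x - (y - x) *\<^sub>R f' x) \<le> e' * \<bar>y - x\<bar>))" for x
    proof (cases "x \<in> Z")
      case True
      then show ?thesis using T(1,2) by (metis DiffD2 openE subsetD)
    next
      case False
      show ?thesis
      proof (cases "x \<in> {a..b}")
        case True
        then have "(f has_vector_derivative f' x) (at x within {a..b})" using der False by simp
        then show ?thesis
          using e' False unfolding has_vector_derivative_def has_derivative_within_alt real_norm_def by blast
      qed (use False in \<open>auto intro: exI[of _ 1]\<close>)
    qed
    then obtain d where d: "\<And>x. d x > 0" "\<And>x. x \<in> Z \<Longrightarrow> ball x (d x) \<subseteq> T"
      "\<And>x y. x \<in> {a..b} - Z \<Longrightarrow> y \<in> {a..b} \<Longrightarrow> \<bar>y - x\<bar> < d x \<Longrightarrow> norm (f y - f x - (y - x) *\<^sub>R f' x) \<le> e' * \<bar>y - x\<bar>"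
      by metis
    show "\<exists>\<gamma>. gauge \<gamma> \<and> (\<forall>\<D>. \<D> tagged_division_of cbox a b \<and> \<gamma> fine \<D> \<longrightarrow>
             norm ((\<Sum>(x, k)\<in>\<D>. measure lborel k *\<^sub>R g x) - (f b - f a)) < e)"
    proof (intro exI[of _ "\<lambda>x. ball x (d x)"] conjI allI impI)
      show "gauge (\<lambda>x. ball x (d x))" using d(1) by (simp add: gauge_def)
      fix D assume "D tagged_division_of cbox a b \<and> (\<lambda>x. ball x (d x)) fine D"
      then have D: "D tagged_division_of cbox a b" and fine: "\<And>x K. (x, K) \<in> D \<Longrightarrow> K \<subseteq> ball x (d x)"
        by (auto simp: fine_def)
      have finD: "finite D" using D by auto
      have K: "\<exists>u v. K = {u..v} \<and> u \<le> x \<and> x \<le> v \<and> a \<le> u \<and> v \<le> b \<and> Inf K = u \<and> Sup K = v \<and> measure lborel K = v - u"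
        if xKD: "(x, K) \<in> D" for x K
      proof -
        obtain u v where uv: "K = cbox u v" using tagged_division_ofD(4)[OF D xKD] by blast
        have "x \<in> K" "K \<subseteq> {a..b}" using tagged_division_ofD(2,3)[OF D xKD] by auto
        then show ?thesis using uv by (intro exI[of _ u] exI[of _ v]) auto
      qed
      define R where "R = (\<lambda>(x, K). measure lborel K *\<^sub>R g x - (f (Sup K) - f (Inf K)))"
      define D2 where "D2 = {p \<in> D. fst p \<in> Z}"
      have D2: "D2 \<subseteq> D" "finite D2" using finD by (auto simp: D2_def)
      have eq: "(\<Sum>(x, k)\<in>D. measure lborel k *\<^sub>R g x) - (f b - f a) = (\<Sum>p\<in>D. R p)"
        using additive_tagged_division_1[OF ab, of D f] D
        by (simp add: R_def sum_subtractf case_prod_unfold)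
      have "norm (\<Sum>p\<in>D. R p) \<le> (\<Sum>p\<in>D - D2. norm (R p)) + (\<Sum>p\<in>D2. norm (R p))"
        using sum_norm_le[of D R "\<lambda>p. norm (R p)"] sum.subset_diff[OF D2(1) finD, of "\<lambda>p. norm (R p)"] by simp
      moreover have "(\<Sum>p\<in>D - D2. norm (R p)) \<le> e' * (b - a)"
      proof -
        have "norm (R p) \<le> e' * measure lborel (snd p)" if p: "p \<in> D - D2" for p
        proof -
          obtain x K where xK: "p = (x, K)" by force
          obtain u v where uv: "K = {u..v}" "u \<le> x" "x \<le> v" "a \<le> u" "v \<le> b" "Inf K = u" "Sup K = v" "measure lborel K = v - u"
            using K p xK by (metis DiffD1)
          have xZ: "x \<notin> Z" using p xK by (auto simp: D2_def)
          have "u \<in> K" "v \<in> K" using uv by auto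
          then have "u \<in> ball x (d x)" "v \<in> ball x (d x)"
            using fine[of x K] p xK by blast+
          then have 1: "norm (f v - f x - (v - x) *\<^sub>R f' x) \<le> e' * \<bar>v - x\<bar>"
            "norm (f u - f x - (u - x) *\<^sub>R f' x) \<le> e' * \<bar>u - x\<bar>"
            using d(3)[of x v] d(3)[of x u] uv xZ by (auto simp: dist_real_def)
          have "R p = (f u - f x - (u - x) *\<^sub>R f' x) - (f v - f x - (v - x) *\<^sub>R f' x)"
            using xZ order_trans[OF uv(2,3)] by (simp add: R_def xK uv g_def algebra_simps)
          then have "norm (R p) \<le> e' * \<bar>u - x\<bar> + e' * \<bar>v - x\<bar>"
            using 1 norm_triangle_ineq4 by (smt (verit))
          also have "\<dots> = e' * measure lborel (snd p)" using uv by (simp add: xK algebra_simps)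
          finally show ?thesis .
        qed
        then have "(\<Sum>p\<in>D - D2. norm (R p)) \<le> (\<Sum>p\<in>D - D2. e' * measure lborel (snd p))"
          by (rule sum_mono)
        also have "\<dots> \<le> (\<Sum>p\<in>D. e' * measure lborel (snd p))"
          using finD e' by (intro sum_mono2) auto
        also have "\<dots> = e' * (b - a)"
          using additive_content_tagged_division[OF D] ab
          by (simp add: sum_distrib_left[symmetric] case_prod_unfold)
        finally show ?thesis .
      qed
      moreover have "(\<Sum>p\<in>D2. norm (R p)) < e / 2"
      proof -
        have part: "D2 tagged_partial_division_of cbox a b"
          using D D2(1) by (metis tagged_division_of_def tagged_partial_division_subset)
        have div: "snd ` D2 division_of \<Union>(snd ` D2)"
          using part by (rule partial_division_of_tagged_division)
        have "(\<Sum>p\<in>D2. Sup (snd p) - Inf (snd p)) = (\<Sum>(x,K)\<in>D2. measure lborel K)"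
          using K D2(1) by (intro sum.cong) force+
        also have "\<dots> = sum (measure lborel) (snd ` D2)"
          by (rule sum.over_tagged_division_lemma[OF tagged_partial_division_of_Union_self[OF part]])
            (simp add: content_eq_0_interior)
        also have "\<dots> = measure lebesgue (\<Union>(snd ` D2))"
        proof -
          have "measure lborel L = measure lebesgue L" if L: "L \<in> snd ` D2" for L
          proof -
            obtain u v where "L = {u..v}" using L K D2(1) by force
            then show ?thesis by simp
          qed
          then show ?thesis using content_division[OF div] by simp
        qed
        also have "\<dots> \<le> measure lebesgue T"
        proof (rule measure_mono_fmeasurable)
          show "\<Union>(snd ` D2) \<subseteq> T" using fine d(2) unfolding D2_def by fastforce
          show "\<Union>(snd ` D2) \<in> sets lebesgue"
          proof (rule sets.finite_Union)
            show "snd ` D2 \<subseteq> sets lebesgue"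
            proof
              fix L assume "L \<in> snd ` D2"
              then obtain u v where "L = {u..v}" using K D2(1) by force
              then show "L \<in> sets lebesgue" by simp
            qed
          qed (use D2 in simp)
        qed (rule Tm)
        finally have small: "(\<Sum>p\<in>D2. Sup (snd p) - Inf (snd p)) < \<delta>" using Tmd by simp
        have disj: "disjoint_family_on (\<lambda>p. {Inf (snd p)<..<Sup (snd p)}) D2"
          unfolding disjoint_family_on_def
        proof (intro ballI impI)
          fix p q assume pq: "p \<in> D2" "q \<in> D2" "p \<noteq> q"
          obtain x K y L where xy: "p = (x, K)" "q = (y, L)" by (metis surj_pair)
          have "interior K \<inter> interior L = {}"
            using tagged_division_ofD(5)[OF D] pq xy D2(1) by blast
          moreover have "interior K = {Inf K<..<Sup K}" if "(x, K) \<in> D" for x K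
            using K[OF that] by (elim exE conjE) simp
          then have "interior K = {Inf K<..<Sup K}" "interior L = {Inf L<..<Sup L}"
            using pq xy D2(1) by blast+
          ultimately show "{Inf (snd p)<..<Sup (snd p)} \<inter> {Inf (snd q)<..<Sup (snd q)} = {}"
            by (simp add: xy)
        qed
        have "(\<Sum>p\<in>D2. norm (f (Sup (snd p)) - f (Inf (snd p)))) < e / 2"
          by (rule \<delta>(2)[rule_format, OF D2(2) _ disj small]) (use K D2(1) in force)
        moreover have "norm (R p) = norm (f (Sup (snd p)) - f (Inf (snd p)))" if "p \<in> D2" for p
          using that by (auto simp: R_def g_def D2_def case_prod_unfold norm_minus_commute)
        ultimately show ?thesis by simp
      qed
      moreover have "e' * (b - a) \<le> e / 2" using ab e by (simp add: e'_def field_simps)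
      ultimately show "norm ((\<Sum>(x, k)\<in>D. measure lborel k *\<^sub>R g x) - (f b - f a)) < e"
        unfolding eq by linarith
    qed
  qed
  then show ?thesis
    by (intro has_integral_spike[OF Z, of _ f' g]) (auto simp: g_def)
qed

text \<open>The integrals of \<open>f'\<close> over the members of a division are increments of \<open>f\<close>, and absolute
continuity bounds the sum of their norms on short intervals.\<close>

lemma absolutely_continuous_path_derivative_absolutely_integrable:
  fixes f :: "real \<Rightarrow> 'v::euclidean_space"
  assumes ab: "a \<le> b" and AC: "absolutely_continuous_path a b f" and Z: "negligible Z"
    and der: "\<And>t. t \<in> {a..b} - Z \<Longrightarrow> (f has_vector_derivative f' t) (at t within {a..b})"
  shows "f' absolutely_integrable_on {a..b}"
proof -
  have int: "(f' has_integral f v - f u) {u..v}" if "a \<le> u" "u \<le> v" "v \<le> b" for u v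
  proof (rule absolutely_continuous_path_has_integral[OF that(2) _ Z])
    show "absolutely_continuous_path u v f"
      using absolutely_continuous_path_subinterval[OF AC] that by simp
    show "(f has_vector_derivative f' t) (at t within {u..v})" if "t \<in> {u..v} - Z" for t
      by (rule has_vector_derivative_within_subset[OF der]) (use that \<open>a \<le> u\<close> \<open>v \<le> b\<close> in auto)
  qed
  obtain \<delta> where \<delta>: "\<delta> > 0" "\<forall>(I :: real set set) s t. finite I \<longrightarrow> (\<forall>i\<in>I. a \<le> s i \<and> s i \<le> t i \<and> t i \<le> b) \<longrightarrow>
      disjoint_family_on (\<lambda>i. {s i<..<t i}) I \<longrightarrow> (\<Sum>i\<in>I. t i - s i) < \<delta> \<longrightarrow>
      (\<Sum>i\<in>I. norm (f (t i) - f (s i))) < 1"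
    using absolutely_continuous_path_family[OF AC zero_less_one] by blast
  \<comment> \<open>Intervals shorter than \<open>\<delta>\<close> have variation at most 1; finitely many of them cover.\<close>
  have short: "f' absolutely_integrable_on {u..v}" if uv: "a \<le> u" "u \<le> v" "v \<le> b" "v - u < \<delta>" for u v
  proof -
    have "f' absolutely_integrable_on cbox u v"
    proof (rule bounded_variation_absolutely_integrable_interval)
      show "f' integrable_on cbox u v" using int[OF uv(1-3)] by auto
      fix d assume d: "d division_of cbox u v"
      have K: "\<exists>p q. K = {p..q} \<and> p \<le> q \<and> u \<le> p \<and> q \<le> v \<and> Inf K = p \<and> Sup K = q \<and> measure lborel K = q - p"
        if Kd: "K \<in> d" for K
      proof -
        obtain p q where pq: "K = cbox p q" using division_ofD(4)[OF d Kd] by blast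
        have "K \<noteq> {}" "K \<subseteq> {u..v}" using division_ofD(2,3)[OF d Kd] by auto
        then show ?thesis using pq by (intro exI[of _ p] exI[of _ q]) auto
      qed
      have "(\<Sum>K\<in>d. norm (f (Sup K) - f (Inf K))) < 1"
      proof (rule \<delta>(2)[rule_format])
        show "finite d" using d by blast
        show "a \<le> Inf K \<and> Inf K \<le> Sup K \<and> Sup K \<le> b" if "K \<in> d" for K
          using K[OF that] uv by auto
        show "disjoint_family_on (\<lambda>K. {Inf K<..<Sup K}) d"
          unfolding disjoint_family_on_def
        proof (intro ballI impI)
          fix K L assume KL: "K \<in> d" "L \<in> d" "K \<noteq> L"
          then have "interior K \<inter> interior L = {}" using division_ofD(5)[OF d] by blast
          moreover have "interior K = {Inf K<..<Sup K}" if "K \<in> d" for K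
            using K[OF that] by (elim exE conjE) simp
          then have "interior K = {Inf K<..<Sup K}" "interior L = {Inf L<..<Sup L}"
            using KL by blast+
          ultimately show "{Inf K<..<Sup K} \<inter> {Inf L<..<Sup L} = {}" by simp
        qed
        have "(\<Sum>K\<in>d. Sup K - Inf K) = sum (measure lborel) d"
          using K by (intro sum.cong) force+
        also have "\<dots> = v - u" using additive_content_division[OF d] uv by simp
        finally show "(\<Sum>K\<in>d. Sup K - Inf K) < \<delta>" using uv by simp
      qed
      moreover have "norm (integral K f') = norm (f (Sup K) - f (Inf K))" if "K \<in> d" for K
        using K[OF that] uv int by (metis integral_unique order_trans)
      ultimately show "(\<Sum>K\<in>d. norm (integral K f')) \<le> 1" by simp
    qed
    then show ?thesis by simp
  qed
  have "f' absolutely_integrable_on {a..v}" if "a \<le> v" "v \<le> b" "v - a < real n * (\<delta> / 2)" for n v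
    using that
  proof (induction n arbitrary: v)
    case (Suc n)
    define u where "u = max a (v - \<delta> / 2)"
    have u: "a \<le> u" "u \<le> v" "v - u < \<delta>" using Suc \<delta>(1) by (auto simp: u_def)
    have "f' absolutely_integrable_on {a..u}"
    proof (cases "n = 0")
      case True
      then have "u = a" using Suc by (simp add: u_def)
      then show ?thesis using short[of a a] ab \<delta>(1) by simp
    next
      case False
      then have "0 < real n * (\<delta> / 2)" using \<delta>(1) by simp
      moreover have "real (Suc n) * (\<delta> / 2) = real n * (\<delta> / 2) + \<delta> / 2" by (simp add: field_simps)
      ultimately have "u - a < real n * (\<delta> / 2)"
        using Suc.prems by (simp add: u_def max_def)
      then show ?thesis using Suc.prems u by (intro Suc.IH) auto
    qed
    moreover have "f' absolutely_integrable_on {u..v}" using u Suc by (intro short) auto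
    moreover have "{a..v} = {a..u} \<union> {u..v}" using u by auto
    ultimately show ?case by (metis absolutely_integrable_Un)
  qed simp
  moreover obtain n :: nat where "b - a < real n * (\<delta> / 2)"
    using reals_Archimedean3[of "\<delta> / 2"] \<delta>(1) by (metis half_gt_zero)
  ultimately show ?thesis using ab by blast
qed

lemma absolutely_continuous_path_uniform:
  assumes "absolutely_continuous_path a b f" "\<epsilon> > 0"
  shows "\<exists>\<delta>>0. \<forall>s t. a \<le> s \<longrightarrow> s \<le> t \<longrightarrow> t \<le> b \<longrightarrow> t - s < \<delta> \<longrightarrow> norm (f t - f s) < \<epsilon>"
proof -
  obtain \<delta> where \<delta>: "\<delta> > 0" "\<forall>(I :: unit set) s t. finite I \<longrightarrow> (\<forall>i\<in>I. a \<le> s i \<and> s i \<le> t i \<and> t i \<le> b) \<longrightarrow>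
      disjoint_family_on (\<lambda>i. {s i<..<t i}) I \<longrightarrow> (\<Sum>i\<in>I. t i - s i) < \<delta> \<longrightarrow>
      (\<Sum>i\<in>I. norm (f (t i) - f (s i))) < \<epsilon>"
    using absolutely_continuous_path_family[OF assms] by blast
  have "norm (f t - f s) < \<epsilon>" if "a \<le> s" "s \<le> t" "t \<le> b" "t - s < \<delta>" for s t
    using \<delta>(2)[rule_format, of "{()}" "\<lambda>_. s" "\<lambda>_. t"] that by (simp add: disjoint_family_on_def)
  then show ?thesis using \<delta>(1) by blast
qed

section \<open>Matrices\<close>

definition upper :: "real \<Rightarrow> real \<Rightarrow> real \<Rightarrow> real^3^3" where
  "upper a b c = vector [vector [1, a, b], vector [0, 1, c], vector [0, 0, 1]]"

definition hmat :: "real \<times> real \<Rightarrow> real^3^3" where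
  "hmat v = vector [vector [0, fst v, 0], vector [0, 0, snd v], vector [0, 0, 0]]"

definition mat_of :: "heis \<Rightarrow> real^3^3" where
  "mat_of g = upper (fst (hor g)) (ver g + fst (hor g) * snd (hor g) / 2) (snd (hor g))"

definition of_mat :: "real^3^3 \<Rightarrow> heis" where
  "of_mat M = Heis (M$1$2, M$2$3) (M$1$3 - M$1$2 * M$2$3 / 2)"

lemma upper_sel [simp]: "upper a b c $ 1 $ 2 = a" "upper a b c $ 1 $ 3 = b" "upper a b c $ 2 $ 3 = c"
  by (auto simp: upper_def)

lemma upper_mult: "upper a b c ** upper a' b' c' = upper (a + a') (b' + a * c' + b) (c + c')"
  by (simp add: upper_def matrix_matrix_mult_def vec_eq_iff forall_3 sum_3)

lemma upper_mult_hmat: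
  "(upper a b c ** hmat v) $ 1 $ 2 = fst v" "(upper a b c ** hmat v) $ 2 $ 3 = snd v"
  "(upper a b c ** hmat v) $ 1 $ 3 = a * snd v"
  by (auto simp: upper_def hmat_def matrix_matrix_mult_def sum_3)

lemma of_mat_mat_of [simp]: "of_mat (mat_of g) = g"
  by (rule heis_eqI) (auto simp: of_mat_def mat_of_def)

lemma mat_of_eq_iff [simp]: "mat_of g = mat_of h \<longleftrightarrow> g = h"
  by (metis of_mat_mat_of)

lemma mat_of_0: "mat_of 0 = mat 1"
  by (simp add: mat_of_def upper_def mat_def vec_eq_iff forall_3)

lemma mat_of_plus: "mat_of (g + h) = mat_of g ** mat_of h"
  unfolding mat_of_def upper_mult
  by (rule arg_cong3[of _ _ _ _ _ _ upper]) (auto simp: det2_def field_simps)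

lemma matrix_inv_eqI:
  fixes A B :: "real^'n^'n"
  assumes "A ** B = mat 1" "B ** A = mat 1"
  shows "matrix_inv A = B"
proof -
  have "A ** matrix_inv A = mat 1 \<and> matrix_inv A ** A = mat 1"
    unfolding matrix_inv_def using assms by (rule someI[of "\<lambda>A'. A ** A' = mat 1 \<and> A' ** A = mat 1", OF conjI])
  then show ?thesis using assms by (metis matrix_mul_assoc matrix_mul_lid matrix_mul_rid)
qed

lemma matrix_inv_mat_of: "matrix_inv (mat_of g) = mat_of (- g)"
  by (rule matrix_inv_eqI) (simp_all add: mat_of_plus[symmetric] mat_of_0)

lemma carrier_HR: "carrier HR = range mat_of"
proof -
  have "x \<in> \<real>" for x :: real
    using Reals_of_real[where 'a = real, of x] by simp
  then have c: "carrier HR = {upper a b c | a b c. True}"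
    by (simp add: heisenberg_group_def upper_def)
  have 1: "upper a b c \<in> range mat_of" for a b c
    by (rule range_eqI[of _ _ "Heis (a, c) (b - a * c / 2)"]) (simp add: mat_of_def)
  have "{upper a b c | a b c. True} = range mat_of"
  proof (intro subset_antisym subsetI)
    fix M assume "M \<in> {upper a b c | a b c. True}"
    then obtain a b c where "M = upper a b c" by blast
    then show "M \<in> range mat_of" using 1 by simp
  qed (auto simp: mat_of_def)
  then show ?thesis using c by simp
qed

lemma horizontal_eq: "horizontal = range hmat"
  by (auto simp: horizontal_def hmat_def image_def)

lemma hmat_linear: "hmat (u + v) = hmat u + hmat v" "hmat (c *\<^sub>R v) = c *\<^sub>R hmat v"
  by (auto simp: hmat_def vec_eq_iff forall_3)

lemma hmat_eq_0_iff: "hmat v = 0 \<longleftrightarrow> v = 0"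
  by (auto simp: hmat_def vec_eq_iff forall_3 prod_eq_iff)

section \<open>The Carnot-Caratheodory distance of a norm\<close>

text \<open>The integral lies within any error of a Riemann sum, to which the triangle inequality applies.\<close>

lemma (in plane_norm) N_integral_le:
  fixes f :: "real \<Rightarrow> real \<times> real"
  assumes f: "(f has_integral I) {s..t}" and Nf: "((\<lambda>x. N (f x)) has_integral J) {s..t}"
  shows "N I \<le> J"
proof (rule field_le_epsilon)
  fix e :: real assume e: "e > 0"
  define d where "d = e / (N_basis + 1)"
  have d: "d > 0" using e N_basis_pos by (simp add: d_def)
  obtain g1 where g1: "gauge g1" "\<forall>D. D tagged_division_of {s..t} \<and> g1 fine D \<longrightarrow>
      norm ((\<Sum>(x,k)\<in>D. measure lborel k *\<^sub>R f x) - I) < d"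
    using f[THEN has_integral_real[THEN iffD1], THEN spec, THEN mp, OF d] by (elim exE conjE) (rule that)
  obtain g2 where g2: "gauge g2" "\<forall>D. D tagged_division_of {s..t} \<and> g2 fine D \<longrightarrow>
      norm ((\<Sum>(x,k)\<in>D. measure lborel k *\<^sub>R N (f x)) - J) < d"
    using Nf[THEN has_integral_real[THEN iffD1], THEN spec, THEN mp, OF d] by (elim exE conjE) (rule that)
  obtain D where D: "D tagged_division_of {s..t}" "(\<lambda>x. g1 x \<inter> g2 x) fine D"
    using fine_division_exists_real[OF gauge_Int[OF g1(1) g2(1)]] by blast
  have fine: "g1 fine D" "g2 fine D" using D(2) by (auto simp: fine_Int)
  have Nsum: "N (\<Sum>p\<in>A. F p) \<le> (\<Sum>p\<in>A. N (F p))" for F :: "real \<times> real set \<Rightarrow> real \<times> real" and A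
    by (induction A rule: infinite_finite_induct) (auto intro: order_trans[OF N_triangle])
  define R where "R = (\<Sum>(x,k)\<in>D. measure lborel k *\<^sub>R f x)"
  have "N R \<le> (\<Sum>(x,k)\<in>D. measure lborel k *\<^sub>R N (f x))"
    unfolding R_def using Nsum[of "\<lambda>(x,k). measure lborel k *\<^sub>R f x" D] by (simp add: case_prod_unfold)
  also have "\<dots> \<le> J + d" using g2(2)[rule_format, OF conjI[OF D(1) fine(2)]] by (simp add: case_prod_unfold)
  finally have "N R \<le> J + d" .
  moreover have "\<bar>N R - N I\<bar> \<le> N_basis * d"
    using N_lipschitz[of R I] g1(2)[rule_format, OF conjI[OF D(1) fine(1)]] N_basis_pos unfolding R_def[symmetric]
    by (meson less_imp_le mult_left_mono order_trans)
  moreover have "d * (N_basis + 1) = e" using N_basis_pos by (simp add: d_def)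
  then have "d + N_basis * d = e" by (simp add: algebra_simps)
  ultimately show "N I \<le> J + e" by linarith
qed

text \<open>Horizontal matrices are nilpotent, so a left-translated one-parameter subgroup is a quadratic polynomial in the
parameter.\<close>

lemma segment_polynomial:
  "mat_of (g + Heis (t *\<^sub>R v) 0) =
    mat_of g + t *\<^sub>R (mat_of g ** hmat v) + (t\<^sup>2 / 2) *\<^sub>R (mat_of g ** hmat v ** hmat v)"
  "mat_of (g + Heis (t *\<^sub>R v) 0) ** hmat v = mat_of g ** hmat v + t *\<^sub>R (mat_of g ** hmat v ** hmat v)"
  by (auto simp: mat_of_def upper_def hmat_def matrix_matrix_mult_def vec_eq_iff forall_3 sum_3
      det2_def power2_eq_square field_simps)

lemma segment_has_vector_derivative:
  "((\<lambda>t. mat_of (g + Heis ((t - r) *\<^sub>R v) 0)) has_vector_derivative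
     mat_of (g + Heis ((t - r) *\<^sub>R v) 0) ** hmat v) (at t within S)"
  unfolding segment_polynomial(2) unfolding segment_polynomial(1)
  by (auto intro!: derivative_eq_intros)

lemma segment_lipschitz:
  "\<exists>K. K-lipschitz_on {r..r + 1} (\<lambda>t. mat_of (g + Heis ((t - r) *\<^sub>R v) 0))"
proof -
  define A where "A = mat_of g ** hmat v"
  define B where "B = A ** hmat v"
  have "norm (mat_of (g + Heis ((s - r) *\<^sub>R v) 0) - mat_of (g + Heis ((t - r) *\<^sub>R v) 0))
      \<le> (norm A + norm B) * \<bar>s - t\<bar>" if st: "s \<in> {r..r+1}" "t \<in> {r..r+1}" for s t
  proof -
    have sq: "(s - t) * ((s - r) + (t - r)) / 2 = (s - r)\<^sup>2 / 2 - (t - r)\<^sup>2 / 2"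
      by (simp add: power2_eq_square field_simps)
    have "mat_of (g + Heis ((s - r) *\<^sub>R v) 0) - mat_of (g + Heis ((t - r) *\<^sub>R v) 0)
      = (s - t) *\<^sub>R A + ((s - t) * ((s - r) + (t - r)) / 2) *\<^sub>R B"
      unfolding segment_polynomial(1) A_def[symmetric] B_def[symmetric] sq
      by (simp add: scaleR_left_diff_distrib)
    also have "norm \<dots> \<le> \<bar>s - t\<bar> * norm A + \<bar>(s - t) * ((s - r) + (t - r)) / 2\<bar> * norm B"
      by (rule order_trans[OF norm_triangle_ineq]) simp
    also have "\<bar>(s - t) * ((s - r) + (t - r)) / 2\<bar> \<le> \<bar>s - t\<bar> * 1"
      using st unfolding times_divide_eq_right[symmetric] abs_mult
      by (intro mult_left_mono) auto
    finally show ?thesis by (simp add: algebra_simps mult_right_mono)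
  qed
  then show ?thesis
    by (intro exI[of _ "norm A + norm B"]) (auto simp: lipschitz_on_def dist_norm)
qed

text \<open>Polygons are realised by Lipschitz curves of constant speed \<open>v\<close> on each unit interval. The finite set \<open>Z\<close> holds
the corners; it contains \<open>0\<close> so that off \<open>Z\<close> the parameter interval is not a single point and derivatives are unique.\<close>

lemma (in plane_norm) polygon_path:
  "\<exists>\<xi> h Z K. \<xi> 0 = mat_of x \<and> \<xi> (real (length vs)) = mat_of (x + polygon vs) \<and> range \<xi> \<subseteq> range mat_of \<and>
     K-lipschitz_on {0..real (length vs)} \<xi> \<and> finite Z \<and> 0 \<in> Z \<and>
     (\<forall>t\<in>{0..real (length vs)} - Z. (\<xi> has_vector_derivative \<xi> t ** hmat (h t)) (at t within {0..real (length vs)})) \<and>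
     ((\<lambda>t. N (h t)) has_integral plen vs) {0..real (length vs)}"
proof (induction vs rule: rev_induct)
  case Nil
  have "((\<lambda>t. N (0::real\<times>real)) has_integral 0) {0..0::real}" by simp
  then show ?case
    by (intro exI[of _ "\<lambda>_. mat_of x"] exI[of _ "\<lambda>_. 0"] exI[of _ "{0}"] exI[of _ 0])
      (auto simp: lipschitz_on_def)
next
  case (snoc v vs)
  define n where "n = real (length vs)"
  have n: "real (length (vs @ [v])) = n + 1" "n \<ge> 0" by (auto simp: n_def)
  obtain \<xi> h Z K where IH: "\<xi> 0 = mat_of x" "\<xi> n = mat_of (x + polygon vs)" "range \<xi> \<subseteq> range mat_of"
    "K-lipschitz_on {0..n} \<xi>" "finite Z" "0 \<in> Z"
    "\<And>t. t \<in> {0..n} - Z \<Longrightarrow> (\<xi> has_vector_derivative \<xi> t ** hmat (h t)) (at t within {0..n})"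
    "((\<lambda>t. N (h t)) has_integral plen vs) {0..n}"
    using snoc unfolding n_def[symmetric] by blast
  define \<sigma> where "\<sigma> t = mat_of (x + polygon vs + Heis ((t - n) *\<^sub>R v) 0)" for t
  obtain K' where K': "K'-lipschitz_on {n..n+1} \<sigma>" using segment_lipschitz unfolding \<sigma>_def by blast
  have H0: "Heis 0 0 = 0" by (simp add: zero_heis_def)
  have \<sigma>n: "\<xi> n = \<sigma> n" by (simp add: \<sigma>_def IH(2) H0)
  define \<xi>' where "\<xi>' t = (if t \<le> n then \<xi> t else \<sigma> t)" for t
  define h' where "h' t = (if t \<le> n then h t else v)" for t
  have lip: "(max K K')-lipschitz_on {0..n+1} \<xi>'"
    unfolding \<xi>'_def by (rule lipschitz_on_concat_max[OF IH(4) K' \<sigma>n])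
  have der: "(\<xi>' has_vector_derivative \<xi>' t ** hmat (h' t)) (at t within {0..n+1})"
    if t: "t \<in> {0..n+1} - insert n Z" for t
  proof (cases "t < n")
    case True
    have "(\<xi> has_vector_derivative \<xi> t ** hmat (h t)) (at t within {0..n})"
      using IH(7) t True by auto
    moreover have "at t within {0..n} = at t within {0..n+1}"
      by (rule at_within_nhd[of _ "{..<n}"]) (use True in auto)
    ultimately have "(\<xi> has_vector_derivative \<xi> t ** hmat (h t)) (at t within {0..n+1})" by simp
    then have "(\<xi>' has_vector_derivative \<xi> t ** hmat (h t)) (at t within {0..n+1})"
      by (rule has_vector_derivative_transform_within[of _ _ _ _ "n - t"])
        (use True t in \<open>auto simp: \<xi>'_def dist_real_def\<close>)
    then show ?thesis using True by (simp add: \<xi>'_def h'_def)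
  next
    case False
    have "(\<sigma> has_vector_derivative \<sigma> t ** hmat v) (at t within {0..n+1})"
      unfolding \<sigma>_def by (rule segment_has_vector_derivative)
    then have "(\<xi>' has_vector_derivative \<sigma> t ** hmat v) (at t within {0..n+1})"
      by (rule has_vector_derivative_transform_within[of _ _ _ _ "t - n"])
        (use False t in \<open>auto simp: \<xi>'_def dist_real_def\<close>)
    then show ?thesis using False t by (simp add: \<xi>'_def h'_def)
  qed
  have "((\<lambda>t. N (h' t)) has_integral plen vs) {0..n}"
    by (rule has_integral_eq[OF _ IH(8)]) (simp add: h'_def)
  moreover have "((\<lambda>t. N (h' t)) has_integral N v) {n..n+1}"
  proof (rule has_integral_spike[of "{n}" _ _ "\<lambda>_. N v"])
    show "((\<lambda>_. N v) has_integral N v) {n..n+1}"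
      using has_integral_const_real[of "N v" n "n + 1"] by simp
  qed (auto simp: h'_def)
  ultimately have int: "((\<lambda>t. N (h' t)) has_integral plen (vs @ [v])) {0..n+1}"
    using has_integral_combine[of 0 n "n + 1"] n by simp
  show ?case unfolding n(1)
  proof (intro exI[of _ \<xi>'] exI[of _ h'] exI[of _ "insert n Z"] exI[of _ "max K K'"] conjI)
    show "\<xi>' (n + 1) = mat_of (x + polygon (vs @ [v]))"
      by (simp add: \<xi>'_def \<sigma>_def add.assoc)
    show "range \<xi>' \<subseteq> range mat_of"
      using IH(3) by (auto simp: \<xi>'_def \<sigma>_def)
    show "\<forall>t\<in>{0..n + 1} - insert n Z.
        (\<xi>' has_vector_derivative \<xi>' t ** hmat (h' t)) (at t within {0..n + 1})"
      using der by blast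
    show "\<xi>' 0 = mat_of x" using IH(1) n(2) by (simp add: \<xi>'_def)
  qed (use IH(5,6) lip int in auto)
qed

lemma (in plane_norm) path_length_polygon:
  assumes \<Phi>: "\<And>v. \<Phi> (hmat v) = N v"
  shows "\<exists>a b \<xi>. a \<le> b \<and> admissible a b \<xi> \<and> \<xi> a = mat_of x \<and> \<xi> b = mat_of (x + polygon vs) \<and>
    path_length_wrt \<Phi> a b \<xi> = plen vs"
proof -
  define n where "n = real (length vs)"
  obtain \<xi> h Z K where IH: "\<xi> 0 = mat_of x" "\<xi> n = mat_of (x + polygon vs)" "range \<xi> \<subseteq> range mat_of"
    "K-lipschitz_on {0..n} \<xi>" "finite Z" "0 \<in> Z"
    "\<And>t. t \<in> {0..n} - Z \<Longrightarrow> (\<xi> has_vector_derivative \<xi> t ** hmat (h t)) (at t within {0..n})"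
    "((\<lambda>t. N (h t)) has_integral plen vs) {0..n}"
    using polygon_path[of x vs] unfolding n_def[symmetric] by blast
  have vd: "vector_derivative \<xi> (at t within {0..n}) = \<xi> t ** hmat (h t)" if "t \<in> {0..n} - Z" for t
  proof -
    have "0 < n" using that IH(6) by (cases "t = 0") auto
    moreover have "cbox 0 n = {0..n}" by simp
    ultimately show ?thesis
      using IH(7)[OF that] that vector_derivative_within_cbox[where a = 0 and b = n and x = t and f = \<xi>]
      by (metis DiffD1)
  qed
  have Zn: "negligible Z" using IH(5) by (rule negligible_finite)
  have nullZ: "Z \<inter> {0..n} \<in> null_sets (lebesgue_on {0..n})"
    using Zn by (simp add: null_sets_restrict_space negligible_iff_null_sets[symmetric] negligible_Int)
  have tn: "translated_norm \<Phi> (\<xi> t) (vector_derivative \<xi> (at t within {0..n})) = N (h t)" if "t \<in> {0..n} - Z" for t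
  proof -
    obtain g where g: "\<xi> t = mat_of g" using IH(3) by auto
    show ?thesis
      using \<Phi> by (simp add: translated_norm_def vd[OF that] g matrix_inv_mat_of matrix_mul_assoc
        mat_of_plus[symmetric] mat_of_0)
  qed
  have "(\<lambda>t. N (h t)) absolutely_integrable_on {0..n}"
    using IH(8) by (intro nonnegative_absolutely_integrable_1) auto
  then have "(\<lambda>t. translated_norm \<Phi> (\<xi> t) (vector_derivative \<xi> (at t within {0..n}))) absolutely_integrable_on {0..n}"
    by (rule absolutely_integrable_spike[OF _ Zn]) (rule tn)
  then have "path_length_wrt \<Phi> 0 n \<xi> = integral {0..n} (\<lambda>t. translated_norm \<Phi> (\<xi> t) (vector_derivative \<xi> (at t within {0..n})))"
    unfolding path_length_wrt_def by (intro lebesgue_integral_eq_integral absolutely_integrable_imp_integrable) auto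
  also have "\<dots> = integral {0..n} (\<lambda>t. N (h t))"
    by (rule integral_spike[OF Zn]) (use tn in auto)
  also have "\<dots> = plen vs" using IH(8) by (rule integral_unique)
  finally have len: "path_length_wrt \<Phi> 0 n \<xi> = plen vs" .
  have "admissible 0 n \<xi>"
    unfolding admissible_def
  proof (intro conjI)
    show "\<xi> ` {0..n} \<subseteq> carrier HR" using IH(3) by (auto simp: carrier_HR)
    show "absolutely_continuous_path 0 n \<xi>" by (rule lipschitz_imp_absolutely_continuous_path[OF IH(4)])
    show "AE t in lebesgue_on {0..n}. \<xi> differentiable at t within {0..n} \<and>
        vector_derivative \<xi> (at t within {0..n}) \<in> distribution (\<xi> t)"
    proof (rule AE_I'[OF nullZ], rule subsetI)
      fix t assume t: "t \<in> {t \<in> space (lebesgue_on {0..n}). \<not> (\<xi> differentiable at t within {0..n} \<and>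
        vector_derivative \<xi> (at t within {0..n}) \<in> distribution (\<xi> t))}"
      show "t \<in> Z \<inter> {0..n}"
      proof (rule ccontr)
        assume "t \<notin> Z \<inter> {0..n}"
        then have t': "t \<in> {0..n} - Z" using t by (simp add: space_restrict_space)
        have "\<xi> differentiable at t within {0..n}" using IH(7)[OF t'] by (rule differentiableI_vector)
        moreover have "vector_derivative \<xi> (at t within {0..n}) \<in> distribution (\<xi> t)"
          unfolding vd[OF t'] distribution_def horizontal_eq by blast
        ultimately show False using t by blast
      qed
    qed
  qed
  moreover have "0 \<le> n" by (simp add: n_def)
  ultimately show ?thesis using IH(1,2) len by blast
qed

text \<open>Replacing a short piece of a horizontal path by the straight horizontal segment with the same
  planar increment changes the endpoint only by a central element, whose size is the area between the two.
  Central errors add up, and their sum tends to zero with the mesh.\<close>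

lemma (in plane_norm) rho_le_path_length:
  assumes \<Phi>: "\<And>v. \<Phi> (hmat v) = N v" and ab: "a \<le> b" and adm: "admissible a b \<xi>"
  shows "rho (- of_mat (\<xi> a) + of_mat (\<xi> b)) \<le> path_length_wrt \<Phi> a b \<xi>"
proof -
  have carrier: "\<xi> ` {a..b} \<subseteq> range mat_of" and AC: "absolutely_continuous_path a b \<xi>"
    and AE: "AE t in lebesgue_on {a..b}. \<xi> differentiable (at t within {a..b}) \<and>
      vector_derivative \<xi> (at t within {a..b}) \<in> distribution (\<xi> t)"
    using adm by (auto simp: admissible_def carrier_HR)
  obtain Z where Z: "Z \<in> null_sets (lebesgue_on {a..b})"
    "{t \<in> space (lebesgue_on {a..b}). \<not> (\<xi> differentiable (at t within {a..b}) \<and>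
      vector_derivative \<xi> (at t within {a..b}) \<in> distribution (\<xi> t))} \<subseteq> Z"
    using AE unfolding eventually_ae_filter by blast
  have Zneg: "negligible Z"
    using Z(1) by (simp add: null_sets_restrict_space negligible_iff_null_sets)
  have Zout: "\<xi> differentiable (at t within {a..b})"
    "vector_derivative \<xi> (at t within {a..b}) \<in> distribution (\<xi> t)" if "t \<in> {a..b} - Z" for t
    using Z(2) that by (auto simp: space_restrict_space)
  define D where "D t = (if t \<in> Z then 0 else vector_derivative \<xi> (at t within {a..b}))" for t
  have der: "(\<xi> has_vector_derivative D t) (at t within {a..b})" if "t \<in> {a..b} - Z" for t
    using Zout(1)[OF that] that by (simp add: D_def vector_derivative_works)
  define g where "g t = of_mat (\<xi> t)" for t
  have \<xi>g: "\<xi> t = mat_of (g t)" if "t \<in> {a..b}" for t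
  proof -
    have "\<xi> t \<in> range mat_of" using carrier that by blast
    then show ?thesis by (auto simp: g_def)
  qed
  define \<alpha> where "\<alpha> t = fst (hor (g t))" for t
  define h where "h t = (D t $ 1 $ 2, D t $ 2 $ 3)" for t
  have Dh: "D t = \<xi> t ** hmat (h t)" if t: "t \<in> {a..b} - Z" for t
  proof -
    obtain w where w: "D t = \<xi> t ** hmat w"
      using Zout(2)[OF t] t by (auto simp: D_def distribution_def horizontal_eq)
    then have "h t = w" using t \<xi>g[of t] by (simp add: h_def mat_of_def upper_mult_hmat)
    then show ?thesis using w by simp
  qed
  have D13: "D t $ 1 $ 3 = \<alpha> t * snd (h t)" if t: "t \<in> {a..b}" for t
  proof (cases "t \<in> Z")
    case True then show ?thesis by (simp add: D_def h_def)
  next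
    case False
    then have "D t = mat_of (g t) ** hmat (h t)" using Dh[of t] \<xi>g[of t] t by simp
    then show ?thesis by (simp add: mat_of_def upper_mult_hmat \<alpha>_def)
  qed
  have int: "(D has_integral \<xi> t - \<xi> s) {s..t}" if "a \<le> s" "s \<le> t" "t \<le> b" for s t
  proof (rule absolutely_continuous_path_has_integral[OF that(2) _ Zneg])
    show "absolutely_continuous_path s t \<xi>"
      using absolutely_continuous_path_subinterval[OF AC] that by simp
    show "(\<xi> has_vector_derivative D u) (at u within {s..t})" if "u \<in> {s..t} - Z" for u
      by (rule has_vector_derivative_within_subset[OF der]) (use that \<open>a \<le> s\<close> \<open>t \<le> b\<close> in auto)
  qed
  have comp: "bounded_linear (\<lambda>M :: real^3^3. M $ i $ j)" for i j
    using bounded_linear_compose[OF bounded_linear_vec_nth bounded_linear_vec_nth] .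
  have hlin: "bounded_linear (\<lambda>M :: real^3^3. (M $ 1 $ 2, M $ 2 $ 3))"
    by (intro bounded_linear_Pair comp)
  have hint: "(h has_integral hor (g t) - hor (g s)) {s..t}" if "a \<le> s" "s \<le> t" "t \<le> b" for s t
    using has_integral_linear[OF int[OF that] hlin]
    by (simp add: o_def h_def[abs_def] g_def of_mat_def)
  have Dabs: "D absolutely_integrable_on {a..b}"
    by (rule absolutely_continuous_path_derivative_absolutely_integrable[OF ab AC Zneg der])
  have habs: "h absolutely_integrable_on {a..b}"
    using absolutely_integrable_linear[OF Dabs hlin] by (simp add: o_def h_def[abs_def])
  have Nhabs: "(\<lambda>t. N (h t)) absolutely_integrable_on {a..b}"
  proof (rule measurable_bounded_by_integrable_imp_absolutely_integrable)
    show "(\<lambda>t. N (h t)) \<in> borel_measurable (lebesgue_on {a..b})"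
      using absolutely_integrable_measurable[of "{a..b}" h] habs
      by (intro measurable_compose[of h _ borel N] borel_measurable_continuous_onI continuous_on_N) auto
    show "(\<lambda>t. N_basis * norm (h t)) integrable_on {a..b}"
      by (rule integrable_on_mult_right) (use habs in \<open>simp add: absolutely_integrable_on_def\<close>)
    show "norm (N (h t)) \<le> N_basis * norm (h t)" for t
      using N_le_norm[of "h t"] by simp
  qed simp
  have len: "path_length_wrt \<Phi> a b \<xi> = integral {a..b} (\<lambda>t. N (h t))"
  proof -
    have tn: "translated_norm \<Phi> (\<xi> t) (vector_derivative \<xi> (at t within {a..b})) = N (h t)" if t: "t \<in> {a..b} - Z" for t
    proof -
      have "vector_derivative \<xi> (at t within {a..b}) = mat_of (g t) ** hmat (h t)"
        using Dh[OF t] t \<xi>g[of t] by (simp add: D_def)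
      then show ?thesis
        using \<Phi> \<xi>g[of t] t by (simp add: translated_norm_def matrix_inv_mat_of matrix_mul_assoc
          mat_of_plus[symmetric] mat_of_0)
    qed
    have "(\<lambda>t. translated_norm \<Phi> (\<xi> t) (vector_derivative \<xi> (at t within {a..b}))) absolutely_integrable_on {a..b}"
      using Nhabs by (rule absolutely_integrable_spike[OF _ Zneg]) (rule tn)
    then have "path_length_wrt \<Phi> a b \<xi> = integral {a..b} (\<lambda>t. translated_norm \<Phi> (\<xi> t) (vector_derivative \<xi> (at t within {a..b})))"
      unfolding path_length_wrt_def by (intro lebesgue_integral_eq_integral absolutely_integrable_imp_integrable) auto
    also have "\<dots> = integral {a..b} (\<lambda>t. N (h t))"
      by (rule integral_spike[OF Zneg]) (use tn in auto)
    finally show ?thesis .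
  qed
  have Nh1: "(\<lambda>t. N (h t)) integrable_on {a..b}"
    using Nhabs unfolding absolutely_integrable_on_def by blast
  have Nint: "(\<lambda>t. N (h t)) integrable_on {s..t}" if "a \<le> s" "t \<le> b" for s t
    by (rule integrable_on_subinterval[OF Nh1]) (use that in auto)
  have sndabs: "(\<lambda>t. \<bar>snd (h t)\<bar>) integrable_on {a..b}"
    using absolutely_integrable_norm[OF absolutely_integrable_linear[OF habs bounded_linear_snd]]
    by (simp add: o_def absolutely_integrable_on_def)
  have qint: "(\<lambda>t. \<bar>snd (h t)\<bar>) integrable_on {s..t}" if "a \<le> s" "t \<le> b" for s t
    by (rule integrable_on_subinterval[OF sndabs]) (use that in auto)
  define Q where "Q = integral {a..b} (\<lambda>t. \<bar>snd (h t)\<bar>)"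
  have Q: "Q \<ge> 0" unfolding Q_def by (rule integral_nonneg[OF sndabs]) auto
  have approx: "rho (- g a + g b) \<le> integral {a..b} (\<lambda>t. N (h t)) + ver_const * sqrt (\<eta> * Q)" if \<eta>: "\<eta> > 0" for \<eta>
  proof -
    obtain \<delta> where \<delta>: "\<delta> > 0" "\<forall>s t. a \<le> s \<longrightarrow> s \<le> t \<longrightarrow> t \<le> b \<longrightarrow> t - s < \<delta> \<longrightarrow> norm (\<xi> t - \<xi> s) < \<eta>"
      using absolutely_continuous_path_uniform[OF AC \<eta>] by blast
    obtain m :: nat where m: "b - a < real m * \<delta>"
      using reals_Archimedean3[OF \<delta>(1)] by blast
    then have m0: "m > 0" using ab by (cases m) auto
    define p where "p i = a + (b - a) * (real i / real m)" for i
    have p0: "p 0 = a" and pm: "p m = b" using m0 by (auto simp: p_def)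
    have psuc: "p (Suc i) = p i + (b - a) / real m" for i
      by (simp add: p_def add_divide_distrib diff_divide_distrib algebra_simps)
    have step: "0 \<le> (b - a) / real m" "(b - a) / real m < \<delta>" using ab m m0 by (auto simp: field_simps)
    have pmono: "p i \<le> p j" if "i \<le> j" for i j
      unfolding p_def using that ab m0 by (intro add_left_mono mult_left_mono divide_right_mono) auto
    have prange: "a \<le> p i" "i \<le> m \<Longrightarrow> p i \<le> b" for i
      using pmono[of 0 i] pmono[of i m] p0 pm by auto
    have claim: "\<exists>vs z. - g a + g (p i) = polygon vs + Heis 0 z \<and> plen vs \<le> integral {a..p i} (\<lambda>t. N (h t)) \<and>
        \<bar>z\<bar> \<le> \<eta> * integral {a..p i} (\<lambda>t. \<bar>snd (h t)\<bar>)" if "i \<le> m" for i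
      using that
    proof (induction i)
      case 0
      then show ?case by (intro exI[of _ "[]"] exI[of _ 0]) (auto simp: p0 zero_heis_def[symmetric])
    next
      case (Suc i)
      obtain vs z where IH: "- g a + g (p i) = polygon vs + Heis 0 z" "plen vs \<le> integral {a..p i} (\<lambda>t. N (h t))"
        "\<bar>z\<bar> \<le> \<eta> * integral {a..p i} (\<lambda>t. \<bar>snd (h t)\<bar>)" using Suc by force
      define s t where "s = p i" and "t = p (Suc i)"
      have st: "a \<le> s" "s \<le> t" "t \<le> b" "t - s < \<delta>"
        using prange[of i] prange[of "Suc i"] Suc.prems step psuc[of i] by (auto simp: s_def t_def)
      define \<Delta> where "\<Delta> = hor (g t) - hor (g s)"
      define \<gamma> where "\<gamma> u = snd (hor (g u))" for u
      define \<beta> where "\<beta> u = \<xi> u $ 1 $ 3" for u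
      \<comment> \<open>The straight segment has vertical increment \<open>k\<close> times the second increment; the deviation
        \<open>\<zeta>\<close> is the integral of \<open>\<alpha> u - k\<close>, which is small on a short interval.\<close>
      define k where "k = (\<alpha> s + \<alpha> t) / 2"
      define \<zeta> where "\<zeta> = \<beta> t - \<beta> s - k * (\<gamma> t - \<gamma> s)"
      have gt: "g t = g s + Heis \<Delta> 0 + Heis 0 \<zeta>"
        by (rule heis_eqI)
          (auto simp: \<Delta>_def \<zeta>_def k_def \<beta>_def \<gamma>_def \<alpha>_def g_def of_mat_def det2_def field_simps)
      have N\<Delta>: "N \<Delta> \<le> integral {s..t} (\<lambda>u. N (h u))"
        unfolding \<Delta>_def by (rule N_integral_le[OF hint[OF st(1-3)]]) (intro integrable_integral Nint st)
      have "((\<lambda>u. D u $ 1 $ 3 - k * snd (h u)) has_integral \<zeta>) {s..t}"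
        unfolding \<zeta>_def
      proof (intro has_integral_diff has_integral_mult_right)
        show "((\<lambda>u. D u $ 1 $ 3) has_integral \<beta> t - \<beta> s) {s..t}"
          using has_integral_linear[OF int[OF st(1-3)] comp[of 1 3]] by (simp add: o_def \<beta>_def)
        show "((\<lambda>u. snd (h u)) has_integral \<gamma> t - \<gamma> s) {s..t}"
          using has_integral_linear[OF hint[OF st(1-3)] bounded_linear_snd] by (simp add: o_def \<gamma>_def)
      qed
      then have \<zeta>: "\<zeta> = integral {s..t} (\<lambda>u. D u $ 1 $ 3 - k * snd (h u))"
        "(\<lambda>u. D u $ 1 $ 3 - k * snd (h u)) integrable_on {s..t}"
        by (auto simp: integral_unique)
      have "norm (integral {s..t} (\<lambda>u. D u $ 1 $ 3 - k * snd (h u))) \<le> integral {s..t} (\<lambda>u. \<eta> * \<bar>snd (h u)\<bar>)"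
      proof (rule integral_norm_bound_integral[OF \<zeta>(2)])
        show "(\<lambda>u. \<eta> * \<bar>snd (h u)\<bar>) integrable_on {s..t}"
          using qint[OF st(1,3)] by (rule integrable_on_mult_right)
        fix u assume u: "u \<in> {s..t}"
        have \<alpha>\<xi>: "\<bar>\<alpha> x - \<alpha> y\<bar> \<le> norm (\<xi> x - \<xi> y)" for x y
          using order_trans[OF component_le_norm_cart[of "(\<xi> x - \<xi> y) $ 1" 2] Finite_Cartesian_Product.norm_nth_le[of "\<xi> x - \<xi> y" 1]]
          by (simp add: \<alpha>_def g_def of_mat_def)
        have "norm (\<xi> u - \<xi> s) < \<eta>" "norm (\<xi> t - \<xi> u) < \<eta>"
          using \<delta>(2)[rule_format, of s u] \<delta>(2)[rule_format, of u t] st u by auto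
        then have "\<bar>\<alpha> u - \<alpha> s\<bar> \<le> \<eta>" "\<bar>\<alpha> t - \<alpha> u\<bar> \<le> \<eta>"
          using \<alpha>\<xi>[of u s] \<alpha>\<xi>[of t u] by linarith+
        then have "\<bar>\<alpha> u - k\<bar> \<le> \<eta>" unfolding k_def by (auto simp: abs_le_iff field_simps)
        then have "\<bar>(\<alpha> u - k) * snd (h u)\<bar> \<le> \<eta> * \<bar>snd (h u)\<bar>"
          unfolding abs_mult by (rule mult_right_mono) simp
        then show "norm (D u $ 1 $ 3 - k * snd (h u)) \<le> \<eta> * \<bar>snd (h u)\<bar>"
          using D13[of u] u st by (simp add: algebra_simps)
      qed
      then have \<zeta>le: "\<bar>\<zeta>\<bar> \<le> \<eta> * integral {s..t} (\<lambda>u. \<bar>snd (h u)\<bar>)"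
        using \<zeta>(1) by simp
      have "- g a + g t = polygon (vs @ [\<Delta>]) + Heis 0 (z + \<zeta>)"
      proof -
        have "- g a + g t = (- g a + g s) + Heis \<Delta> 0 + Heis 0 \<zeta>" by (simp add: gt add.assoc)
        also have "\<dots> = polygon (vs @ [\<Delta>]) + Heis 0 (z + \<zeta>)"
          unfolding s_def IH(1) by (rule heis_eqI) auto
        finally show ?thesis .
      qed
      moreover have "plen (vs @ [\<Delta>]) \<le> integral {a..t} (\<lambda>u. N (h u))"
        using IH(2) N\<Delta> Henstock_Kurzweil_Integration.integral_combine[OF st(1,2) Nint[OF order_refl st(3)]] st by (simp add: s_def)
      moreover have "\<bar>z + \<zeta>\<bar> \<le> \<eta> * integral {a..t} (\<lambda>u. \<bar>snd (h u)\<bar>)"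
      proof -
        have "integral {a..t} (\<lambda>u. \<bar>snd (h u)\<bar>) = integral {a..s} (\<lambda>u. \<bar>snd (h u)\<bar>) + integral {s..t} (\<lambda>u. \<bar>snd (h u)\<bar>)"
          using Henstock_Kurzweil_Integration.integral_combine[OF st(1,2) qint[OF order_refl st(3)]] st by simp
        then show ?thesis using IH(3) \<zeta>le by (simp add: s_def distrib_left)
      qed
      ultimately show ?case unfolding t_def by blast
    qed
    obtain vs z where vs: "- g a + g b = polygon vs + Heis 0 z" "plen vs \<le> integral {a..b} (\<lambda>t. N (h t))"
        "\<bar>z\<bar> \<le> \<eta> * Q" using claim[of m] by (auto simp: pm Q_def)
    have "rho (- g a + g b) \<le> plen vs + ver_const * sqrt \<bar>z\<bar>"
      unfolding vs(1)
      using rho_triangle[of "polygon vs" "Heis 0 z"] rho_le_plen[of vs "polygon vs"] rho_le[of "Heis 0 z"] by simp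
    also have "\<dots> \<le> integral {a..b} (\<lambda>t. N (h t)) + ver_const * sqrt (\<eta> * Q)"
      using vs ver_const_pos by (intro add_mono mult_left_mono) auto
    finally show ?thesis .
  qed
  have "rho (- g a + g b) \<le> integral {a..b} (\<lambda>t. N (h t))"
  proof (rule field_le_epsilon)
    fix e :: real assume e: "e > 0"
    define \<eta> where "\<eta> = (e / ver_const)\<^sup>2 / (Q + 1)"
    have "\<eta> > 0" using e ver_const_pos Q by (simp add: \<eta>_def)
    have "\<eta> * (Q + 1) = (e / ver_const)\<^sup>2" using Q by (simp add: \<eta>_def)
    then have "\<eta> * Q \<le> (e / ver_const)\<^sup>2" using \<open>\<eta> > 0\<close> by (simp add: distrib_left)
    then have "sqrt (\<eta> * Q) \<le> e / ver_const"
      using e ver_const_pos by (intro real_le_lsqrt) (auto simp: Q less_imp_le[OF \<open>\<eta> > 0\<close>])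
    then have "ver_const * sqrt (\<eta> * Q) \<le> e" using ver_const_pos by (simp add: field_simps)
    then show "rho (- g a + g b) \<le> integral {a..b} (\<lambda>t. N (h t)) + e"
      using approx[OF \<open>\<eta> > 0\<close>] by linarith
  qed
  then show ?thesis by (simp add: len g_def)
qed

text \<open>The two infima agree: polygons are admissible paths, and no admissible path is shorter than \<open>rho\<close>.\<close>

theorem (in plane_norm) cc_dist_eq_rho:
  assumes \<Phi>: "\<And>v. \<Phi> (hmat v) = N v"
  shows "cc_dist \<Phi> (mat_of x) (mat_of y) = rho (- x + y)"
proof (rule antisym)
  let ?L = "{path_length_wrt \<Phi> a b \<xi> | a b \<xi>. a \<le> b \<and> admissible a b \<xi> \<and> \<xi> a = mat_of x \<and> \<xi> b = mat_of y}"
  have lower: "rho (- x + y) \<le> l" if lL: "l \<in> ?L" for l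
  proof -
    obtain a b \<xi> where "l = path_length_wrt \<Phi> a b \<xi>" "a \<le> b" "admissible a b \<xi>" "\<xi> a = mat_of x" "\<xi> b = mat_of y"
      using lL by blast
    then show ?thesis using rho_le_path_length[of \<Phi> a b \<xi>] \<Phi> by simp
  qed
  have upper: "plen vs \<in> ?L" if "polygon vs = - x + y" for vs
  proof -
    have "x + polygon vs = y" using that by simp
    then show ?thesis using path_length_polygon[of \<Phi> x vs, OF \<Phi>] by force
  qed
  have "bdd_below ?L" using lower by (rule bdd_belowI)
  then show "cc_dist \<Phi> (mat_of x) (mat_of y) \<le> rho (- x + y)"
    unfolding cc_dist_def by (intro rho_greatest cInf_lower upper) auto
  show "rho (- x + y) \<le> cc_dist \<Phi> (mat_of x) (mat_of y)"
    unfolding cc_dist_def using ex_polygon[of "- x + y"] upper lower by (intro cInf_greatest) blast+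
qed

section \<open>Integer points\<close>

text \<open>The integer points, in exponential coordinates. The term \<open>a c / 2\<close> translates between the vertical coordinate and the
corner entry of the matrix.\<close>

definition Zh :: "heis set" where
  "Zh = {g. fst (hor g) \<in> \<int> \<and> snd (hor g) \<in> \<int> \<and> ver g + fst (hor g) * snd (hor g) / 2 \<in> \<int>}"

lemma mat_of_Zh: "mat_of ` Zh = carrier HZ"
proof -
  have c: "carrier HZ = {upper a b c | a b c. a \<in> \<int> \<and> b \<in> \<int> \<and> c \<in> \<int>}"
    by (simp add: heisenberg_group_def upper_def)
  have "upper a b c \<in> mat_of ` Zh" if "a \<in> \<int>" "b \<in> \<int>" "c \<in> \<int>" for a b c
    by (rule image_eqI[of _ _ "Heis (a, c) (b - a * c / 2)"]) (use that in \<open>simp_all add: mat_of_def Zh_def\<close>)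
  then show ?thesis unfolding c by (auto simp: mat_of_def Zh_def)
qed

lemma Zh_0 [simp]: "0 \<in> Zh"
  by (simp add: Zh_def)

lemma Zh_plus [intro, simp]:
  assumes "g \<in> Zh" "h \<in> Zh" shows "g + h \<in> Zh"
proof -
  have "ver (g + h) + fst (hor (g + h)) * snd (hor (g + h)) / 2
    = (ver g + fst (hor g) * snd (hor g) / 2) + (ver h + fst (hor h) * snd (hor h) / 2) + fst (hor g) * snd (hor h)"
    by (simp add: det2_def field_simps)
  also have "\<dots> \<in> \<int>"
    using assms unfolding Zh_def mem_Collect_eq by (blast intro: Ints_add[OF Ints_add] Ints_mult)
  finally show ?thesis using assms by (simp add: Zh_def)
qed

lemma Zh_uminus [intro, simp]:
  assumes "g \<in> Zh" shows "- g \<in> Zh"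
proof -
  have "ver (- g) + fst (hor (- g)) * snd (hor (- g)) / 2
    = fst (hor g) * snd (hor g) - (ver g + fst (hor g) * snd (hor g) / 2)"
    by (simp add: field_simps)
  also have "\<dots> \<in> \<int>"
    using assms unfolding Zh_def mem_Collect_eq by (blast intro: Ints_diff Ints_mult)
  finally show ?thesis using assms by (simp add: Zh_def)
qed

lemma Zh_minus [intro, simp]: "g \<in> Zh \<Longrightarrow> h \<in> Zh \<Longrightarrow> g - h \<in> Zh"
  by (metis Zh_plus Zh_uminus diff_conv_add_uminus)

lemma smul_Suc: "smul (real (Suc n)) g = smul (real n) g + g"
  using smul_add[of "real n" 1 g] by (simp add: add.commute)

lemma Zh_smul_nat [intro, simp]: "g \<in> Zh \<Longrightarrow> smul (real n) g \<in> Zh"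
  by (induction n) (auto simp: smul_Suc simp del: of_nat_Suc)

lemma Zh_smul_int [intro, simp]:
  assumes "g \<in> Zh" shows "smul (real_of_int n) g \<in> Zh"
proof (cases "n \<ge> 0")
  case True
  then show ?thesis using Zh_smul_nat[OF assms, of "nat n"] by simp
next
  case False
  then have "smul (real_of_int n) g = - smul (real (nat (- n))) g"
    by (simp add: smul_minus[symmetric])
  then show ?thesis using assms by simp
qed

lemma (in plane_norm) rho_smul_le: "rho (smul (real n) g) \<le> real n * rho g"
proof (induction n)
  case (Suc n)
  then show ?case
    using rho_triangle[of "smul (real n) g" g] by (simp add: smul_Suc algebra_simps del: of_nat_Suc) (simp add: algebra_simps)
qed simp

section \<open>Walls and highways\<close>

text \<open>A coprime staircase separates the lines parallel to its diagonal: the linear functional that vanishes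
  on the diagonal takes different values at different vertices.\<close>

lemma staircase_inj:
  fixes a b :: nat
  assumes "coprime a b" "a > 0" "b > 0" "i < a + b" "j < a + b"
    and eq: "(if i \<le> a then i * b else a * (b - (i - a))) = (if j \<le> a then j * b else a * (b - (j - a)))"
  shows "i = j"
proof -
  have mixed: False if "i \<le> a" "\<not> j \<le> a" "j < a + b" "i * b = a * (b - (j - a))" for i j
  proof -
    have "b dvd a * (b - (j - a))" using that(4) by (metis dvd_triv_right)
    then have "b dvd b - (j - a)" using assms(1) by (simp add: coprime_commute coprime_dvd_mult_right_iff)
    moreover have "0 < b - (j - a)" "b - (j - a) < b" using that assms by auto
    ultimately show False using nat_dvd_not_less by blast
  qed
  show ?thesis
  proof (cases "i \<le> a"; cases "j \<le> a")
    assume "i \<le> a" "j \<le> a" then show ?thesis using eq assms by simp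
  next
    assume "i \<le> a" "\<not> j \<le> a" then show ?thesis using eq assms mixed[of i j] by simp
  next
    assume "\<not> i \<le> a" "j \<le> a" then show ?thesis using eq assms mixed[of j i] by simp
  next
    assume *: "\<not> i \<le> a" "\<not> j \<le> a"
    then have "b - (i - a) = b - (j - a)" using eq assms by simp
    then show ?thesis using * assms by linarith
  qed
qed

text \<open>Two multiples of the modulus among the terms lie at least \<open>M\<close> apart, so the integer part of
\<open>r \<bar>f\<bar> / M\<close> takes different values at different hits.\<close>

lemma card_arith_progression_le:
  fixes M a f :: int and n :: nat
  assumes "M > 0" "f \<noteq> 0"
  shows "real (card {r. r < n \<and> M dvd a + int r * f}) \<le> real n * \<bar>real_of_int f\<bar> / real_of_int M + 1"
proof -
  let ?A = "{r. r < n \<and> M dvd a + int r * f}"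
  define h where "h r = nat ((int r * \<bar>f\<bar>) div M)" for r
  have sep: False if rs: "r \<in> ?A" "s \<in> ?A" "r < s" "h r = h s" for r s
  proof -
    have "M dvd (a + int s * f) - (a + int r * f)" using rs by (intro dvd_diff) auto
    then have "M dvd (int s - int r) * f" by (simp add: algebra_simps)
    then have "M dvd (int s - int r) * \<bar>f\<bar>" by (simp add: abs_if)
    moreover have "0 < (int s - int r) * \<bar>f\<bar>" using rs assms by simp
    ultimately have "M \<le> (int s - int r) * \<bar>f\<bar>" by (rule zdvd_imp_le)
    then have "int r * \<bar>f\<bar> + M \<le> int s * \<bar>f\<bar>" by (simp add: algebra_simps)
    then have "(int r * \<bar>f\<bar> + M) div M \<le> (int s * \<bar>f\<bar>) div M"
      using assms by (intro zdiv_mono1) auto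
    then have "(int r * \<bar>f\<bar>) div M < (int s * \<bar>f\<bar>) div M" using assms by simp
    moreover have "0 \<le> (int r * \<bar>f\<bar>) div M" using assms by (simp add: pos_imp_zdiv_nonneg_iff)
    ultimately show False using rs(4) by (simp add: h_def)
  qed
  have "inj_on h ?A"
  proof (rule inj_onI, rule ccontr)
    fix r s assume "r \<in> ?A" "s \<in> ?A" "h r = h s" "r \<noteq> s"
    then show False using sep[of r s] sep[of s r] by (metis linorder_neqE_nat)
  qed
  moreover have "h ` ?A \<subseteq> {..nat ((int n * \<bar>f\<bar>) div M)}"
    unfolding h_def using assms by (auto intro!: nat_mono zdiv_mono1 mult_right_mono)
  ultimately have "card ?A \<le> card {..nat ((int n * \<bar>f\<bar>) div M)}"
    by (intro card_inj_on_le) auto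
  then have "real (card ?A) \<le> real (Suc (nat ((int n * \<bar>f\<bar>) div M)))"
    by (simp only: of_nat_le_iff card_atMost)
  also have "\<dots> = real_of_int ((int n * \<bar>f\<bar>) div M) + 1"
    using assms by (simp add: pos_imp_zdiv_nonneg_iff)
  finally have "real (card ?A) \<le> real_of_int ((int n * \<bar>f\<bar>) div M) + 1" .
  moreover have "real_of_int ((int n * \<bar>f\<bar>) div M) \<le> real n * \<bar>real_of_int f\<bar> / real_of_int M"
    using real_of_int_div4[of "int n * \<bar>f\<bar>" M] by simp
  ultimately show ?thesis by linarith
qed

text \<open>\<open>G\<close> is a symmetric generating set of the group of integer points. It contains two elements whose horizontal
parts are independent, out of which the highways are built.\<close>

locale highways = plane_norm +
  fixes G :: "heis set" and s1 s2 :: heis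
  assumes G_Zh: "G \<subseteq> Zh" and G_minus: "s \<in> G \<Longrightarrow> - s \<in> G"
    and s1: "s1 \<in> G" and s2: "s2 \<in> G" and independent: "det2 (hor s1) (hor s2) \<noteq> 0"
    and generating: "h \<in> Zh \<Longrightarrow> \<exists>xs. set xs \<subseteq> G \<and> sum_list xs = h"
begin

text \<open>The levels enumerate the nonzero rationals; slope \<open>\<beta> k / \<alpha> k\<close> in lowest terms gives the
horizontal direction \<open>dir k\<close>. The staircase \<open>stair k\<close> takes \<open>\<alpha> k\<close> steps \<open>s1\<close> and then
\<open>\<bar>\<beta> k\<bar>\<close> steps \<open>s2\<close> or \<open>- s2\<close>. \<open>F k\<close> is the primitive integral linear functional on the plane that vanishes
on \<open>dir k\<close>; the floors only convert integer coordinates from type real.\<close>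

definition slope :: "nat \<Rightarrow> rat" where "slope k = from_nat_into (- {0}) k"
definition \<alpha> :: "nat \<Rightarrow> int" where "\<alpha> k = snd (quotient_of (slope k))"
definition \<beta> :: "nat \<Rightarrow> int" where "\<beta> k = fst (quotient_of (slope k))"
definition dir :: "nat \<Rightarrow> real \<times> real" where "dir k = \<alpha> k *\<^sub>R hor s1 + \<beta> k *\<^sub>R hor s2"
definition len :: "nat \<Rightarrow> nat" where "len k = nat (\<alpha> k) + nat \<bar>\<beta> k\<bar>"
definition stair :: "nat \<Rightarrow> nat \<Rightarrow> heis" where
  "stair k i = (if i \<le> nat (\<alpha> k) then smul (real i) s1
     else smul (of_int (\<alpha> k)) s1 + smul (of_int (sgn (\<beta> k)) * real (i - nat (\<alpha> k))) s2)"
definition period :: "nat \<Rightarrow> heis" where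
  "period k = smul (of_int (\<alpha> k)) s1 + smul (of_int (\<beta> k)) s2"
definition shift :: "nat \<Rightarrow> heis" where
  "shift k = Heis ((- ver (period k) / det2 (dir k) (hor s1)) *\<^sub>R hor s1) 0"
definition dirx :: "nat \<Rightarrow> int" where "dirx k = \<alpha> k * \<lfloor>fst (hor s1)\<rfloor> + \<beta> k * \<lfloor>fst (hor s2)\<rfloor>"
definition diry :: "nat \<Rightarrow> int" where "diry k = \<alpha> k * \<lfloor>snd (hor s1)\<rfloor> + \<beta> k * \<lfloor>snd (hor s2)\<rfloor>"
definition F :: "nat \<Rightarrow> heis \<Rightarrow> int" where
  "F k x = \<lfloor>fst (hor x)\<rfloor> * (diry k div gcd (dirx k) (diry k)) - \<lfloor>snd (hor x)\<rfloor> * (dirx k div gcd (dirx k) (diry k))"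

abbreviation \<Delta> :: real where "\<Delta> \<equiv> det2 (hor s1) (hor s2)"

lemma s12_Zh [simp]: "s1 \<in> Zh" "s2 \<in> Zh"
  using s1 s2 G_Zh by auto

lemma slope_bij: "bij_betw slope UNIV (- {0})"
proof -
  have "infinite (- {0 :: rat})" using infinite_UNIV_char_0 by (simp add: finite_compl)
  then have "bij_betw (from_nat_into (- {0 :: rat})) UNIV (- {0})"
    by (intro bij_betw_from_nat_into) auto
  then show ?thesis unfolding slope_def[abs_def] .
qed

lemma slope_nz: "slope k \<noteq> 0" and slope_inj: "slope j = slope k \<Longrightarrow> j = k"
  using slope_bij by (auto simp: bij_betw_def inj_on_def)

lemma slope_eq: "slope k = of_int (\<beta> k) / of_int (\<alpha> k)"
  using quotient_of_div[of "slope k" "\<beta> k" "\<alpha> k"] by (simp add: \<alpha>_def \<beta>_def)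

lemma \<alpha>_pos: "\<alpha> k > 0" using quotient_of_denom_pos' by (simp add: \<alpha>_def)

text \<open>Every neighbourhood contains infinitely many rationals, hence some of arbitrarily high level; high levels have
small disturbance \<open>1 / 2 ^ k\<close>.\<close>

lemma slope_dense:
  assumes "\<delta> > 0" shows "\<exists>k\<ge>K. \<bar>real_of_int (\<beta> k) / real_of_int (\<alpha> k) - t\<bar> < \<delta>"
proof -
  obtain r1 where r1: "t < of_rat r1" "of_rat r1 < t + \<delta>" using of_rat_dense[of t "t + \<delta>"] assms by auto
  obtain r2 where r2: "of_rat r1 < (of_rat r2 :: real)" "of_rat r2 < t + \<delta>" using of_rat_dense[OF r1(2)] by auto
  have "infinite {r1<..<r2}" using r2(1) by (intro infinite_Ioo) (simp add: of_rat_less)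
  then have "infinite ({r1<..<r2} - insert 0 (slope ` {..<K}))" by (intro Diff_infinite_finite) auto
  then obtain r where r: "r1 < r" "r < r2" "r \<noteq> 0" "r \<notin> slope ` {..<K}"
    by (metis (no_types, lifting) DiffE finite.emptyI greaterThanLessThan_iff insertI1 insertCI all_not_in_conv)
  then have "r \<in> range slope" using slope_bij by (auto simp: bij_betw_def)
  then obtain k where k: "r = slope k" by blast
  have "k \<ge> K" using r(4) k by (metis imageI lessThan_iff not_le)
  moreover have "real_of_int (\<beta> k) / real_of_int (\<alpha> k) = of_rat r"
    unfolding k slope_eq by (simp add: of_rat_divide)
  moreover have "of_rat r1 < (of_rat r :: real)" "(of_rat r :: real) < of_rat r2"
    using r by (auto simp: of_rat_less)
  ultimately show ?thesis using r1 r2 by (intro exI[of _ k]) auto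
qed

lemma \<beta>_nz: "\<beta> k \<noteq> 0" using slope_nz[of k] slope_eq[of k] by auto

lemma \<alpha>\<beta>_coprime: "coprime (nat (\<alpha> k)) (nat \<bar>\<beta> k\<bar>)"
proof -
  have "coprime (\<beta> k) (\<alpha> k)"
    using quotient_of_coprime[of "slope k" "\<beta> k" "\<alpha> k"] by (simp add: \<alpha>_def \<beta>_def)
  then have "coprime (nat \<bar>\<alpha> k\<bar>) (nat \<bar>\<beta> k\<bar>)" by (simp add: coprime_commute)
  then show ?thesis using \<alpha>_pos[of k] by simp
qed

lemma len_pos: "len k > 0" using \<alpha>_pos by (simp add: len_def)

lemma stair_0 [simp]: "stair k 0 = 0" by (simp add: stair_def)

lemma stair_len: "stair k (len k) = period k"
proof -
  have "of_int (sgn (\<beta> k)) * real (nat \<bar>\<beta> k\<bar>) = of_int (\<beta> k)" by (simp add: sgn_if)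
  moreover have "nat \<bar>\<beta> k\<bar> > 0" using \<beta>_nz[of k] by simp
  ultimately show ?thesis by (simp add: stair_def len_def period_def)
qed

lemma stair_Zh [simp]: "stair k i \<in> Zh"
proof -
  have "smul (of_int (sgn (\<beta> k)) * real (i - nat (\<alpha> k))) s2 = smul (of_int (sgn (\<beta> k) * int (i - nat (\<alpha> k)))) s2"
    by simp
  then show ?thesis unfolding stair_def by (metis Zh_plus Zh_smul_int Zh_smul_nat s12_Zh)
qed

lemma period_Zh [simp]: "period k \<in> Zh" by (simp add: period_def)

lemma stair_step: "- stair k i + stair k (Suc i) \<in> G"
proof (cases "Suc i \<le> nat (\<alpha> k)")
  case True
  then have "stair k (Suc i) = stair k i + s1" using smul_Suc[of i s1] by (simp add: stair_def)
  then show ?thesis using s1 by (simp add: add.assoc[symmetric])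
next
  case False
  have "stair k (Suc i) = stair k i + smul (of_int (sgn (\<beta> k))) s2"
  proof (cases "i \<le> nat (\<alpha> k)")
    case True
    then have "i = nat (\<alpha> k)" using False by simp
    then show ?thesis using \<alpha>_pos[of k] by (simp add: stair_def)
  next
    case i: False
    have "of_int (sgn (\<beta> k)) * real (Suc i - nat (\<alpha> k)) = of_int (sgn (\<beta> k)) * real (i - nat (\<alpha> k)) + of_int (sgn (\<beta> k))"
      using i by (simp add: Suc_diff_le algebra_simps)
    then show ?thesis using i False by (simp add: stair_def smul_add add.assoc)
  qed
  moreover have "smul (of_int (sgn (\<beta> k))) s2 \<in> G"
    using \<beta>_nz[of k] s2 G_minus[OF s2] by (auto simp: sgn_if smul_minus)
  ultimately show ?thesis by (simp add: add.assoc[symmetric])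
qed

lemma det2_dir: "det2 (dir k) (hor s1) = - \<beta> k * \<Delta>" "det2 (hor s1) (dir k) = \<beta> k * \<Delta>"
  "det2 (hor s2) (dir k) = - \<alpha> k * \<Delta>" "det2 (dir j) (dir k) = (\<alpha> j * \<beta> k - \<beta> j * \<alpha> k) * \<Delta>"
  by (auto simp: dir_def det2_commute[of "hor s2" "hor s1"] algebra_simps)

lemma det2_dir_nz: "j \<noteq> k \<Longrightarrow> det2 (dir j) (dir k) \<noteq> 0"
proof
  assume "j \<noteq> k" and "det2 (dir j) (dir k) = 0"
  then have "\<alpha> j * \<beta> k = \<beta> j * \<alpha> k" using independent unfolding det2_dir
    by (metis mult_eq_0_iff of_int_diff of_int_eq_0_iff of_int_mult right_minus_eq)
  then have "(of_int (\<alpha> j) * of_int (\<beta> k) :: rat) = of_int (\<beta> j) * of_int (\<alpha> k)" by (metis of_int_mult)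
  then have "slope j = slope k" using \<alpha>_pos[of j] \<alpha>_pos[of k] by (simp add: slope_eq field_simps)
  then show False using slope_inj \<open>j \<noteq> k\<close> by blast
qed

lemma dir_nz: "dir k \<noteq> 0"
  using det2_dir(2)[of k] \<beta>_nz[of k] independent by auto

lemma hor_period: "hor (period k) = dir k"
  by (simp add: period_def dir_def)

text \<open>The vertical coordinate of the period is the obstacle to its being a straight segment. It can be conjugated away,
because the period and \<open>s1\<close> have independent horizontal parts.\<close>

lemma period_shift: "period k + shift k = shift k + Heis (dir k) 0"
proof (rule heis_eqI)
  have "det2 (dir k) (hor s1) \<noteq> 0" using det2_dir(1)[of k] \<beta>_nz[of k] independent by simp
  then show "ver (period k + shift k) = ver (shift k + Heis (dir k) 0)"
    by (simp add: hor_period shift_def det2_commute[of "hor s1"])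
qed (simp add: hor_period add.commute)

lemma Zh_floor: "x \<in> Zh \<Longrightarrow> of_int \<lfloor>fst (hor x)\<rfloor> = fst (hor x)" "x \<in> Zh \<Longrightarrow> of_int \<lfloor>snd (hor x)\<rfloor> = snd (hor x)"
  by (auto simp: Zh_def elim!: Ints_cases)

lemma dir_eq: "dir k = (of_int (dirx k), of_int (diry k))"
  by (simp add: dir_def dirx_def diry_def Zh_floor prod_eq_iff)

definition dir_gcd :: "nat \<Rightarrow> int" where "dir_gcd k = gcd (dirx k) (diry k)"

lemma dir_gcd_pos: "dir_gcd k > 0"
  using dir_nz[of k] by (auto simp: dir_gcd_def dir_eq zero_prod_def less_le)

lemma F_symp: "x \<in> Zh \<Longrightarrow> of_int (F k x) * of_int (dir_gcd k) = det2 (hor x) (dir k)"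
proof -
  assume x: "x \<in> Zh"
  have "F k x * dir_gcd k = \<lfloor>fst (hor x)\<rfloor> * diry k - \<lfloor>snd (hor x)\<rfloor> * dirx k"
    unfolding F_def dir_gcd_def by (simp add: left_diff_distrib mult.assoc)
  then have "of_int (F k x) * of_int (dir_gcd k) = real_of_int (\<lfloor>fst (hor x)\<rfloor> * diry k - \<lfloor>snd (hor x)\<rfloor> * dirx k)"
    by (metis of_int_mult)
  then show ?thesis using x by (simp add: det2_def dir_eq Zh_floor)
qed

lemma F_eqI: "of_int n * of_int (dir_gcd k) = det2 (hor x) (dir k) \<Longrightarrow> x \<in> Zh \<Longrightarrow> F k x = n"
  using F_symp[of x k] dir_gcd_pos[of k]
  by (metis less_irrefl mult_right_cancel of_int_eq_iff of_int_0)

lemma F_plus [simp]: "x \<in> Zh \<Longrightarrow> y \<in> Zh \<Longrightarrow> F k (x + y) = F k x + F k y"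
  by (rule F_eqI) (auto simp: F_symp distrib_right)

lemma F_0 [simp]: "F k 0 = 0" by (rule F_eqI) auto

lemma F_uminus [simp]: "x \<in> Zh \<Longrightarrow> F k (- x) = - F k x"
  by (rule F_eqI) (auto simp: F_symp)

lemma F_smul [simp]: "x \<in> Zh \<Longrightarrow> F k (smul (real n) x) = int n * F k x"
  by (rule F_eqI) (auto simp: F_symp mult.assoc)

lemma F_minus [simp]: "x \<in> Zh \<Longrightarrow> y \<in> Zh \<Longrightarrow> F k (x - y) = F k x - F k y"
  by (rule F_eqI) (auto simp: F_symp left_diff_distrib)

lemma F_period [simp]: "F k (period k) = 0"
  by (rule F_eqI) (auto simp: hor_period)

lemma F_period_nz: "j \<noteq> k \<Longrightarrow> F j (period k) \<noteq> 0"
  using F_symp[of "period k" j] det2_dir_nz[of k j] by (auto simp: hor_period)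

lemma F_s1_nz: "F k s1 \<noteq> 0" and F_s2_nz: "F k s2 \<noteq> 0"
  using F_symp[of s1 k] F_symp[of s2 k] det2_dir[of k] \<alpha>_pos[of k] \<beta>_nz[of k] independent by auto

text \<open>By Bezout's identity. It lets a traveller change the residue of \<open>F k\<close> and so enter the highway.\<close>

lemma F_surj: "\<exists>e\<in>Zh. F k e = 1"
proof -
  obtain u v where uv: "u * dirx k + v * diry k = dir_gcd k"
    using bezout_int unfolding dir_gcd_def by blast
  define e where "e = Heis (of_int v, - of_int u) (of_int v * of_int u / 2)"
  have "e \<in> Zh" by (simp add: e_def Zh_def)
  moreover have "real_of_int u * dirx k + v * diry k = dir_gcd k" using uv by (metis of_int_add of_int_mult)
  then have "F k e = 1" using \<open>e \<in> Zh\<close> by (intro F_eqI) (auto simp: e_def det2_def dir_eq algebra_simps)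
  ultimately show ?thesis by blast
qed

text \<open>The vertices of one period have different values, so the value tells to which vertex a point corresponds.\<close>

lemma F_stair_inj: "inj_on (\<lambda>i. F k (stair k i)) {..<len k}"
proof (rule inj_onI)
  fix i j assume ij: "i \<in> {..<len k}" "j \<in> {..<len k}" "F k (stair k i) = F k (stair k j)"
  define a b where "a = nat (\<alpha> k)" and "b = nat \<bar>\<beta> k\<bar>"
  have ab: "a > 0" "b > 0" "len k = a + b" using \<alpha>_pos[of k] \<beta>_nz[of k] by (auto simp: a_def b_def len_def)
  define \<sigma> where "\<sigma> = real_of_int (sgn (\<beta> k))"
  have \<sigma>: "\<sigma> \<noteq> 0" using \<beta>_nz[of k] by (simp add: \<sigma>_def sgn_if)
  have \<alpha>: "real_of_int (\<alpha> k) = real a" and \<beta>: "real_of_int (\<beta> k) = \<sigma> * real b"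
    using \<alpha>_pos[of k] by (auto simp: a_def b_def \<sigma>_def sgn_if)
  define f where "f i = (if i \<le> a then i * b else a * (b - (i - a)))" for i
  have f: "det2 (hor (stair k i)) (dir k) = \<sigma> * \<Delta> * real (f i)" if "i < a + b" for i
  proof (cases "i \<le> a")
    case True
    then have "stair k i = smul (real i) s1" by (simp add: stair_def a_def)
    then show ?thesis using True by (simp add: det2_dir \<beta> f_def)
  next
    case False
    define m where "m = i - a"
    have m: "m \<le> b" using that by (simp add: m_def)
    have "stair k i = smul (of_int (\<alpha> k)) s1 + smul (\<sigma> * real m) s2"
      using False unfolding stair_def \<sigma>_def m_def a_def by (simp only: if_False)
    then have "det2 (hor (stair k i)) (dir k) = \<sigma> * \<Delta> * (real a * (real b - real m))"
      by (simp add: det2_dir \<alpha> \<beta> algebra_simps)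
    moreover have "real (f i) = real a * (real b - real m)"
      using False m by (simp add: f_def m_def[symmetric] of_nat_diff)
    ultimately show ?thesis by simp
  qed
  have "det2 (hor (stair k i)) (dir k) = det2 (hor (stair k j)) (dir k)"
    using F_symp[of "stair k i" k] F_symp[of "stair k j" k] ij by simp
  then have "f i = f j"
    using f[of i] f[of j] ij ab independent \<sigma> by simp
  then show "i = j"
    using staircase_inj[OF \<alpha>\<beta>_coprime[of k], of i j] ij ab unfolding f_def a_def b_def by simp
qed

definition F_bound :: "nat \<Rightarrow> real" where "F_bound k = det2_const * N (dir k)"

lemma F_bound_nonneg: "0 \<le> F_bound k" using det2_const_pos by (simp add: F_bound_def)

lemma F_le: "x \<in> Zh \<Longrightarrow> \<bar>of_int (F k x)\<bar> \<le> F_bound k * rho x"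
proof -
  assume x: "x \<in> Zh"
  have "\<bar>of_int (F k x) :: real\<bar> * 1 \<le> \<bar>of_int (F k x)\<bar> * of_int (dir_gcd k)"
    using dir_gcd_pos[of k] by (intro mult_left_mono) auto
  also have "\<dots> = \<bar>det2 (hor x) (dir k)\<bar>"
    using dir_gcd_pos[of k] by (simp add: F_symp[OF x, symmetric] abs_mult)
  also have "\<dots> \<le> det2_const * (N (hor x) * N (dir k))" by (rule det2_le)
  also have "\<dots> \<le> det2_const * (rho x * N (dir k))"
    using det2_const_pos by (intro mult_left_mono mult_right_mono N_hor_le_rho) auto
  finally show ?thesis by (simp add: F_bound_def mult_ac)
qed

text \<open>A bound for the distance by which a point on a wall of level \<open>j\<close> is moved when that wall is collapsed.\<close>

definition disp :: "nat \<Rightarrow> real" where "disp j = (\<Sum>i<len j. rho (- stair j i + shift j))"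

lemma disp_nonneg: "0 \<le> disp j" by (simp add: disp_def sum_nonneg)

lemma disp_ge: "i < len j \<Longrightarrow> rho (- stair j i + shift j) \<le> disp j"
  unfolding disp_def by (rule member_le_sum) auto

text \<open>\<open>toll j\<close> bounds all that a wall of level \<open>j\<close> can cost in one step to a traveller on a highway of lower level or
along a generator, summed over the positions of the wall; \<open>gap j\<close>, the period of the walls, is enormous compared with it.\<close>

definition toll :: "nat \<Rightarrow> real" where
  "toll j = 1 + disp j + 4 * disp j * len j
     + (\<Sum>k<j. 2 * len k * (disp j + disp k) * (len k + 1) * len j)"

definition gap :: "nat \<Rightarrow> int" where
  "gap j = 1 + \<lceil>2 ^ j * toll j * ((\<Sum>k<j. \<bar>F j (period k)\<bar>) + \<bar>F j s1\<bar> + \<bar>F j s2\<bar>)\<rceil>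
     + (\<Sum>i<len j. \<Sum>i'<len j. \<bar>F j (stair j i) - F j (stair j i')\<bar>)
     + \<lceil>2 ^ j * len j * (2 * F_bound j * (2 ^ j * toll j) + 1)\<rceil>"

lemma toll_ge: "1 \<le> toll j" "disp j \<le> toll j" "4 * disp j * len j \<le> toll j"
  "k < j \<Longrightarrow> 2 * len k * (disp j + disp k) * (len k + 1) * len j \<le> toll j"
proof -
  have nn: "0 \<le> 2 * len k * (disp j + disp k) * (len k + 1) * len j" for k
    using disp_nonneg[of j] disp_nonneg[of k] by simp
  have s: "0 \<le> (\<Sum>k<j. 2 * len k * (disp j + disp k) * (len k + 1) * len j)"
    by (intro sum_nonneg nn)
  have d: "0 \<le> disp j" "0 \<le> 4 * disp j * len j" using disp_nonneg[of j] by auto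
  show "1 \<le> toll j" "disp j \<le> toll j" "4 * disp j * len j \<le> toll j" using s d by (auto simp: toll_def)
  assume "k < j"
  then have "2 * len k * (disp j + disp k) * (len k + 1) * len j \<le> (\<Sum>k<j. 2 * len k * (disp j + disp k) * (len k + 1) * len j)"
    using nn by (intro member_le_sum) auto
  then show "2 * len k * (disp j + disp k) * (len k + 1) * len j \<le> toll j"
    unfolding toll_def using d by linarith
qed

text \<open>The summands of \<open>gap j\<close> serve three purposes: walls of level \<open>j\<close> are rarely crossed by highways of lower level and by
lines along the generators, the residues of different vertices of a staircase stay different modulo \<open>gap j\<close>, and a
wall of level \<open>j\<close> is unlikely to come near the origin.\<close>

lemma gap_props: "0 < gap j"
  "i < len j \<Longrightarrow> i' < len j \<Longrightarrow> \<bar>F j (stair j i) - F j (stair j i')\<bar> < gap j"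
  "k < j \<Longrightarrow> toll j * \<bar>F j (period k)\<bar> \<le> gap j / 2 ^ j"
  "toll j * \<bar>F j s1\<bar> \<le> gap j / 2 ^ j" "toll j * \<bar>F j s2\<bar> \<le> gap j / 2 ^ j"
  "len j * (2 * F_bound j * (2 ^ j * toll j) + 1) \<le> gap j / 2 ^ j"
proof -
  define X where "X = 2 ^ j * toll j * ((\<Sum>k<j. \<bar>F j (period k)\<bar>) + \<bar>F j s1\<bar> + \<bar>F j s2\<bar>)"
  define Y where "Y = (\<Sum>i<len j. \<Sum>i'<len j. \<bar>F j (stair j i) - F j (stair j i')\<bar>)"
  define W where "W = 2 ^ j * len j * (2 * F_bound j * (2 ^ j * toll j) + 1)"
  have t: "0 < toll j" using toll_ge(1)[of j] by linarith
  have nn: "0 \<le> X" "0 \<le> Y" "0 \<le> W"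
    using t F_bound_nonneg[of j] by (auto simp: X_def Y_def W_def intro!: sum_nonneg mult_nonneg_nonneg add_nonneg_nonneg)
  have gap: "gap j = 1 + \<lceil>X\<rceil> + Y + \<lceil>W\<rceil>" by (simp add: gap_def X_def Y_def W_def)
  have c: "0 \<le> \<lceil>X\<rceil>" "0 \<le> \<lceil>W\<rceil>" using nn by linarith+
  show "0 < gap j" using c nn gap by linarith
  have Xg: "X \<le> gap j" and Wg: "W \<le> gap j"
    using c nn gap le_of_int_ceiling[of X] le_of_int_ceiling[of W] by linarith+
  show "\<bar>F j (stair j i) - F j (stair j i')\<bar> < gap j" if "i < len j" "i' < len j"
  proof -
    have "\<bar>F j (stair j i) - F j (stair j i')\<bar> \<le> (\<Sum>i'<len j. \<bar>F j (stair j i) - F j (stair j i')\<bar>)"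
      using that by (intro member_le_sum[of i' _ "\<lambda>i'. \<bar>F j (stair j i) - F j (stair j i')\<bar>"]) auto
    also have "\<dots> \<le> Y" unfolding Y_def
      using that by (intro member_le_sum[of i _ "\<lambda>i. \<Sum>i'<len j. \<bar>F j (stair j i) - F j (stair j i')\<bar>"]) (auto intro: sum_nonneg)
    finally show ?thesis using c gap by linarith
  qed
  have part: "toll j * \<bar>f\<bar> \<le> gap j / 2 ^ j" if "\<bar>f\<bar> \<le> (\<Sum>k<j. \<bar>F j (period k)\<bar>) + \<bar>F j s1\<bar> + \<bar>F j s2\<bar>" for f :: int
  proof -
    have "real_of_int \<bar>f\<bar> \<le> real_of_int ((\<Sum>k<j. \<bar>F j (period k)\<bar>) + \<bar>F j s1\<bar> + \<bar>F j s2\<bar>)"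
      using that by (simp only: of_int_le_iff)
    from mult_left_mono[OF this, of "2 ^ j * toll j"] have "2 ^ j * toll j * \<bar>f\<bar> \<le> X"
      using t by (simp add: X_def)
    then have "2 ^ j * toll j * \<bar>f\<bar> \<le> gap j" using Xg by linarith
    then show ?thesis by (simp add: field_simps)
  qed
  have s: "0 \<le> (\<Sum>k<j. \<bar>F j (period k)\<bar>)" by (simp add: sum_nonneg)
  show "toll j * \<bar>F j s1\<bar> \<le> gap j / 2 ^ j" using s by (intro part) simp
  show "toll j * \<bar>F j s2\<bar> \<le> gap j / 2 ^ j" using s by (intro part) simp
  show "toll j * \<bar>F j (period k)\<bar> \<le> gap j / 2 ^ j" if "k < j"
  proof (rule part)
    have "\<bar>F j (period k)\<bar> \<le> (\<Sum>k<j. \<bar>F j (period k)\<bar>)"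
      using that by (intro member_le_sum[of k _ "\<lambda>k. \<bar>F j (period k)\<bar>"]) auto
    then show "\<bar>F j (period k)\<bar> \<le> (\<Sum>k<j. \<bar>F j (period k)\<bar>) + \<bar>F j s1\<bar> + \<bar>F j s2\<bar>" by linarith
  qed
  show "len j * (2 * F_bound j * (2 ^ j * toll j) + 1) \<le> gap j / 2 ^ j"
    using Wg by (simp add: W_def field_simps)
qed

end

section \<open>Collapsing the walls\<close>

lemma left_cancel: "- (x + a) + (x + b) = - a + (b :: 'a :: group_add)"
  by (simp add: minus_add add.assoc del: add_uminus_conv_diff)

context highways
begin

text \<open>With \<open>c j\<close> as the residue of the base points of level \<open>j\<close>, the point \<open>x\<close> is at position
\<open>i\<close> of the wall if it looks like the vertex number \<open>i\<close> of a staircase that starts at a base point.\<close>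

definition at_wall :: "(nat \<Rightarrow> int) \<Rightarrow> nat \<Rightarrow> nat \<Rightarrow> heis \<Rightarrow> bool" where
  "at_wall c j i x \<longleftrightarrow> gap j dvd F j x - c j - F j (stair j i)"

definition wall :: "(nat \<Rightarrow> int) \<Rightarrow> nat \<Rightarrow> heis \<Rightarrow> bool" where
  "wall c j x \<longleftrightarrow> (\<exists>i<len j. at_wall c j i x)"

text \<open>One more than the highest level of a wall through \<open>x\<close>, and \<open>0\<close> if there is no wall.\<close>

definition level :: "(nat \<Rightarrow> int) \<Rightarrow> heis \<Rightarrow> nat" where
  "level c x = (LEAST n. \<forall>j\<ge>n. \<not> wall c j x)"

text \<open>The point to which the wall of level \<open>j\<close> through \<open>x\<close> is collapsed: going back along the staircase leads to the base
point of the period, and \<open>shift j\<close> corrects its vertical position. The number \<open>i\<close> is unique by \<open>at_wall_unique\<close>; the least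
one is a choice that translations visibly respect.\<close>

definition foot :: "(nat \<Rightarrow> int) \<Rightarrow> nat \<Rightarrow> heis \<Rightarrow> heis" where
  "foot c j x = x - stair j (LEAST i. i < len j \<and> at_wall c j i x) + shift j"

definition collapse :: "(nat \<Rightarrow> int) \<Rightarrow> heis \<Rightarrow> heis" where
  "collapse c x = (case level c x of 0 \<Rightarrow> x | Suc j \<Rightarrow> foot c j x)"

text \<open>The almost sure event on which everything below takes place: the walls of high level keep away from the origin.\<close>

definition good :: "(nat \<Rightarrow> int) \<Rightarrow> bool" where
  "good c \<longleftrightarrow> (\<exists>J. \<forall>j\<ge>J. \<forall>x\<in>Zh. wall c j x \<longrightarrow> 2 ^ j * toll j \<le> rho x)"

lemma at_wall_unique:
  assumes "i < len j" "i' < len j" "at_wall c j i x" "at_wall c j i' x"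
  shows "i = i'"
proof -
  have "gap j dvd (F j x - c j - F j (stair j i')) - (F j x - c j - F j (stair j i))"
    using dvd_diff[OF assms(4)[unfolded at_wall_def] assms(3)[unfolded at_wall_def]] .
  then have "gap j dvd F j (stair j i) - F j (stair j i')" by simp
  then have "F j (stair j i) = F j (stair j i')"
    using gap_props(2)[OF assms(1,2)] gap_props(1)[of j]
      dvd_imp_le_int[of "F j (stair j i) - F j (stair j i')" "gap j"] by auto
  then show ?thesis using F_stair_inj[of j] assms(1,2) by (auto simp: inj_on_def)
qed

lemma sum_half_powers_le:
  assumes "finite H" "\<And>j. j \<in> H \<Longrightarrow> k \<le> j"
  shows "(\<Sum>j\<in>H. 1 / 2 ^ j) \<le> 2 / (2 ^ k :: real)"
proof -
  obtain m where m: "H \<subseteq> {..<m}" using assms(1) finite_nat_iff_bounded by blast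
  have eq: "(\<Sum>j=k..<k+d. (1 / 2) ^ j) = 2 * (1 / 2) ^ k - 2 * (1 / 2 :: real) ^ (k + d)" for d
    by (induction d) auto
  have "(\<Sum>j\<in>H. (1 / 2) ^ j) \<le> (\<Sum>j=k..<k+m. (1 / 2 :: real) ^ j)"
    using m assms(2) by (intro sum_mono2) force+
  also have "\<dots> \<le> 2 * (1 / 2) ^ k" unfolding eq by simp
  finally show ?thesis by (simp add: power_one_over)
qed

text \<open>The levels whose walls are met at one of the positions \<open>y + h\<close>; these are the vertices visited
in one step of a periodic route.\<close>

definition crossed :: "(nat \<Rightarrow> int) \<Rightarrow> nat \<Rightarrow> heis set \<Rightarrow> heis \<Rightarrow> nat set" where
  "crossed c k A y = {j. k \<le> j \<and> (\<exists>h\<in>A. wall c j (y + h))}"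

end

text \<open>All that is used about passage times. \<open>T_step\<close> bounds the cost of one edge, and \<open>T_lower\<close> is the triangle
inequality for the weights along a path.\<close>

locale traveller = highways +
  fixes c :: "nat \<Rightarrow> int" and T :: "heis \<Rightarrow> heis \<Rightarrow> real"
  assumes good: "good c"
    and T_refl: "x \<in> Zh \<Longrightarrow> T x x = 0"
    and T_sym: "x \<in> Zh \<Longrightarrow> y \<in> Zh \<Longrightarrow> T x y = T y x"
    and T_triangle: "x \<in> Zh \<Longrightarrow> y \<in> Zh \<Longrightarrow> z \<in> Zh \<Longrightarrow> T x z \<le> T x y + T y z"
    and T_step: "x \<in> Zh \<Longrightarrow> s \<in> G \<Longrightarrow> T x (x + s) \<le> rho (- collapse c x + collapse c (x + s))"
    and T_lower: "x \<in> Zh \<Longrightarrow> y \<in> Zh \<Longrightarrow> rho (- collapse c x + collapse c y) \<le> T x y"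
begin

lemma no_walls_beyond:
  assumes "x \<in> Zh" shows "\<exists>n. \<forall>j\<ge>n. \<not> wall c j x"
proof -
  obtain J where J: "\<And>j. j \<ge> J \<Longrightarrow> wall c j x \<Longrightarrow> 2 ^ j * toll j \<le> rho x"
    using good assms unfolding good_def by blast
  obtain m where m: "rho x < 2 ^ m" using real_arch_pow[of 2 "rho x"] by auto
  have "\<not> wall c j x" if "j \<ge> max J m" for j
  proof
    assume "wall c j x"
    then have "2 ^ j * toll j \<le> rho x" using J that by simp
    moreover have "(2::real) ^ m \<le> 2 ^ j" using that by simp
    moreover have "2 ^ j * 1 \<le> 2 ^ j * toll j" using toll_ge(1)[of j] by (intro mult_left_mono) auto
    ultimately show False using m by linarith
  qed
  then show ?thesis by blast
qed

lemma collapse_top: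
  assumes x: "x \<in> Zh" and i: "i < len j" "at_wall c j i x" and top: "\<And>j'. j' > j \<Longrightarrow> \<not> wall c j' x"
  shows "collapse c x = x - stair j i + shift j"
proof -
  have "level c x = Suc j"
    unfolding level_def
  proof (rule Least_equality)
    show "\<forall>j'\<ge>Suc j. \<not> wall c j' x" using top by auto
    show "Suc j \<le> n" if "\<forall>j'\<ge>n. \<not> wall c j' x" for n
      using that i by (metis not_less_eq_eq wall_def)
  qed
  moreover have "(LEAST i. i < len j \<and> at_wall c j i x) = i"
    using i at_wall_unique by (intro Least_equality) (auto intro: eq_refl)
  ultimately show ?thesis by (simp add: collapse_def foot_def)
qed

lemma collapse_cases:
  assumes x: "x \<in> Zh"
  obtains "collapse c x = x" "\<And>j. \<not> wall c j x"
    | j i where "i < len j" "at_wall c j i x" "\<And>j'. j' > j \<Longrightarrow> \<not> wall c j' x" "collapse c x = x - stair j i + shift j"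
proof -
  have L: "\<forall>j\<ge>level c x. \<not> wall c j x"
    unfolding level_def by (rule LeastI_ex[OF no_walls_beyond[OF x]])
  show thesis
  proof (cases "level c x")
    case 0
    then show ?thesis using L that(1) by (simp add: collapse_def)
  next
    case (Suc j)
    have "\<not> (\<forall>j'\<ge>j. \<not> wall c j' x)"
      using not_less_Least[of j "\<lambda>n. \<forall>j'\<ge>n. \<not> wall c j' x"] Suc by (simp add: level_def)
    then have "wall c j x" using L Suc by (metis not_less_eq_eq le_antisym)
    then obtain i where i: "i < len j" "at_wall c j i x" by (auto simp: wall_def)
    have top: "\<not> wall c j' x" if "j' > j" for j' using L Suc that by simp
    show ?thesis by (rule that(2)[OF i top collapse_top[OF x i top]])
  qed
qed

lemma rho_coll_le_disp:
  assumes "i < len j" "collapse c x = x - stair j i + shift j"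
  shows "rho (- x + collapse c x) \<le> disp j"
proof -
  have "- x + collapse c x = - stair j i + shift j"
    unfolding assms(2) by (simp add: diff_conv_add_uminus add.assoc del: add_uminus_conv_diff)
  then show ?thesis using disp_ge[OF assms(1)] by simp
qed

text \<open>To be moved by \<open>disp j \<le> toll j\<close> a point must lie on a wall of level \<open>j\<close>, which for large \<open>j\<close> happens
only at distance \<open>2 ^ j * toll j\<close> and beyond.\<close>

lemma collapse_sublinear:
  assumes e: "\<epsilon> > 0"
  shows "\<exists>C\<ge>0. \<forall>x\<in>Zh. rho (- x + collapse c x) \<le> \<epsilon> * rho x + C"
proof -
  obtain J where J: "\<And>j x. j \<ge> J \<Longrightarrow> x \<in> Zh \<Longrightarrow> wall c j x \<Longrightarrow> 2 ^ j * toll j \<le> rho x"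
    using good unfolding good_def by blast
  obtain m where m: "1 / \<epsilon> < 2 ^ m" using real_arch_pow[of 2 "1 / \<epsilon>"] by auto
  define K where "K = max J m"
  have "rho (- x + collapse c x) \<le> \<epsilon> * rho x + (\<Sum>j<K. disp j)" if x: "x \<in> Zh" for x
  proof (rule collapse_cases[OF x])
    assume "collapse c x = x"
    then show ?thesis using e by (auto intro!: add_nonneg_nonneg sum_nonneg disp_nonneg)
  next
    fix j i assume *: "i < len j" "at_wall c j i x" "collapse c x = x - stair j i + shift j"
    have d: "rho (- x + collapse c x) \<le> disp j" using *(1,3) by (rule rho_coll_le_disp)
    show ?thesis
    proof (cases "j < K")
      case True
      have "disp j \<le> (\<Sum>j<K. disp j)" using True by (intro member_le_sum) (auto intro: disp_nonneg)
      then show ?thesis using d mult_nonneg_nonneg[OF less_imp_le[OF e] rho_nonneg[of x]] by linarith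
    next
      case False
      have "wall c j x" using * by (auto simp: wall_def)
      with False have "2 ^ j * toll j \<le> rho x" using J[of j x] x by (simp add: K_def)
      moreover have "(2::real) ^ m \<le> 2 ^ j" using False by (intro power_increasing) (auto simp: K_def)
      then have "1 / \<epsilon> \<le> 2 ^ j" using m by linarith
      then have "1 / \<epsilon> * toll j \<le> 2 ^ j * toll j" using toll_ge(1)[of j] by (intro mult_right_mono) auto
      ultimately have "1 / \<epsilon> * toll j \<le> rho x" by linarith
      then have "toll j \<le> \<epsilon> * rho x" using e by (simp add: field_simps)
      moreover have "0 \<le> (\<Sum>j<K. disp j)" by (intro sum_nonneg disp_nonneg)
      ultimately show ?thesis using d toll_ge(2)[of j] by linarith
    qed
  qed
  then show ?thesis
    by (intro exI[of _ "\<Sum>j<K. disp j"]) (auto intro!: sum_nonneg disp_nonneg)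
qed

lemma rho_between_le: "rho (- a + b) \<le> rho (- x + a) + rho (- x + y) + rho (- y + b)"
  using rho_triangle_via[of a b x] rho_triangle_via[of x b y] rho_minus_commute[of a x] by linarith

lemma T_path:
  assumes "\<And>i. i \<le> n \<Longrightarrow> v i \<in> Zh" "\<And>i. i < n \<Longrightarrow> - v i + v (Suc i) \<in> G"
  shows "T (v 0) (v n) \<le> (\<Sum>i<n. rho (- collapse c (v i) + collapse c (v (Suc i))))"
  using assms
proof (induction n)
  case 0
  then show ?case using T_refl by simp
next
  case (Suc n)
  have "T (v 0) (v (Suc n)) \<le> T (v 0) (v n) + T (v n) (v (Suc n))"
    using Suc.prems by (intro T_triangle) auto
  moreover have "T (v n) (v (Suc n)) \<le> rho (- collapse c (v n) + collapse c (v (Suc n)))"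
    using T_step[of "v n" "- v n + v (Suc n)"] Suc.prems by (simp add: add.assoc[symmetric])
  ultimately show ?case using Suc by fastforce
qed

text \<open>Fixed displacements are compositions of boundedly many edges, whose weights are bounded up to the sublinear
displacement of \<open>collapse\<close>.\<close>

lemma T_bounded_move:
  assumes h: "h \<in> Zh" and e: "\<epsilon> > 0"
  shows "\<exists>C\<ge>0. \<forall>x\<in>Zh. T x (x + h) \<le> \<epsilon> * rho x + C"
proof -
  obtain xs where xs: "set xs \<subseteq> G" "sum_list xs = h" using generating[OF h] by blast
  have "\<exists>C\<ge>0. \<forall>x\<in>Zh. T x (x + sum_list xs) \<le> \<epsilon> * rho x + C" using xs(1) e
  proof (induction xs arbitrary: \<epsilon>)
    case Nil
    then show ?case by (intro exI[of _ 0]) (auto simp: T_refl)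
  next
    case (Cons s xs)
    have s: "s \<in> G" "s \<in> Zh" using Cons.prems G_Zh by auto
    have tail: "sum_list xs \<in> Zh" if "set xs \<subseteq> G" for xs
      using that G_Zh by (induction xs) auto
    have e3: "\<epsilon> / 3 > 0" using Cons.prems by simp
    obtain C1 where C1: "C1 \<ge> 0" "\<And>x. x \<in> Zh \<Longrightarrow> T x (x + sum_list xs) \<le> \<epsilon> / 3 * rho x + C1"
      using Cons.IH[OF _ e3] Cons.prems by auto
    obtain C2 where C2: "C2 \<ge> 0" "\<And>x. x \<in> Zh \<Longrightarrow> rho (- x + collapse c x) \<le> \<epsilon> / 3 * rho x + C2"
      using collapse_sublinear[OF e3] by blast
    define B where "B = rho s + 2 * (\<epsilon> / 3) * rho s + C1 + 2 * C2"
    have "T x (x + sum_list (s # xs)) \<le> \<epsilon> * rho x + B" if x: "x \<in> Zh" for x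
    proof -
      have "T x (x + sum_list (s # xs)) \<le> T x (x + s) + T (x + s) (x + s + sum_list xs)"
        using x s tail Cons.prems by (intro order_trans[OF T_triangle[of x "x + s"]]) (auto simp: add.assoc)
      also have "T x (x + s) \<le> rho (- x + collapse c x) + rho s + rho (- (x + s) + collapse c (x + s))"
        using T_step[OF x s(1)] rho_between_le[of "collapse c x" "collapse c (x + s)" x "x + s"]
        by (simp add: add.assoc[symmetric] del: minus_add)
      also have "\<dots> \<le> (\<epsilon> / 3 * rho x + C2) + rho s + (\<epsilon> / 3 * (rho x + rho s) + C2)"
        using C2(2)[of x] C2(2)[of "x + s"] x s mult_left_mono[OF rho_triangle[of x s] less_imp_le[OF e3]]
        by (simp del: minus_add)
      also have "T (x + s) (x + s + sum_list xs) \<le> \<epsilon> / 3 * (rho x + rho s) + C1"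
        using C1(2)[of "x + s"] x s mult_left_mono[OF rho_triangle[of x s] less_imp_le[OF e3]] by auto
      finally show ?thesis by (simp add: B_def field_simps)
    qed
    moreover have "B \<ge> 0" using C1 C2 e3 by (simp add: B_def)
    ultimately show ?case by blast
  qed
  then show ?thesis using xs by simp
qed

lemma finite_crossed:
  assumes "finite A" "A \<subseteq> Zh" "x \<in> Zh" shows "finite (crossed c k A x)"
proof -
  have "\<exists>n. \<forall>j\<ge>n. \<not> wall c j (x + h)" if "h \<in> A" for h
    using no_walls_beyond assms that by blast
  then obtain n where n: "\<And>h j. h \<in> A \<Longrightarrow> j \<ge> n h \<Longrightarrow> \<not> wall c j (x + h)" by metis
  have "crossed c k A x \<subseteq> (\<Union>h\<in>A. {..<n h})"
    using n by (force simp: crossed_def not_less[symmetric])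
  then show ?thesis using assms(1) finite_subset by blast
qed

section \<open>The cost of crossing walls\<close>

text \<open>A route with steps \<open>u\<close> not parallel to \<open>dir j\<close> meets the walls of level \<open>j\<close> with frequency at most proportional to
\<open>1 / gap j\<close>, and possibly once more. The first contribution sums to \<open>2 / 2 ^ k\<close> per step. The additional crossing is
paid for by the distance from the origin, since walls of high level are only met far away.\<close>

lemma crossing_cost:
  fixes cost :: "nat \<Rightarrow> real"
  assumes u: "u \<in> Zh" and A: "finite A" "A \<subseteq> Zh" and cost: "\<And>j. 0 \<le> cost j"
    and nz: "\<And>j. k \<le> j \<Longrightarrow> F j u \<noteq> 0"
    and toll: "\<And>j. k \<le> j \<Longrightarrow> cost j * card A * len j \<le> toll j"
    and gap: "\<And>j. k \<le> j \<Longrightarrow> toll j * \<bar>F j u\<bar> \<le> gap j / 2 ^ j"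
    and e: "\<epsilon> > 0"
  shows "\<exists>C\<ge>0. \<forall>x\<in>Zh. \<forall>n. (\<Sum>r<n. \<Sum>j\<in>crossed c k A (x + smul (real r) u). cost j)
     \<le> real n * (2 / 2 ^ k) + \<epsilon> * (rho x + real n) + C"
proof -
  obtain J where J: "\<And>j x. j \<ge> J \<Longrightarrow> x \<in> Zh \<Longrightarrow> wall c j x \<Longrightarrow> 2 ^ j * toll j \<le> rho x"
    using good unfolding good_def by blast
  \<comment> \<open>Both \<open>E\<close> and \<open>E * rho u\<close> are at most \<open>\<epsilon>\<close>, so that a bound \<open>E * (rho x + n * rho u)\<close> suffices.\<close>
  define E where "E = \<epsilon> / (1 + rho u)"
  have E: "E > 0" "E * rho u \<le> \<epsilon>" "E \<le> \<epsilon>"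
  proof -
    have p: "1 + rho u > 0" using rho_nonneg[of u] by linarith
    then have "E * (1 + rho u) = \<epsilon>" by (simp add: E_def)
    then have "E + E * rho u = \<epsilon>" by (simp add: distrib_left)
    moreover show "E > 0" using e p by (simp add: E_def)
    moreover have "0 \<le> E * rho u" using \<open>E > 0\<close> by simp
    ultimately show "E * rho u \<le> \<epsilon>" "E \<le> \<epsilon>" by linarith+
  qed
  obtain m where m: "2 / E < 2 ^ m" using real_arch_pow[of 2 "2 / E"] by auto
  \<comment> \<open>Below \<open>K\<close> there are only finitely many levels, paid for by the constant; above \<open>K\<close> the walls are far away.\<close>
  define K where "K = max J m"
  have KE: "2 / 2 ^ K \<le> E"
  proof -
    have "(2::real) ^ m \<le> 2 ^ K" by (intro power_increasing) (auto simp: K_def)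
    then have "2 / E \<le> 2 ^ K" using m by linarith
    then show ?thesis using E(1) by (simp add: field_simps)
  qed
  define \<tau> where "\<tau> = (\<Sum>h\<in>A. rho h)"
  have \<tau>: "\<tau> \<ge> 0" by (simp add: \<tau>_def sum_nonneg)
  have tp: "0 < toll j" for j using toll_ge(1)[of j] by linarith
  define C where "C = (\<Sum>j<K. toll j) + E * \<tau>"
  have "0 \<le> (\<Sum>j<K. toll j)" by (intro sum_nonneg less_imp_le tp)
  then have C: "C \<ge> 0" using \<tau> E by (simp add: C_def)
  have "(\<Sum>r<n. \<Sum>j\<in>crossed c k A (x + smul (real r) u). cost j)
     \<le> real n * (2 / 2 ^ k) + \<epsilon> * (rho x + real n) + C" if x: "x \<in> Zh" for x n
  proof -
    define hits where "hits r = crossed c k A (x + smul (real r) u)" for r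
    have xr: "x + smul (real r) u \<in> Zh" for r using x u by auto
    have fin: "finite (hits r)" for r unfolding hits_def by (rule finite_crossed[OF A xr])
    define H where "H = (\<Union>r<n. hits r)"
    have finH: "finite H" using fin by (simp add: H_def)
    have Hk: "k \<le> j" if "j \<in> H" for j using that by (auto simp: H_def hits_def crossed_def)
    have "(\<Sum>r<n. \<Sum>j\<in>hits r. cost j) = (\<Sum>r<n. \<Sum>j\<in>H. if j \<in> hits r then cost j else 0)"
    proof (rule sum.cong[OF refl])
      fix r assume "r \<in> {..<n}"
      then have "H \<inter> hits r = hits r" by (auto simp: H_def)
      then show "(\<Sum>j\<in>hits r. cost j) = (\<Sum>j\<in>H. if j \<in> hits r then cost j else 0)"
        using sum.inter_restrict[OF finH, of cost "hits r"] by simp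
    qed
    also have "\<dots> = (\<Sum>j\<in>H. \<Sum>r<n. if j \<in> hits r then cost j else 0)" by (rule sum.swap)
    also have "\<dots> = (\<Sum>j\<in>H. cost j * card {r. r < n \<and> j \<in> hits r})"
    proof (rule sum.cong[OF refl])
      fix j
      have "{r. r < n \<and> j \<in> hits r} = {..<n} \<inter> {r. j \<in> hits r}" by auto
      then show "(\<Sum>r<n. if j \<in> hits r then cost j else 0) = cost j * card {r. r < n \<and> j \<in> hits r}"
        by (simp add: sum.If_cases)
    qed
    also have "\<dots> \<le> (\<Sum>j\<in>H. real n / 2 ^ j + toll j)"
    proof (rule sum_mono)
      fix j assume j: "j \<in> H"
      define P where "P h i = {r. r < n \<and> gap j dvd (F j x + F j h - c j - F j (stair j i)) + int r * F j u}" for h i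
      have finP: "finite (P h i)" for h i by (simp add: P_def)
      have "{r. r < n \<and> j \<in> hits r} \<subseteq> (\<Union>h\<in>A. \<Union>i<len j. P h i)"
      proof
        fix r assume "r \<in> {r. r < n \<and> j \<in> hits r}"
        then obtain h i where hi: "r < n" "h \<in> A" "i < len j" "gap j dvd F j (x + smul (real r) u + h) - c j - F j (stair j i)"
          by (auto simp: hits_def crossed_def wall_def at_wall_def)
        have "h \<in> Zh" using hi A by auto
        then have "F j (x + smul (real r) u + h) = F j x + int r * F j u + F j h" using x u xr by simp
        then have "r \<in> P h i" using hi unfolding P_def by (simp add: algebra_simps)
        then show "r \<in> (\<Union>h\<in>A. \<Union>i<len j. P h i)" using hi by blast
      qed
      then have "card {r. r < n \<and> j \<in> hits r} \<le> card (\<Union>h\<in>A. \<Union>i<len j. P h i)"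
        using A finP by (intro card_mono) auto
      also have "\<dots> \<le> (\<Sum>h\<in>A. card (\<Union>i<len j. P h i))" by (rule card_UN_le[OF A(1)])
      also have "\<dots> \<le> (\<Sum>h\<in>A. \<Sum>i<len j. card (P h i))" by (intro sum_mono card_UN_le) simp
      finally have "real (card {r. r < n \<and> j \<in> hits r}) \<le> real (\<Sum>h\<in>A. \<Sum>i<len j. card (P h i))"
        by (simp only: of_nat_le_iff)
      also have "\<dots> = (\<Sum>h\<in>A. \<Sum>i<len j. real (card (P h i)))" by simp
      also have "\<dots> \<le> (\<Sum>h\<in>A. \<Sum>i<len j. real n * \<bar>real_of_int (F j u)\<bar> / real_of_int (gap j) + 1)"
        unfolding P_def by (intro sum_mono card_arith_progression_le gap_props(1) nz Hk j)
      also have "\<dots> = card A * len j * (real n * \<bar>real_of_int (F j u)\<bar> / real_of_int (gap j) + 1)" by simp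
      finally have "cost j * card {r. r < n \<and> j \<in> hits r}
          \<le> cost j * (card A * len j * (real n * \<bar>real_of_int (F j u)\<bar> / real_of_int (gap j) + 1))"
        using cost by (intro mult_left_mono) auto
      also have "\<dots> = (cost j * card A * len j) * (real n * \<bar>real_of_int (F j u)\<bar> / real_of_int (gap j) + 1)"
        by (simp add: mult_ac)
      also have "\<dots> \<le> toll j * (real n * \<bar>real_of_int (F j u)\<bar> / real_of_int (gap j) + 1)"
        using toll[OF Hk[OF j]] gap_props(1)[of j] by (intro mult_right_mono) auto
      also have "\<dots> = real n * ((toll j * \<bar>real_of_int (F j u)\<bar>) / real_of_int (gap j)) + toll j"
        by (simp add: field_simps)
      also have "\<dots> \<le> real n * (1 / 2 ^ j) + toll j"
        using gap[OF Hk[OF j]] gap_props(1)[of j] by (intro add_mono mult_left_mono order_refl) (auto simp: field_simps)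
      finally show "cost j * card {r. r < n \<and> j \<in> hits r} \<le> real n / 2 ^ j + toll j" by simp
    qed
    also have "\<dots> = real n * (\<Sum>j\<in>H. 1 / 2 ^ j) + (\<Sum>j\<in>H. toll j)"
      by (simp add: sum.distrib sum_distrib_left)
    also have "\<dots> \<le> real n * (2 / 2 ^ k) + (\<epsilon> * (rho x + real n) + C)"
    proof (intro add_mono mult_left_mono sum_half_powers_le finH Hk)
      define R where "R = rho x + real n * rho u + \<tau>"
      \<comment> \<open>A wall of level \<open>j \<ge> K\<close> was met, so the traveller has come as far as \<open>2 ^ j * toll j\<close>.\<close>
      have far: "toll j \<le> R * (1 / 2 ^ j)" if j: "j \<in> H" "\<not> j < K" for j
      proof -
        obtain r h where rh: "r < n" "h \<in> A" "wall c j (x + smul (real r) u + h)"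
          using j by (auto simp: H_def hits_def crossed_def)
        then have "2 ^ j * toll j \<le> rho (x + smul (real r) u + h)"
          using J[of j "x + smul (real r) u + h"] j xr A by (auto simp: K_def)
        also have "\<dots> \<le> rho x + rho (smul (real r) u) + rho h"
          using rho_triangle[of "x + smul (real r) u" h] rho_triangle[of x "smul (real r) u"] by linarith
        also have "rho (smul (real r) u) \<le> real n * rho u"
          using rho_smul_le[of r u] mult_right_mono[of "real r" "real n" "rho u"] rh by simp
        also have "rho h \<le> \<tau>" unfolding \<tau>_def using rh A by (intro member_le_sum) auto
        finally show ?thesis by (simp add: R_def field_simps)
      qed
      have "(\<Sum>j\<in>H. toll j) = (\<Sum>j\<in>H \<inter> {..<K}. toll j) + (\<Sum>j\<in>H - {..<K}. toll j)"
        using finH by (metis sum.Int_Diff)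
      also have "(\<Sum>j\<in>H \<inter> {..<K}. toll j) \<le> (\<Sum>j<K. toll j)"
        using tp by (intro sum_mono2) (auto intro: less_imp_le)
      also have "(\<Sum>j\<in>H - {..<K}. toll j) \<le> (\<Sum>j\<in>H - {..<K}. R * (1 / 2 ^ j))"
        using far by (intro sum_mono) auto
      also have "\<dots> = R * (\<Sum>j\<in>H - {..<K}. 1 / 2 ^ j)" by (simp add: sum_distrib_left)
      also have "\<dots> \<le> R * (2 / 2 ^ K)"
        using finH \<tau> by (intro mult_left_mono sum_half_powers_le) (auto simp: R_def)
      also have "\<dots> \<le> R * E" using KE \<tau> by (intro mult_left_mono) (auto simp: R_def)
      also have "\<dots> = E * rho x + real n * (E * rho u) + E * \<tau>" by (simp add: R_def algebra_simps)
      also have "\<dots> \<le> \<epsilon> * rho x + real n * \<epsilon> + E * \<tau>"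
        using E by (intro add_mono mult_right_mono mult_left_mono) auto
      finally show "(\<Sum>j\<in>H. toll j) \<le> \<epsilon> * (rho x + real n) + C" by (simp add: C_def algebra_simps)
    qed auto
    finally show ?thesis unfolding hits_def by simp
  qed
  then show ?thesis using C by blast
qed

text \<open>Summing the cost of the single steps of a periodic route. The invariant \<open>Q\<close> says that the
traveller is on the road for which \<open>step\<close> holds.\<close>

lemma line_cost:
  fixes cost :: "nat \<Rightarrow> real"
  assumes u: "u \<in> Zh" and A: "finite A" "A \<subseteq> Zh" and cost: "\<And>j. 0 \<le> cost j"
    and nz: "\<And>j. k \<le> j \<Longrightarrow> F j u \<noteq> 0"
    and toll: "\<And>j. k \<le> j \<Longrightarrow> cost j * card A * len j \<le> toll j"
    and gap: "\<And>j. k \<le> j \<Longrightarrow> toll j * \<bar>F j u\<bar> \<le> gap j / 2 ^ j"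
    and inv: "\<And>x. x \<in> Zh \<Longrightarrow> Q x \<Longrightarrow> Q (x + u)"
    and step: "\<And>x. x \<in> Zh \<Longrightarrow> Q x \<Longrightarrow> T x (x + u) \<le> a + (\<Sum>j\<in>crossed c k A x. cost j)"
    and e: "\<epsilon> > 0"
  shows "\<exists>C\<ge>0. \<forall>x\<in>Zh. Q x \<longrightarrow> (\<forall>n. T x (x + smul (real n) u) \<le> real n * (a + 2 / 2 ^ k) + \<epsilon> * (rho x + real n) + C)"
proof -
  obtain C where C: "C \<ge> 0" "\<And>x n. x \<in> Zh \<Longrightarrow> (\<Sum>r<n. \<Sum>j\<in>crossed c k A (x + smul (real r) u). cost j)
     \<le> real n * (2 / 2 ^ k) + \<epsilon> * (rho x + real n) + C"
    using crossing_cost[OF u A cost nz toll gap e] by blast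
  have "T x (x + smul (real n) u) \<le> real n * (a + 2 / 2 ^ k) + \<epsilon> * (rho x + real n) + C"
    if x: "x \<in> Zh" "Q x" for x n
  proof -
    have xr: "x + smul (real r) u \<in> Zh" for r using x u by auto
    have Qr: "Q (x + smul (real r) u)" for r
      by (induction r) (use x inv[OF xr] in \<open>auto simp: smul_Suc add.assoc[symmetric] simp del: of_nat_Suc\<close>)
    have "T x (x + smul (real n) u) \<le> (\<Sum>r<n. a + (\<Sum>j\<in>crossed c k A (x + smul (real r) u). cost j))"
    proof (induction n)
      case 0
      then show ?case using T_refl x by simp
    next
      case (Suc n)
      have "x + smul (real (Suc n)) u = x + smul (real n) u + u"
        by (simp only: smul_Suc add.assoc)
      then have "T x (x + smul (real (Suc n)) u) \<le> T x (x + smul (real n) u) + T (x + smul (real n) u) (x + smul (real n) u + u)"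
        using T_triangle[OF x(1) xr[of n] xr[of "Suc n"]] by simp
      then show ?case using Suc step[OF xr Qr, of n] by simp
    qed
    also have "\<dots> = real n * a + (\<Sum>r<n. \<Sum>j\<in>crossed c k A (x + smul (real r) u). cost j)"
      by (simp add: sum.distrib)
    finally show ?thesis using C(2)[OF x(1), of n] by (simp add: distrib_left)
  qed
  then show ?thesis using C(1) by blast
qed

text \<open>In the absence of higher walls all vertices \<open>x + stair k i\<close> with \<open>i < len k\<close> collapse to the same point, the edges
between them are free, and the last edge leads to the corresponding point of the next period, at distance
\<open>N (dir k)\<close> by \<open>period_shift\<close>. A vertex that lies on a higher wall is displaced by the amounts counted in the sum.\<close>

lemma highway_period_cost:
  assumes x: "x \<in> Zh" and on: "gap k dvd F k x - c k"
  shows "T x (x + period k) \<le> N (dir k) + (\<Sum>j\<in>crossed c (Suc k) (stair k ` {..len k}) x. 2 * len k * (disp j + disp k))"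
proof -
  define v where "v i = x + stair k i" for i
  \<comment> \<open>The points to which the vertices would collapse if there were no higher walls.\<close>
  define \<psi> where "\<psi> i = (if i < len k then x + shift k else x + period k + shift k)" for i
  define cr where "cr = crossed c (Suc k) (stair k ` {..len k}) x"
  define \<eta> where "\<eta> = (\<Sum>j\<in>cr. disp j + disp k)"
  have vZ: "v i \<in> Zh" for i using x by (simp add: v_def)
  have fin: "finite cr" unfolding cr_def using x by (intro finite_crossed) auto
  have \<eta>0: "\<eta> \<ge> 0" unfolding \<eta>_def by (intro sum_nonneg add_nonneg_nonneg disp_nonneg)
  have dev: "rho (- collapse c (v i) + \<psi> i) \<le> \<eta>" if i: "i \<le> len k" for i
  proof -
    define i' where "i' = (if i < len k then i else 0)"
    have i': "i' < len k" using len_pos by (simp add: i'_def)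
    have \<psi>: "\<psi> i = v i - stair k i' + shift k"
      using i stair_len[of k]
      by (auto simp: \<psi>_def v_def i'_def diff_conv_add_uminus add.assoc simp del: add_uminus_conv_diff)
    have "at_wall c k i' (v i)"
      using on x i stair_len[of k] by (auto simp: at_wall_def v_def i'_def)
    show ?thesis
    proof (cases "\<exists>j>k. wall c j (v i)")
      case False
      then have "collapse c (v i) = \<psi> i"
        unfolding \<psi> using collapse_top[OF vZ i' \<open>at_wall c k i' (v i)\<close>] by blast
      then show ?thesis using \<eta>0 by simp
    next
      case True
      then obtain j where j: "j > k" "wall c j (v i)" by blast
      show ?thesis
      proof (rule collapse_cases[OF vZ[of i]])
        assume "\<And>j. \<not> wall c j (v i)" then show ?thesis using j by blast
      next
        fix j0 i0 assume *: "i0 < len j0" "at_wall c j0 i0 (v i)" "\<And>j'. j' > j0 \<Longrightarrow> \<not> wall c j' (v i)"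
          "collapse c (v i) = v i - stair j0 i0 + shift j0"
        have "j0 \<ge> j" using *(3) j by (metis not_le)
        then have j0: "j0 \<in> cr" using * j i unfolding cr_def crossed_def wall_def v_def by force
        have "rho (- collapse c (v i) + \<psi> i) \<le> rho (- v i + collapse c (v i)) + rho (- v i + \<psi> i)"
          using rho_triangle_via[of "collapse c (v i)" "\<psi> i" "v i"] rho_minus_commute[of "v i" "collapse c (v i)"] by simp
        also have "rho (- v i + \<psi> i) \<le> disp k"
        proof -
          have "- v i + \<psi> i = - stair k i' + shift k"
            unfolding \<psi> by (simp add: diff_conv_add_uminus add.assoc del: add_uminus_conv_diff)
          then show ?thesis using disp_ge[OF i'] by simp
        qed
        also have "rho (- v i + collapse c (v i)) \<le> disp j0" by (rule rho_coll_le_disp[OF *(1,4)])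
        also have "disp j0 + disp k \<le> \<eta>"
          unfolding \<eta>_def using j0 fin disp_nonneg by (intro member_le_sum[of j0 cr "\<lambda>j. disp j + disp k"]) auto
        finally show ?thesis by simp
      qed
    qed
  qed
  have "T (v 0) (v (len k)) \<le> (\<Sum>i<len k. rho (- collapse c (v i) + collapse c (v (Suc i))))"
  proof (rule T_path)
    show "- v i + v (Suc i) \<in> G" for i
      using stair_step[of k i] by (simp only: v_def left_cancel)
  qed (rule vZ)
  also have "\<dots> \<le> (\<Sum>i<len k. rho (- \<psi> i + \<psi> (Suc i)) + 2 * \<eta>)"
  proof (rule sum_mono)
    fix i assume "i \<in> {..<len k}"
    then have "rho (- collapse c (v i) + \<psi> i) \<le> \<eta>" "rho (- collapse c (v (Suc i)) + \<psi> (Suc i)) \<le> \<eta>"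
      using dev by auto
    then show "rho (- collapse c (v i) + collapse c (v (Suc i))) \<le> rho (- \<psi> i + \<psi> (Suc i)) + 2 * \<eta>"
      using rho_between_le[of "collapse c (v i)" "collapse c (v (Suc i))" "\<psi> i" "\<psi> (Suc i)"]
        rho_minus_commute[of "collapse c (v i)" "\<psi> i"] rho_minus_commute[of "collapse c (v (Suc i))" "\<psi> (Suc i)"] by linarith
  qed
  also have "\<dots> = (\<Sum>i<len k. rho (- \<psi> i + \<psi> (Suc i))) + 2 * len k * \<eta>"
    by (simp add: sum.distrib)
  also have "(\<Sum>i<len k. rho (- \<psi> i + \<psi> (Suc i))) \<le> N (dir k)"
  proof -
    obtain m where m: "len k = Suc m" using len_pos[of k] by (cases "len k") auto
    have "(\<Sum>i<len k. rho (- \<psi> i + \<psi> (Suc i))) = rho (- \<psi> m + \<psi> (Suc m))"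
      by (simp add: m \<psi>_def)
    also have "- \<psi> m + \<psi> (Suc m) = - shift k + (period k + shift k)"
      by (simp add: m \<psi>_def add.assoc left_cancel del: minus_add)
    also have "\<dots> = Heis (dir k) 0" unfolding period_shift by simp
    finally show ?thesis using rho_hor_le[of "dir k"] by simp
  qed
  also have "2 * len k * \<eta> = (\<Sum>j\<in>cr. 2 * len k * (disp j + disp k))"
    unfolding \<eta>_def by (simp add: sum_distrib_left)
  finally show ?thesis by (simp add: v_def cr_def stair_len)
qed

lemma generator_cost:
  assumes x: "x \<in> Zh" and s: "s \<in> G"
  shows "T x (x + s) \<le> rho s + (\<Sum>j\<in>crossed c 0 {0, s} x. 2 * disp j)"
proof -
  have sZ: "s \<in> Zh" using s G_Zh by auto
  define cr where "cr = crossed c 0 {0, s} x"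
  have fin: "finite cr" unfolding cr_def using x sZ by (intro finite_crossed) auto
  have dev: "rho (- (x + h) + collapse c (x + h)) \<le> (\<Sum>j\<in>cr. disp j)" if h: "h \<in> {0, s}" for h
  proof -
    have "x + h \<in> Zh" using x sZ h by auto
    then show ?thesis
    proof (rule collapse_cases)
      assume "collapse c (x + h) = x + h"
      then show ?thesis by (simp add: sum_nonneg disp_nonneg del: minus_add)
    next
      fix j i assume *: "i < len j" "at_wall c j i (x + h)" "collapse c (x + h) = x + h - stair j i + shift j"
      then have "j \<in> cr" using h unfolding cr_def crossed_def wall_def by blast
      then have "disp j \<le> (\<Sum>j\<in>cr. disp j)" using fin disp_nonneg by (intro member_le_sum) auto
      then show ?thesis using rho_coll_le_disp[OF *(1,3)] by linarith
    qed
  qed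
  have "T x (x + s) \<le> rho (- collapse c x + collapse c (x + s))" by (rule T_step[OF x s])
  also have "\<dots> \<le> rho (- x + collapse c x) + rho (- x + (x + s)) + rho (- (x + s) + collapse c (x + s))"
    by (rule rho_between_le)
  also have "\<dots> \<le> (\<Sum>j\<in>cr. disp j) + rho s + (\<Sum>j\<in>cr. disp j)"
    using dev[of 0] dev[of s] by (simp del: minus_add)
  finally show ?thesis by (simp add: cr_def sum_distrib_left[symmetric])
qed

lemma highway_cost:
  assumes "\<epsilon> > 0"
  shows "\<exists>C\<ge>0. \<forall>x\<in>Zh. gap k dvd F k x - c k \<longrightarrow>
    (\<forall>n. T x (x + smul (real n) (period k)) \<le> real n * (N (dir k) + 1 / 2 ^ k) + \<epsilon> * (rho x + real n) + C)"
proof -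
  have card: "card (stair k ` {..len k}) \<le> len k + 1"
    using card_image_le[of "{..len k}" "stair k"] by simp
  have "\<exists>C\<ge>0. \<forall>x\<in>Zh. gap k dvd F k x - c k \<longrightarrow>
    (\<forall>n. T x (x + smul (real n) (period k)) \<le> real n * (N (dir k) + 2 / 2 ^ Suc k) + \<epsilon> * (rho x + real n) + C)"
  proof (rule line_cost[where cost = "\<lambda>j. 2 * len k * (disp j + disp k)" and A = "stair k ` {..len k}" and Q = "\<lambda>x. gap k dvd F k x - c k"])
    fix j assume j: "Suc k \<le> j"
    show "F j (period k) \<noteq> 0" using j by (intro F_period_nz) auto
    have "2 * len k * (disp j + disp k) * card (stair k ` {..len k}) * len j
        \<le> 2 * len k * (disp j + disp k) * (len k + 1) * len j"
      using card disp_nonneg by (intro mult_right_mono mult_left_mono) (auto simp flip: of_nat_Suc)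
    also have "\<dots> \<le> toll j" using toll_ge(4)[of k j] j by simp
    finally show "2 * len k * (disp j + disp k) * card (stair k ` {..len k}) * len j \<le> toll j" .
    show "toll j * \<bar>F j (period k)\<bar> \<le> gap j / 2 ^ j" using gap_props(3)[of k j] j by simp
  qed (use assms disp_nonneg highway_period_cost in auto)
  then show ?thesis by simp
qed

lemma generator_line_cost:
  assumes "\<epsilon> > 0" and s: "s = s1 \<or> s = s2"
  shows "\<exists>C\<ge>0. \<forall>x\<in>Zh. \<forall>n. T x (x + smul (real n) s) \<le> real n * (rho s + 2) + \<epsilon> * (rho x + real n) + C"
proof -
  have sG: "s \<in> G" using s s1 s2 by auto
  have card: "card {0, s} \<le> 2" by (simp add: card_insert_if)
  have "\<exists>C\<ge>0. \<forall>x\<in>Zh. True \<longrightarrow> (\<forall>n. T x (x + smul (real n) s) \<le> real n * (rho s + 2 / 2 ^ 0) + \<epsilon> * (rho x + real n) + C)"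
  proof (rule line_cost[where cost = "\<lambda>j. 2 * disp j" and A = "{0, s}" and Q = "\<lambda>_. True"])
    fix j :: nat
    show "F j s \<noteq> 0" using s F_s1_nz F_s2_nz by auto
    have "2 * disp j * card {0, s} * len j \<le> 2 * disp j * 2 * len j"
      using card disp_nonneg by (intro mult_right_mono mult_left_mono) auto
    then show "2 * disp j * card {0, s} * len j \<le> toll j" using toll_ge(3)[of j] by linarith
    show "toll j * \<bar>F j s\<bar> \<le> gap j / 2 ^ j" using s gap_props(4,5)[of j] by auto
  qed (use assms disp_nonneg generator_cost sG G_Zh in auto)
  then show ?thesis by simp
qed

end

section \<open>Finite nets\<close>

lemma real_nat_le_abs: "real (nat n) \<le> \<bar>real_of_int n\<bar>"
  by (cases "0 \<le> n") auto

lemma int_mem_range: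
  assumes "\<bar>real_of_int i\<bar> \<le> X" shows "i \<in> {- \<lceil>X\<rceil>..\<lceil>X\<rceil>}"
proof -
  have "real_of_int i \<le> real_of_int \<lceil>X\<rceil>" "real_of_int (- i) \<le> real_of_int \<lceil>X\<rceil>"
    using assms le_of_int_ceiling[of X] unfolding of_int_minus by linarith+
  then show ?thesis unfolding of_int_le_iff by simp
qed

lemma sqrt_mult_le_sum: "0 \<le> a \<Longrightarrow> 0 \<le> b \<Longrightarrow> sqrt (a * b) \<le> a + (b::real)"
  by (rule real_le_lsqrt) (auto simp: power2_sum)

context plane_norm
begin

lemma rho_small:
  assumes e: "e > 0"
  shows "\<exists>d>0. \<forall>g. N (hor g) \<le> d \<longrightarrow> \<bar>ver g\<bar> \<le> d \<longrightarrow> rho g \<le> e"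
proof -
  define d where "d = min (e / 2) ((e / (2 * ver_const))\<^sup>2)"
  have d: "d > 0" using e ver_const_pos by (simp add: d_def)
  have "rho g \<le> e" if g: "N (hor g) \<le> d" "\<bar>ver g\<bar> \<le> d" for g
  proof -
    have "sqrt \<bar>ver g\<bar> \<le> e / (2 * ver_const)"
      using g(2) e ver_const_pos by (intro real_le_lsqrt) (auto simp: d_def)
    then have "ver_const * sqrt \<bar>ver g\<bar> \<le> e / 2" using ver_const_pos by (simp add: field_simps)
    moreover have "N (hor g) \<le> e / 2" using g(1) by (simp add: d_def)
    ultimately show ?thesis using rho_le[of g] by linarith
  qed
  then show ?thesis using d by blast
qed

text \<open>By the inequality of the means. For large \<open>g\<close> and sublinear \<open>h\<close> a small \<open>K\<close> shows that the
conjugate of \<open>h\<close> is still sublinear.\<close>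

lemma rho_conj_le_linear:
  assumes "K > 0"
  shows "rho (- g + h + g) \<le> (1 + conj_const\<^sup>2 / K) * rho h + K * N (hor g)"
proof -
  have "conj_const * sqrt (rho h * N (hor g)) = sqrt ((conj_const\<^sup>2 / K * rho h) * (K * N (hor g)))"
    using assms conj_const_pos by (simp add: real_sqrt_mult real_sqrt_divide)
  also have "\<dots> \<le> conj_const\<^sup>2 / K * rho h + K * N (hor g)"
    using assms by (intro sqrt_mult_le_sum) auto
  finally show ?thesis using rho_conj_le[of g h] by (simp add: distrib_right)
qed

text \<open>The unit ball is bounded in the coordinates, and small coordinates imply small \<open>rho\<close>, so a fine coordinate grid
is a net. The corner of the grid cell is subtracted in the group, which adds half of \<open>det2 w (hor g)\<close>.\<close>

lemma unit_ball_net: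
  assumes e: "e > 0"
  shows "\<exists>G. finite G \<and> (\<forall>g. rho g \<le> 1 \<longrightarrow> (\<exists>g'\<in>G. rho (- g' + g) \<le> e))"
proof -
  obtain d where d: "d > 0" "\<And>g. N (hor g) \<le> d \<Longrightarrow> \<bar>ver g\<bar> \<le> d \<Longrightarrow> rho g \<le> e"
    using rho_small[OF e] by blast
  define b where "b = 1 + N_basis + det2_const * N_basis"
  have b: "b \<ge> 1" "b > 0" "N_basis \<le> b" "1 + det2_const * N_basis \<le> b"
    using mult_pos_pos[OF det2_const_pos N_basis_pos] N_basis_pos by (auto simp: b_def)
  define \<delta> where "\<delta> = d / b"
  have \<delta>: "\<delta> > 0" "\<delta> * b = d" using d b by (auto simp: \<delta>_def)
  define m where "m = \<lceil>(norm_const + det2_const) / \<delta> + 1\<rceil>"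
  define P where "P = (\<lambda>(i, j, k). Heis (\<delta> * of_int i, \<delta> * of_int j) (\<delta> * of_int k))"
  define G where "G = P ` ({-m..m} \<times> {-m..m} \<times> {-m..m})"
  have ind: "\<lfloor>t / \<delta>\<rfloor> \<in> {-m..m}" if "\<bar>t\<bar> \<le> norm_const + det2_const" for t
  proof -
    have "\<bar>t / \<delta>\<bar> \<le> (norm_const + det2_const) / \<delta>" using that \<delta>(1) by (simp add: divide_right_mono)
    then have "\<bar>real_of_int \<lfloor>t / \<delta>\<rfloor>\<bar> \<le> (norm_const + det2_const) / \<delta> + 1" by linarith
    then show ?thesis unfolding m_def by (rule int_mem_range)
  qed
  have fl: "0 \<le> t - \<delta> * of_int \<lfloor>t / \<delta>\<rfloor>" "t - \<delta> * of_int \<lfloor>t / \<delta>\<rfloor> \<le> \<delta>" for t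
  proof -
    have "\<delta> * of_int \<lfloor>t / \<delta>\<rfloor> \<le> \<delta> * (t / \<delta>)" "\<delta> * (t / \<delta>) \<le> \<delta> * (of_int \<lfloor>t / \<delta>\<rfloor> + 1)"
      using \<delta>(1) by (intro mult_left_mono; linarith)+
    then show "0 \<le> t - \<delta> * of_int \<lfloor>t / \<delta>\<rfloor>" "t - \<delta> * of_int \<lfloor>t / \<delta>\<rfloor> \<le> \<delta>"
      using \<delta>(1) by (auto simp: distrib_left)
  qed
  have "\<exists>g'\<in>G. rho (- g' + g) \<le> e" if g: "rho g \<le> 1" for g
  proof -
    have Nh: "N (hor g) \<le> 1" using N_hor_le_rho[of g] g by simp
    have "norm (hor g) \<le> norm_const"
      using norm_const(2)[of "hor g"] mult_left_mono[OF Nh less_imp_le[OF norm_const(1)]] by simp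
    moreover have "\<bar>fst (hor g)\<bar> \<le> norm (hor g)" "\<bar>snd (hor g)\<bar> \<le> norm (hor g)"
      using norm_fst_le[of "fst (hor g)" "snd (hor g)"] norm_snd_le[of "snd (hor g)" "fst (hor g)"] by auto
    moreover have "\<bar>ver g\<bar> \<le> det2_const"
    proof -
      have "(rho g)\<^sup>2 \<le> 1" using g by (simp add: power_le_one)
      then have "det2_const * (rho g)\<^sup>2 \<le> det2_const * 1"
        using det2_const_pos by (intro mult_left_mono) auto
      then show ?thesis using ver_le_rho[of g] by linarith
    qed
    ultimately have bd: "\<bar>fst (hor g)\<bar> \<le> norm_const + det2_const" "\<bar>snd (hor g)\<bar> \<le> norm_const + det2_const"
      "\<bar>ver g\<bar> \<le> norm_const + det2_const"
      using norm_const(1) det2_const_pos by linarith+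
    define g' where "g' = P (\<lfloor>fst (hor g) / \<delta>\<rfloor>, \<lfloor>snd (hor g) / \<delta>\<rfloor>, \<lfloor>ver g / \<delta>\<rfloor>)"
    have "g' \<in> G" unfolding G_def g'_def using ind bd by (intro imageI) auto
    moreover have "rho (- g' + g) \<le> e"
    proof (rule d(2))
      define w where "w = hor g - hor g'"
      have w: "0 \<le> fst w" "fst w \<le> \<delta>" "0 \<le> snd w" "snd w \<le> \<delta>"
        using fl[of "fst (hor g)"] fl[of "snd (hor g)"] by (auto simp: w_def g'_def P_def)
      have "N w \<le> \<delta> * N (1, 0) + \<delta> * N (0, 1)"
        using w by (intro order_trans[OF N_le_coords] add_mono mult_right_mono) auto
      then have Nw: "N w \<le> \<delta> * N_basis" by (simp add: N_basis_def distrib_left)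
      have "\<delta> * N_basis \<le> d" using b \<delta> mult_left_mono[of N_basis b \<delta>] by simp
      then show "N (hor (- g' + g)) \<le> d" using Nw by (simp add: w_def)
      have "\<bar>det2 w (hor g)\<bar> \<le> det2_const * (\<delta> * N_basis * 1)"
        using Nw Nh N_basis_pos det2_const_pos \<delta>(1)
        by (intro order_trans[OF det2_le] mult_left_mono mult_mono) auto
      moreover have "det2 (hor g') (hor g) = - det2 w (hor g)" by (simp add: w_def)
      moreover have "\<bar>ver g - ver g'\<bar> \<le> \<delta>" using fl[of "ver g"] by (simp add: g'_def P_def)
      moreover have "\<delta> * (1 + det2_const * N_basis) \<le> d" using b \<delta> mult_left_mono[of "1 + det2_const * N_basis" b \<delta>] by simp
      moreover have "0 \<le> det2_const * (\<delta> * N_basis)" using N_basis_pos det2_const_pos \<delta>(1) by simp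
      ultimately show "\<bar>ver (- g' + g)\<bar> \<le> d" by (simp add: algebra_simps)
    qed
    ultimately show ?thesis by blast
  qed
  moreover have "finite G" by (simp add: G_def)
  ultimately show ?thesis by blast
qed

end

lemma finite_Zh_box: "finite {g \<in> Zh. \<bar>fst (hor g)\<bar> \<le> b \<and> \<bar>snd (hor g)\<bar> \<le> b \<and> \<bar>ver g\<bar> \<le> b}"
proof -
  define m where "m = \<lceil>b + b * b\<rceil>"
  define P where "P = (\<lambda>(i, j, k). Heis (of_int i, of_int j) (of_int k - of_int i * of_int j / 2))"
  have "{g \<in> Zh. \<bar>fst (hor g)\<bar> \<le> b \<and> \<bar>snd (hor g)\<bar> \<le> b \<and> \<bar>ver g\<bar> \<le> b} \<subseteq> P ` ({-m..m} \<times> {-m..m} \<times> {-m..m})"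
  proof
    fix g assume g: "g \<in> {g \<in> Zh. \<bar>fst (hor g)\<bar> \<le> b \<and> \<bar>snd (hor g)\<bar> \<le> b \<and> \<bar>ver g\<bar> \<le> b}"
    then obtain i j k where ijk: "fst (hor g) = of_int i" "snd (hor g) = of_int j"
      "ver g + fst (hor g) * snd (hor g) / 2 = of_int k"
      by (auto simp: Zh_def elim!: Ints_cases)
    have b0: "0 \<le> b" using g by auto
    have bd: "\<bar>of_int i :: real\<bar> \<le> b" "\<bar>of_int j :: real\<bar> \<le> b" "\<bar>ver g\<bar> \<le> b"
      using g ijk by auto
    have "\<bar>of_int i * of_int j :: real\<bar> \<le> b * b" unfolding abs_mult using bd b0 by (intro mult_mono) auto
    then have "\<bar>of_int k :: real\<bar> \<le> b + b * b" using bd(3) ijk b0 by (auto simp: abs_le_iff)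
    moreover have "0 \<le> b * b" using b0 by simp
    ultimately have "\<bar>of_int i\<bar> \<le> b + b * b" "\<bar>of_int j\<bar> \<le> b + b * b" "\<bar>of_int k\<bar> \<le> b + b * b"
      using bd by linarith+
    then have r: "i \<in> {-m..m}" "j \<in> {-m..m}" "k \<in> {-m..m}" unfolding m_def by (auto dest!: int_mem_range)
    have "g = P (i, j, k)" by (rule heis_eqI) (use ijk in \<open>auto simp: P_def prod_eq_iff\<close>)
    then show "g \<in> P ` ({-m..m} \<times> {-m..m} \<times> {-m..m})" using r by blast
  qed
  then show ?thesis by (rule finite_subset) simp
qed

section \<open>Moving at a bounded speed\<close>

context traveller
begin

text \<open>From any starting point, the displacement \<open>f h\<close> can be travelled at a cost proportional to \<open>rho h\<close>, up to
errors that are sublinear in the distances involved.\<close>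

definition speed_bound :: "real \<Rightarrow> (heis \<Rightarrow> heis) \<Rightarrow> bool" where
  "speed_bound A f \<longleftrightarrow> (\<forall>h\<in>Zh. f h \<in> Zh) \<and> (\<forall>h\<in>Zh. rho (f h) \<le> A * (rho h + 1)) \<and>
     (\<forall>\<epsilon>>0. \<exists>C\<ge>0. \<forall>h\<in>Zh. \<forall>x\<in>Zh. T x (x + f h) \<le> A * rho h + \<epsilon> * (rho x + rho h) + C)"

definition bounded_speed :: "(heis \<Rightarrow> heis) \<Rightarrow> bool" where
  "bounded_speed f \<longleftrightarrow> (\<exists>A\<ge>0. speed_bound A f)"

lemma bounded_speedI:
  assumes "\<And>h. h \<in> Zh \<Longrightarrow> f h \<in> Zh" "A \<ge> 0" "\<And>h. h \<in> Zh \<Longrightarrow> rho (f h) \<le> A * (rho h + 1)"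
    "\<And>\<epsilon>. \<epsilon> > 0 \<Longrightarrow> \<exists>C\<ge>0. \<forall>h\<in>Zh. \<forall>x\<in>Zh. T x (x + f h) \<le> A * rho h + \<epsilon> * (rho x + rho h) + C"
  shows "bounded_speed f"
  unfolding bounded_speed_def speed_bound_def using assms by (intro exI[of _ A] conjI) simp_all

lemma speed_boundD:
  "speed_bound A f \<Longrightarrow> h \<in> Zh \<Longrightarrow> f h \<in> Zh" "speed_bound A f \<Longrightarrow> h \<in> Zh \<Longrightarrow> rho (f h) \<le> A * (rho h + 1)"
  "speed_bound A f \<Longrightarrow> \<epsilon> > 0 \<Longrightarrow> \<exists>C\<ge>0. \<forall>h\<in>Zh. \<forall>x\<in>Zh. T x (x + f h) \<le> A * rho h + \<epsilon> * (rho x + rho h) + C"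
  unfolding speed_bound_def by simp_all

lemma bounded_speed_Zh: "bounded_speed f \<Longrightarrow> h \<in> Zh \<Longrightarrow> f h \<in> Zh"
  unfolding bounded_speed_def using speed_boundD(1) by blast

lemma bounded_speed_cong: "bounded_speed f \<Longrightarrow> (\<And>h. h \<in> Zh \<Longrightarrow> f h = g h) \<Longrightarrow> bounded_speed g"
  unfolding bounded_speed_def speed_bound_def by simp

lemma bounded_speed_add:
  assumes "bounded_speed f" "bounded_speed g" shows "bounded_speed (\<lambda>h. f h + g h)"
proof -
  obtain A where "A \<ge> 0" and "speed_bound A f" using assms(1) unfolding bounded_speed_def by blast
  note A = this(1) speed_boundD[OF this(2)]
  obtain B where "B \<ge> 0" and "speed_bound B g" using assms(2) unfolding bounded_speed_def by blast
  note B = this(1) speed_boundD[OF this(2)]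
  show ?thesis
  proof (rule bounded_speedI[where A = "A + B"])
    show "rho (f h + g h) \<le> (A + B) * (rho h + 1)" if "h \<in> Zh" for h
      using rho_triangle[of "f h" "g h"] A(3)[OF that] B(3)[OF that] by (simp add: distrib_right)
    fix \<epsilon> :: real assume e: "\<epsilon> > 0"
    define \<epsilon>' where "\<epsilon>' = \<epsilon> / (2 + A)"
    have e': "\<epsilon>' > 0" "\<epsilon>' * (2 + A) = \<epsilon>" using e A(1) by (auto simp: \<epsilon>'_def)
    obtain C where C: "C \<ge> 0" "\<And>h x. h \<in> Zh \<Longrightarrow> x \<in> Zh \<Longrightarrow> T x (x + f h) \<le> A * rho h + \<epsilon>' * (rho x + rho h) + C"
      using A(4)[OF e'(1)] by blast
    obtain D where D: "D \<ge> 0" "\<And>h x. h \<in> Zh \<Longrightarrow> x \<in> Zh \<Longrightarrow> T x (x + g h) \<le> B * rho h + \<epsilon>' * (rho x + rho h) + D"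
      using B(4)[OF e'(1)] by blast
    have "T x (x + (f h + g h)) \<le> (A + B) * rho h + \<epsilon> * (rho x + rho h) + (C + D + \<epsilon>)" if h: "h \<in> Zh" and x: "x \<in> Zh" for h x
    proof -
      have "T x (x + (f h + g h)) \<le> T x (x + f h) + T (x + f h) (x + f h + g h)"
        using T_triangle[of x "x + f h" "x + f h + g h"] x A(2)[OF h] B(2)[OF h] by (simp add: add.assoc)
      also have "T x (x + f h) \<le> A * rho h + \<epsilon>' * (rho x + rho h) + C" by (rule C(2)[OF h x])
      also have "T (x + f h) (x + f h + g h) \<le> B * rho h + \<epsilon>' * (rho (x + f h) + rho h) + D"
        using x A(2)[OF h] by (intro D(2)[OF h]) auto
      also have "\<epsilon>' * (rho (x + f h) + rho h) \<le> \<epsilon>' * (rho x + A * (rho h + 1) + rho h)"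
        using rho_triangle[of x "f h"] A(3)[OF h] e'(1) by (intro mult_left_mono) auto
      finally have "T x (x + (f h + g h)) \<le> (A + B) * rho h + (\<epsilon>' * 2 * rho x + \<epsilon>' * (2 + A) * rho h + \<epsilon>' * A) + C + D"
        by (simp add: algebra_simps)
      moreover have "\<epsilon>' * 2 * rho x \<le> \<epsilon> * rho x" using e' A(1) by (intro mult_right_mono) (auto simp: distrib_left)
      moreover have "\<epsilon>' * A \<le> \<epsilon>" using e' by (simp add: distrib_left)
      ultimately show ?thesis unfolding e'(2) by (simp add: algebra_simps)
    qed
    then show "\<exists>C\<ge>0. \<forall>h\<in>Zh. \<forall>x\<in>Zh. T x (x + (f h + g h)) \<le> (A + B) * rho h + \<epsilon> * (rho x + rho h) + C"
      using C(1) D(1) e by (intro exI[of _ "C + D + \<epsilon>"]) auto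
  qed (use A B in auto)
qed

lemma bounded_speed_uminus:
  assumes "bounded_speed f" shows "bounded_speed (\<lambda>h. - f h)"
proof -
  obtain A where "A \<ge> 0" and "speed_bound A f" using assms(1) unfolding bounded_speed_def by blast
  note A = this(1) speed_boundD[OF this(2)]
  show ?thesis
  proof (rule bounded_speedI[where A = A])
    fix \<epsilon> :: real assume e: "\<epsilon> > 0"
    define \<epsilon>' where "\<epsilon>' = \<epsilon> / (1 + A)"
    have e': "\<epsilon>' > 0" "\<epsilon>' * (1 + A) = \<epsilon>" using e A(1) by (auto simp: \<epsilon>'_def)
    obtain C where C: "C \<ge> 0" "\<And>h x. h \<in> Zh \<Longrightarrow> x \<in> Zh \<Longrightarrow> T x (x + f h) \<le> A * rho h + \<epsilon>' * (rho x + rho h) + C"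
      using A(4)[OF e'(1)] by blast
    have "T x (x + - f h) \<le> A * rho h + \<epsilon> * (rho x + rho h) + (C + \<epsilon>)" if h: "h \<in> Zh" and x: "x \<in> Zh" for h x
    proof -
      define y where "y = x + - f h"
      have y: "y \<in> Zh" "y + f h = x" using x A(2)[OF h] by (auto simp: y_def)
      have "T x y = T y (y + f h)" using T_sym[OF x y(1)] y(2) by simp
      also have "\<dots> \<le> A * rho h + \<epsilon>' * (rho y + rho h) + C" by (rule C(2)[OF h y(1)])
      also have "\<epsilon>' * (rho y + rho h) \<le> \<epsilon>' * (rho x + A * (rho h + 1) + rho h)"
        using rho_triangle[of x "- f h"] A(3)[OF h] e'(1) by (intro mult_left_mono) (auto simp: y_def)
      finally have "T x y \<le> A * rho h + (\<epsilon>' * rho x + \<epsilon>' * (1 + A) * rho h + \<epsilon>' * A) + C"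
        by (simp add: algebra_simps)
      moreover have "\<epsilon>' * rho x \<le> \<epsilon> * rho x" using e' A(1) by (intro mult_right_mono) (auto simp: distrib_left)
      moreover have "\<epsilon>' * A \<le> \<epsilon>" using e' by (simp add: distrib_left)
      ultimately show ?thesis unfolding e'(2) y_def by (simp add: algebra_simps)
    qed
    then show "\<exists>C\<ge>0. \<forall>h\<in>Zh. \<forall>x\<in>Zh. T x (x + - f h) \<le> A * rho h + \<epsilon> * (rho x + rho h) + C"
      using C(1) e by (intro exI[of _ "C + \<epsilon>"]) auto
  qed (use A in auto)
qed

lemma bounded_speed_line:
  assumes s: "s = s1 \<or> s = s2" and n: "\<And>h. h \<in> Zh \<Longrightarrow> real (n h) \<le> B * (rho h + 1)" and B: "B \<ge> 0"
  shows "bounded_speed (\<lambda>h. smul (real (n h)) s)"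
proof (rule bounded_speedI[where A = "B * (rho s + 2)"])
  have sZ: "s \<in> Zh" using s by auto
  show "smul (real (n h)) s \<in> Zh" for h using sZ by simp
  show "0 \<le> B * (rho s + 2)" using B by (intro mult_nonneg_nonneg add_nonneg_nonneg) auto
  show "rho (smul (real (n h)) s) \<le> B * (rho s + 2) * (rho h + 1)" if h: "h \<in> Zh" for h
  proof -
    have "rho (smul (real (n h)) s) \<le> real (n h) * rho s" by (rule rho_smul_le)
    also have "\<dots> \<le> (B * (rho h + 1)) * (rho s + 2)"
      using n[OF h] by (intro mult_mono) auto
    finally show ?thesis by (simp add: mult_ac)
  qed
  fix \<epsilon> :: real assume e: "\<epsilon> > 0"
  define \<epsilon>' where "\<epsilon>' = \<epsilon> / (1 + B)"
  have e': "\<epsilon>' > 0" "\<epsilon>' * (1 + B) = \<epsilon>" using e B by (auto simp: \<epsilon>'_def)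
  obtain C where C: "C \<ge> 0" "\<And>x n. x \<in> Zh \<Longrightarrow> T x (x + smul (real n) s) \<le> real n * (rho s + 2) + \<epsilon>' * (rho x + real n) + C"
    using generator_line_cost[OF e'(1) s] by blast
  have "T x (x + smul (real (n h)) s) \<le> B * (rho s + 2) * rho h + \<epsilon> * (rho x + rho h) + (C + B * (rho s + 2) + \<epsilon>)"
    if h: "h \<in> Zh" and x: "x \<in> Zh" for h x
  proof -
    have "T x (x + smul (real (n h)) s) \<le> real (n h) * (rho s + 2) + \<epsilon>' * (rho x + real (n h)) + C"
      by (rule C(2)[OF x])
    also have "real (n h) * (rho s + 2) \<le> B * (rho h + 1) * (rho s + 2)"
      using n[OF h] rho_nonneg[of s] by (intro mult_right_mono) linarith+
    also have "\<epsilon>' * (rho x + real (n h)) \<le> \<epsilon>' * (rho x + B * (rho h + 1))"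
      using n[OF h] e'(1) by (intro mult_left_mono) auto
    finally have "T x (x + smul (real (n h)) s) \<le> B * (rho s + 2) * rho h + B * (rho s + 2) + (\<epsilon>' * rho x + \<epsilon>' * B * rho h + \<epsilon>' * B) + C"
      by (simp add: algebra_simps)
    moreover have "\<epsilon>' * rho x \<le> \<epsilon> * rho x" "\<epsilon>' * B * rho h \<le> \<epsilon> * rho h" "\<epsilon>' * B \<le> \<epsilon>"
      using e' B by (auto intro!: mult_right_mono simp: distrib_left)
    ultimately show ?thesis by (simp add: algebra_simps)
  qed
  moreover have "C + B * (rho s + 2) + \<epsilon> \<ge> 0" using C(1) e B by (intro add_nonneg_nonneg mult_nonneg_nonneg) auto
  ultimately show "\<exists>C\<ge>0. \<forall>h\<in>Zh. \<forall>x\<in>Zh. T x (x + smul (real (n h)) s) \<le> B * (rho s + 2) * rho h + \<epsilon> * (rho x + rho h) + C"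
    by blast
qed

lemma bounded_speed_int_line:
  assumes s: "s = s1 \<or> s = s2" and n: "\<And>h. h \<in> Zh \<Longrightarrow> \<bar>real_of_int (n h)\<bar> \<le> B * (rho h + 1)" and B: "B \<ge> 0"
  shows "bounded_speed (\<lambda>h. smul (real_of_int (n h)) s)"
proof (rule bounded_speed_cong)
  show "bounded_speed (\<lambda>h. smul (real (nat (n h))) s + - smul (real (nat (- n h))) s)"
  proof (intro bounded_speed_add bounded_speed_uminus bounded_speed_line[OF s _ B])
    show "real (nat (n h)) \<le> B * (rho h + 1)" "real (nat (- n h)) \<le> B * (rho h + 1)" if "h \<in> Zh" for h
      using n[OF that] real_nat_le_abs[of "n h"] real_nat_le_abs[of "- n h"] by simp_all
  qed
  show "smul (real (nat (n h))) s + - smul (real (nat (- n h))) s = smul (real_of_int (n h)) s" for h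
  proof -
    have "real_of_int (n h) = real (nat (n h)) + - real (nat (- n h))" by (cases "0 \<le> n h") auto
    then show ?thesis by (simp only: smul_add smul_minus)
  qed
qed

lemma bounded_speed_finite:
  assumes "finite (f ` Zh)" "f ` Zh \<subseteq> Zh" shows "bounded_speed f"
proof -
  define F0 where "F0 = f ` Zh"
  have F: "finite F0" "F0 \<subseteq> Zh" "\<And>h. h \<in> Zh \<Longrightarrow> f h \<in> F0" using assms by (auto simp: F0_def)
  show ?thesis
  proof (rule bounded_speedI[where A = "\<Sum>y\<in>F0. rho y"])
    show "0 \<le> (\<Sum>y\<in>F0. rho y)" by (simp add: sum_nonneg)
    show "rho (f h) \<le> (\<Sum>y\<in>F0. rho y) * (rho h + 1)" if "h \<in> Zh" for h
    proof -
      have "rho (f h) \<le> (\<Sum>y\<in>F0. rho y)" using F that by (intro member_le_sum) auto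
      also have "\<dots> \<le> (\<Sum>y\<in>F0. rho y) * (rho h + 1)"
        using mult_left_mono[of 1 "rho h + 1" "\<Sum>y\<in>F0. rho y"] by (simp add: sum_nonneg)
      finally show ?thesis .
    qed
    fix \<epsilon> :: real assume e: "\<epsilon> > 0"
    have "\<forall>y\<in>F0. \<exists>C\<ge>0. \<forall>x\<in>Zh. T x (x + y) \<le> \<epsilon> * rho x + C"
      using T_bounded_move[OF _ e] F(2) by blast
    then obtain C where C: "\<And>y. y \<in> F0 \<Longrightarrow> 0 \<le> C y" "\<And>y x. y \<in> F0 \<Longrightarrow> x \<in> Zh \<Longrightarrow> T x (x + y) \<le> \<epsilon> * rho x + C y"
      by metis
    have "T x (x + f h) \<le> (\<Sum>y\<in>F0. rho y) * rho h + \<epsilon> * (rho x + rho h) + (\<Sum>y\<in>F0. C y)"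
      if h: "h \<in> Zh" and x: "x \<in> Zh" for h x
    proof -
      have "T x (x + f h) \<le> \<epsilon> * rho x + C (f h)" using C(2) F(3) h x by blast
      also have "C (f h) \<le> (\<Sum>y\<in>F0. C y)" using F C(1) h by (intro member_le_sum) auto
      moreover have "0 \<le> (\<Sum>y\<in>F0. rho y) * rho h" "0 \<le> \<epsilon> * rho h" using e by (auto intro!: mult_nonneg_nonneg sum_nonneg)
      ultimately show ?thesis by (simp add: distrib_left)
    qed
    moreover have "0 \<le> (\<Sum>y\<in>F0. C y)" using C(1) by (intro sum_nonneg)
    ultimately show "\<exists>C\<ge>0. \<forall>h\<in>Zh. \<forall>x\<in>Zh. T x (x + f h) \<le> (\<Sum>y\<in>F0. rho y) * rho h + \<epsilon> * (rho x + rho h) + C"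
      by blast
  qed (use F in auto)
qed

text \<open>The element of height \<open>n * \<Delta>\<close> is a product of two commutators of multiples of the generators
with factors of size \<open>sqrt n\<close>: write \<open>n = m\<^sup>2 + r\<close> with \<open>r \<le> 2 m\<close>.\<close>

lemma bounded_speed_central:
  assumes n: "\<And>h. h \<in> Zh \<Longrightarrow> real (n h) \<le> (B * (rho h + 1))\<^sup>2" and B: "B \<ge> 0"
  shows "bounded_speed (\<lambda>h. Heis 0 (real (n h) * \<Delta>))"
proof (rule bounded_speed_cong)
  define m where "m h = nat \<lfloor>sqrt (real (n h))\<rfloor>" for h
  define r where "r h = n h - m h * m h" for h
  have ml: "real (m h) \<le> sqrt (real (n h))" for h by (simp add: m_def)
  have mu: "sqrt (real (n h)) < real (m h) + 1" for h unfolding m_def by simp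
  have m2: "m h * m h \<le> n h" for h
  proof -
    have "real (m h) * real (m h) \<le> sqrt (real (n h)) * sqrt (real (n h))" using ml by (intro mult_mono) auto
    then have "real (m h * m h) \<le> real (n h)" by simp
    then show ?thesis by (simp only: of_nat_le_iff)
  qed
  have r: "n h = m h * m h + r h" for h using m2[of h] by (simp add: r_def)
  have r2: "r h \<le> 2 * m h" for h
  proof -
    have "sqrt (real (n h)) * sqrt (real (n h)) < (real (m h) + 1) * (real (m h) + 1)"
      using mu[of h] by (intro mult_strict_mono) auto
    then have "real (n h) < real ((m h + 1) * (m h + 1))" by (simp add: algebra_simps)
    then have "n h < (m h + 1) * (m h + 1)" by (simp only: of_nat_less_iff)
    then show ?thesis using r[of h] by simp
  qed
  have mB: "real (m h) \<le> 2 * B * (rho h + 1)" "real (r h) \<le> 2 * B * (rho h + 1)" if "h \<in> Zh" for h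
  proof -
    have nn: "0 \<le> B * (rho h + 1)" using B by (intro mult_nonneg_nonneg add_nonneg_nonneg) auto
    have "real (m h) \<le> B * (rho h + 1)"
      using ml[of h] real_le_lsqrt[OF nn n[OF that]] by linarith
    then show "real (m h) \<le> 2 * B * (rho h + 1)" "real (r h) \<le> 2 * B * (rho h + 1)"
      using r2[of h] nn by (auto simp: mult.assoc)
  qed
  define B3 where "B3 = 2 * B + 1"
  have mB3: "real (m h) \<le> B3 * (rho h + 1)" "real (r h) \<le> B3 * (rho h + 1)" "real (1::nat) \<le> B3 * (rho h + 1)" if "h \<in> Zh" for h
  proof -
    have "B3 * (rho h + 1) = 2 * B * (rho h + 1) + (rho h + 1)" by (simp add: B3_def distrib_right)
    moreover have "0 \<le> 2 * B * (rho h + 1)" using B by (intro mult_nonneg_nonneg add_nonneg_nonneg) auto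
    ultimately show "real (m h) \<le> B3 * (rho h + 1)" "real (r h) \<le> B3 * (rho h + 1)" "real (1::nat) \<le> B3 * (rho h + 1)"
      using mB[OF that] rho_nonneg[of h] unfolding of_nat_1 by linarith+
  qed
  have B3: "B3 \<ge> 0" using B by (simp add: B3_def)
  define comm where "comm a b = smul (real a) s1 + smul (real b) s2 + - smul (real a) s1 + - smul (real b) s2" for a b
  have comm: "comm a b = Heis 0 (real a * real b * \<Delta>)" for a b
    using commutator_eq[of "smul (real a) s1" "smul (real b) s2"] by (simp add: comm_def)
  show "bounded_speed (\<lambda>h. comm (m h) (m h) + comm (r h) 1)"
    unfolding comm_def
    by (intro bounded_speed_add bounded_speed_uminus bounded_speed_line[of s1 _ B3] bounded_speed_line[of s2 _ B3] mB3 B3 disjI1 disjI2 refl)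
  show "comm (m h) (m h) + comm (r h) 1 = Heis 0 (real (n h) * \<Delta>)" for h
    unfolding comm by (rule heis_eqI) (auto simp: r[of h] algebra_simps)
qed

text \<open>A displacement \<open>h\<close> splits into multiples of \<open>s1\<close> and \<open>s2\<close> that account for its horizontal part up to rounding,
a central element of height at most proportional to \<open>(rho h + 1)\<^sup>2\<close>, and a remainder from a finite set.\<close>

lemma bounded_speed_id: "bounded_speed (\<lambda>h. h)"
proof -
  define i where "i h = \<lfloor>det2 (hor h) (hor s2) / \<Delta>\<rfloor>" for h
  define j where "j h = \<lfloor>det2 (hor s1) (hor h) / \<Delta>\<rfloor>" for h
  define B where "B = det2_const * (N (hor s1) + N (hor s2)) / \<bar>\<Delta>\<bar> + 1"
  have D: "\<bar>\<Delta>\<bar> > 0" using independent by simp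
  have B: "B \<ge> 0" using D det2_const_pos by (simp add: B_def)
  have q: "\<bar>real_of_int \<lfloor>t / \<Delta>\<rfloor>\<bar> \<le> B * (rho h + 1)" if "\<bar>t\<bar> \<le> det2_const * (N (hor s1) + N (hor s2)) * rho h" for t h
  proof -
    have "\<bar>real_of_int \<lfloor>t / \<Delta>\<rfloor>\<bar> \<le> \<bar>t / \<Delta>\<bar> + 1" by linarith
    also have "\<bar>t / \<Delta>\<bar> \<le> det2_const * (N (hor s1) + N (hor s2)) * rho h / \<bar>\<Delta>\<bar>"
      using that D by (simp add: abs_divide divide_right_mono)
    also have "\<dots> + 1 \<le> B * (rho h + 1)"
    proof -
      have "0 \<le> det2_const * (N (hor s1) + N (hor s2)) / \<bar>\<Delta>\<bar>" using D det2_const_pos by simp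
      then show ?thesis by (simp add: B_def distrib_left distrib_right)
    qed
    finally show ?thesis by simp
  qed
  have ib: "\<bar>real_of_int (i h)\<bar> \<le> B * (rho h + 1)" "\<bar>real_of_int (j h)\<bar> \<le> B * (rho h + 1)" for h
  proof -
    have "\<bar>det2 (hor h) (hor s2)\<bar> \<le> det2_const * (rho h * (N (hor s1) + N (hor s2)))"
      using det2_const_pos by (intro order_trans[OF det2_le] mult_left_mono mult_mono N_hor_le_rho) auto
    then show "\<bar>real_of_int (i h)\<bar> \<le> B * (rho h + 1)" unfolding i_def by (intro q) (simp add: mult_ac)
    have "\<bar>det2 (hor s1) (hor h)\<bar> \<le> det2_const * ((N (hor s1) + N (hor s2)) * rho h)"
      using det2_const_pos by (intro order_trans[OF det2_le] mult_left_mono mult_mono N_hor_le_rho) auto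
    then show "\<bar>real_of_int (j h)\<bar> \<le> B * (rho h + 1)" unfolding j_def by (intro q) (simp add: mult_ac)
  qed
  define f1 where "f1 h = smul (of_int (i h)) s1 + smul (of_int (j h)) s2" for h
  have mv1: "bounded_speed f1"
    unfolding f1_def[abs_def] using ib B by (intro bounded_speed_add bounded_speed_int_line[of s1 _ B] bounded_speed_int_line[of s2 _ B]) auto
  obtain A where "A \<ge> 0" and "speed_bound A f1" using mv1 unfolding bounded_speed_def by blast
  note A = this(1) speed_boundD[OF this(2)]
  define r where "r h = - f1 h + h" for h
  have rZ: "r h \<in> Zh" if "h \<in> Zh" for h using A(2)[OF that] that by (simp add: r_def)
  have rr: "rho (r h) \<le> (A + 1) * (rho h + 1)" if "h \<in> Zh" for h
    using rho_triangle[of "- f1 h" h] A(3)[OF that] by (simp add: r_def algebra_simps)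
  define k where "k h = \<lfloor>ver (r h) / \<Delta>\<rfloor>" for h
  define B2 where "B2 = sqrt (det2_const / \<bar>\<Delta>\<bar> + 1) * (A + 1)"
  have B2: "B2 \<ge> 0" using A(1) D det2_const_pos by (simp add: B2_def)
  have kB: "\<bar>real_of_int (k h)\<bar> \<le> (B2 * (rho h + 1))\<^sup>2" if h: "h \<in> Zh" for h
  proof -
    define t where "t = ((A + 1) * (rho h + 1))\<^sup>2"
    have one: "1 \<le> (A + 1) * (rho h + 1)"
      using A(1) rho_nonneg[of h] mult_mono[of 1 "A + 1" 1 "rho h + 1"] by simp
    then have t1: "1 \<le> t" by (simp add: t_def one_le_power)
    have "\<bar>ver (r h)\<bar> \<le> det2_const * t"
      unfolding t_def using det2_const_pos rr[OF h]
      by (intro order_trans[OF ver_le_rho] mult_left_mono power_mono) auto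
    then have "\<bar>ver (r h) / \<Delta>\<bar> \<le> det2_const * t / \<bar>\<Delta>\<bar>" using D by (simp add: abs_divide divide_right_mono)
    then have "\<bar>real_of_int (k h)\<bar> \<le> det2_const * t / \<bar>\<Delta>\<bar> + 1" unfolding k_def by linarith
    also have "\<dots> \<le> det2_const * t / \<bar>\<Delta>\<bar> + t" using t1 by simp
    also have "\<dots> = (det2_const / \<bar>\<Delta>\<bar> + 1) * t" by (simp add: distrib_right)
    also have "\<dots> = (B2 * (rho h + 1))\<^sup>2"
      using D det2_const_pos by (simp add: B2_def t_def power_mult_distrib)
    finally show ?thesis .
  qed
  define z where "z h = Heis 0 (of_int (k h) * \<Delta>)" for h
  have mvz: "bounded_speed z"
  proof (rule bounded_speed_cong)
    show "bounded_speed (\<lambda>h. Heis 0 (real (nat (k h)) * \<Delta>) + - Heis 0 (real (nat (- k h)) * \<Delta>))"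
    proof (intro bounded_speed_add bounded_speed_uminus bounded_speed_central[OF _ B2])
      show "real (nat (k h)) \<le> (B2 * (rho h + 1))\<^sup>2" "real (nat (- k h)) \<le> (B2 * (rho h + 1))\<^sup>2" if "h \<in> Zh" for h
        using kB[OF that] real_nat_le_abs[of "k h"] real_nat_le_abs[of "- k h"] by simp_all
    qed
    show "Heis 0 (real (nat (k h)) * \<Delta>) + - Heis 0 (real (nat (- k h)) * \<Delta>) = z h" for h
      by (cases "0 \<le> k h"; rule heis_eqI) (auto simp: z_def)
  qed
  have zZ: "z h \<in> Zh" if "h \<in> Zh" for h using bounded_speed_Zh[OF mvz] that by simp
  define f where "f h = - z h + r h" for h
  define b where "b = \<bar>\<Delta>\<bar> + \<bar>fst (hor s1)\<bar> + \<bar>fst (hor s2)\<bar> + \<bar>snd (hor s1)\<bar> + \<bar>snd (hor s2)\<bar>"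
  have fbox: "f h \<in> {g \<in> Zh. \<bar>fst (hor g)\<bar> \<le> b \<and> \<bar>snd (hor g)\<bar> \<le> b \<and> \<bar>ver g\<bar> \<le> b}" if h: "h \<in> Zh" for h
  proof -
    define a1 a2 where "a1 = det2 (hor h) (hor s2) / \<Delta> - of_int (i h)" and "a2 = det2 (hor s1) (hor h) / \<Delta> - of_int (j h)"
    have a: "\<bar>a1\<bar> \<le> 1" "\<bar>a2\<bar> \<le> 1" unfolding a1_def a2_def i_def j_def by linarith+
    have "hor (f h) = - (of_int (i h) *\<^sub>R hor s1 + of_int (j h) *\<^sub>R hor s2) + hor h"
      by (simp add: f_def z_def r_def f1_def)
    also have "\<dots> = a1 *\<^sub>R hor s1 + a2 *\<^sub>R hor s2"
      using det2_basis_expansion[OF independent, of "hor h"] by (simp add: a1_def a2_def scaleR_left_diff_distrib)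
    finally have hf: "hor (f h) = a1 *\<^sub>R hor s1 + a2 *\<^sub>R hor s2" .
    have bb: "1 * \<bar>fst (hor s1)\<bar> + 1 * \<bar>fst (hor s2)\<bar> \<le> b" "1 * \<bar>snd (hor s1)\<bar> + 1 * \<bar>snd (hor s2)\<bar> \<le> b" "\<bar>\<Delta>\<bar> \<le> b"
      by (simp_all add: b_def)
    have 1: "\<bar>fst (hor (f h))\<bar> \<le> 1 * \<bar>fst (hor s1)\<bar> + 1 * \<bar>fst (hor s2)\<bar>"
      unfolding hf using a by (auto simp: abs_mult intro!: order_trans[OF abs_triangle_ineq] add_mono mult_left_le_one_le)
    have 2: "\<bar>snd (hor (f h))\<bar> \<le> 1 * \<bar>snd (hor s1)\<bar> + 1 * \<bar>snd (hor s2)\<bar>"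
      unfolding hf using a by (auto simp: abs_mult intro!: order_trans[OF abs_triangle_ineq] add_mono mult_left_le_one_le)
    have 3: "\<bar>ver (f h)\<bar> \<le> \<bar>\<Delta>\<bar>"
    proof -
      have "ver (f h) = (ver (r h) / \<Delta> - of_int (k h)) * \<Delta>"
        using independent by (simp add: f_def z_def left_diff_distrib)
      moreover have "\<bar>ver (r h) / \<Delta> - of_int (k h)\<bar> \<le> 1" unfolding k_def by linarith
      ultimately show ?thesis by (simp add: abs_mult mult_left_le_one_le)
    qed
    have "f h \<in> Zh" using rZ[OF h] zZ[OF h] by (simp add: f_def)
    then show ?thesis using order_trans[OF 1 bb(1)] order_trans[OF 2 bb(2)] order_trans[OF 3 bb(3)] by blast
  qed
  have "bounded_speed f"
  proof (rule bounded_speed_finite)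
    show "finite (f ` Zh)" by (rule finite_subset[OF image_subsetI[OF fbox] finite_Zh_box])
    show "f ` Zh \<subseteq> Zh" by (rule image_subsetI) (use fbox in simp)
  qed
  then have "bounded_speed (\<lambda>h. f1 h + (z h + f h))" by (intro bounded_speed_add mv1 mvz)
  then show ?thesis by (rule bounded_speed_cong) (simp add: f_def r_def)
qed

lemma T_lipschitz:
  "\<exists>A\<ge>0. \<forall>\<epsilon>>0. \<exists>C\<ge>0. \<forall>x\<in>Zh. \<forall>y\<in>Zh. T x y \<le> A * rho (- x + y) + \<epsilon> * (rho x + rho (- x + y)) + C"
proof -
  obtain A where "A \<ge> 0" and "speed_bound A (\<lambda>h. h)" using bounded_speed_id unfolding bounded_speed_def by blast
  note A = this(1) speed_boundD[OF this(2)]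
  have "\<exists>C\<ge>0. \<forall>x\<in>Zh. \<forall>y\<in>Zh. T x y \<le> A * rho (- x + y) + \<epsilon> * (rho x + rho (- x + y)) + C" if e: "\<epsilon> > 0" for \<epsilon>
  proof -
    obtain C where "C \<ge> 0" and C: "\<And>h x. h \<in> Zh \<Longrightarrow> x \<in> Zh \<Longrightarrow> T x (x + h) \<le> A * rho h + \<epsilon> * (rho x + rho h) + C"
      using A(4)[OF e] by blast
    moreover have "T x y \<le> A * rho (- x + y) + \<epsilon> * (rho x + rho (- x + y)) + C" if "x \<in> Zh" "y \<in> Zh" for x y
      using C[of "- x + y" x] that by simp
    ultimately show ?thesis by blast
  qed
  then show ?thesis using A(1) by blast
qed

end

section \<open>Travelling along the highways\<close>

context traveller
begin

text \<open>From any \<open>x\<close> one can travel by \<open>dil l g\<close> at cost \<open>L * l\<close>, with sublinear errors both in the cost and in the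
position of the endpoint. Allowing an error of position is what makes the property stable under limits.\<close>

definition reach :: "heis \<Rightarrow> real \<Rightarrow> bool" where
  "reach g L \<longleftrightarrow> (\<forall>\<epsilon>>0. \<exists>C\<ge>0. \<forall>x\<in>Zh. \<forall>l\<ge>1. \<exists>y\<in>Zh.
     T x y \<le> L * l + \<epsilon> * (rho x + l) + C \<and> rho (- (x + dil l g) + y) \<le> \<epsilon> * l + C)"

lemma reachI:
  assumes "\<And>\<epsilon>. \<epsilon> > 0 \<Longrightarrow> \<exists>C\<ge>0. \<forall>x\<in>Zh. \<forall>l\<ge>1. \<exists>y\<in>Zh.
     T x y \<le> L * l + \<epsilon> * (rho x + l) + C \<and> rho (- (x + dil l g) + y) \<le> \<epsilon> * l + C"
  shows "reach g L"
  using assms unfolding reach_def by blast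

lemma reachD:
  assumes "reach g L" "\<epsilon> > 0"
  shows "\<exists>C\<ge>0. \<forall>x\<in>Zh. \<forall>l\<ge>1. \<exists>y\<in>Zh.
     T x y \<le> L * l + \<epsilon> * (rho x + l) + C \<and> rho (- (x + dil l g) + y) \<le> \<epsilon> * l + C"
  using assms unfolding reach_def by blast

lemma reach_0: "reach 0 0"
proof (rule reachI)
  fix \<epsilon> :: real assume "\<epsilon> > 0"
  then show "\<exists>C\<ge>0. \<forall>x\<in>Zh. \<forall>l\<ge>1. \<exists>y\<in>Zh.
     T x y \<le> 0 * l + \<epsilon> * (rho x + l) + C \<and> rho (- (x + dil l 0) + y) \<le> \<epsilon> * l + C"
    by (intro exI[of _ 0] conjI ballI allI impI bexI) (auto simp: T_refl)
qed

text \<open>Travel by \<open>dil l g1\<close> and then by \<open>dil l g2\<close>. The error of position of the first part is conjugated by \<open>dil l g2\<close>,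
which keeps it sublinear.\<close>

lemma reach_add:
  assumes 1: "reach g1 L1" and 2: "reach g2 L2"
  shows "reach (g1 + g2) (L1 + L2)"
proof (rule reachI)
  fix \<epsilon> :: real assume e: "\<epsilon> > 0"
  define p where "p = 1 + N (hor g2)"
  \<comment> \<open>The tolerances are chosen in the order of the estimates: \<open>K\<close> controls the conjugation by \<open>dil l g2\<close>, \<open>d1\<close> the
    error that is conjugated, and \<open>d2\<close> the second journey, which starts at a point of norm at most
    \<open>rho x + q * l\<close> up to a constant.\<close>
  define K where "K = (\<epsilon> / 4) / p"
  have p: "p > 0" using N_nonneg[of "hor g2"] unfolding p_def by linarith
  have K: "K > 0" "K * N (hor g2) \<le> \<epsilon> / 4"
  proof -
    show K0: "K > 0" using e p by (simp add: K_def)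
    have "K * p = \<epsilon> / 4" using p by (simp add: K_def)
    then show "K * N (hor g2) \<le> \<epsilon> / 4" using K0 unfolding p_def by (simp add: distrib_left)
  qed
  define P where "P = 1 + conj_const\<^sup>2 / K"
  have P: "P \<ge> 1" using K(1) by (simp add: P_def)
  define d1 where "d1 = (\<epsilon> / 4) / P"
  have d1: "d1 > 0" "P * d1 = \<epsilon> / 4" using e P by (auto simp: d1_def)
  have d1': "d1 \<le> \<epsilon> / 4"
    using mult_right_mono[OF P less_imp_le[OF d1(1)]] unfolding d1(2) by simp
  define q where "q = 1 + rho g1 + \<epsilon>"
  define d2 where "d2 = (\<epsilon> / 4) / q"
  have q: "q \<ge> 1" using rho_nonneg[of g1] e unfolding q_def by linarith
  then have d2: "d2 > 0" "d2 * q = \<epsilon> / 4" using e by (auto simp: d2_def)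
  have d2': "d2 \<le> \<epsilon> / 4" 
    using mult_left_mono[OF q less_imp_le[OF d2(1)]] unfolding d2(2) by simp
  obtain C1 where C1: "C1 \<ge> 0" "\<forall>x\<in>Zh. \<forall>l\<ge>1. \<exists>y\<in>Zh.
     T x y \<le> L1 * l + d1 * (rho x + l) + C1 \<and> rho (- (x + dil l g1) + y) \<le> d1 * l + C1"
    using reachD[OF 1 d1(1)] by blast
  obtain C2 where C2: "C2 \<ge> 0" "\<forall>x\<in>Zh. \<forall>l\<ge>1. \<exists>y\<in>Zh.
     T x y \<le> L2 * l + d2 * (rho x + l) + C2 \<and> rho (- (x + dil l g2) + y) \<le> d2 * l + C2"
    using reachD[OF 2 d2(1)] by blast
  define C where "C = C1 + 2 * C2 + d2 * C1 + P * C1"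
  have C0: "0 \<le> d2 * C1" "0 \<le> P * C1" using C1 d2 P by auto
  have "\<exists>y\<in>Zh. T x y \<le> (L1 + L2) * l + \<epsilon> * (rho x + l) + C \<and> rho (- (x + dil l (g1 + g2)) + y) \<le> \<epsilon> * l + C"
    if x: "x \<in> Zh" and l: "l \<ge> 1" for x l
  proof -
    obtain y1 where y1: "y1 \<in> Zh" "T x y1 \<le> L1 * l + d1 * (rho x + l) + C1" "rho (- (x + dil l g1) + y1) \<le> d1 * l + C1"
      using C1(2) x l by blast
    obtain y2 where y2: "y2 \<in> Zh" "T y1 y2 \<le> L2 * l + d2 * (rho y1 + l) + C2" "rho (- (y1 + dil l g2) + y2) \<le> d2 * l + C2"
      using C2(2) y1(1) l by blast
    define e1 e2 where "e1 = - (x + dil l g1) + y1" and "e2 = - (y1 + dil l g2) + y2"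
    have y1e: "y1 = x + dil l g1 + e1" by (simp add: e1_def add.assoc[symmetric])
    have y2e: "y2 = y1 + dil l g2 + e2" by (simp add: e2_def add.assoc[symmetric])
    have "rho y1 \<le> rho x + l * rho g1 + (d1 * l + C1)"
      using rho_triangle[of "x + dil l g1" e1] rho_triangle[of x "dil l g1"] y1(3) rho_dil[of l g1] l
      unfolding y1e[symmetric] e1_def[symmetric] by simp
    moreover have "d1 * l \<le> \<epsilon> * l" using d1' e l by (intro mult_right_mono) auto
    ultimately have "rho y1 + l \<le> rho x + q * l + C1" by (simp add: q_def algebra_simps)
    then have "d2 * (rho y1 + l) \<le> d2 * (rho x + q * l + C1)" using d2 by (intro mult_left_mono) auto
    also have "\<dots> = d2 * rho x + (\<epsilon> / 4) * l + d2 * C1" using d2(2) by (simp add: distrib_left mult.assoc[symmetric])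
    also have "d2 * rho x \<le> (\<epsilon> / 4) * rho x" using d2' by (intro mult_right_mono) auto
    finally have A: "d2 * (rho y1 + l) \<le> (\<epsilon> / 4) * rho x + (\<epsilon> / 4) * l + d2 * C1" by simp
    have B: "d1 * (rho x + l) \<le> (\<epsilon> / 4) * (rho x + l)" using d1' l by (intro mult_right_mono) auto
    have nn: "0 \<le> \<epsilon> * rho x" "0 \<le> \<epsilon> * l" using e l by auto
    have "T x y2 \<le> T x y1 + T y1 y2" using x y1(1) y2(1) by (rule T_triangle)
    then have "T x y2 \<le> (L1 + L2) * l + \<epsilon> * (rho x + l) + C"
      using y1(2) y2(2) A B C0 C2(1) nn by (simp add: C_def algebra_simps)
    moreover have "rho (- (x + dil l (g1 + g2)) + y2) \<le> \<epsilon> * l + C"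
    proof -
      have "- (x + dil l (g1 + g2)) + y2 = (- dil l g2 + e1 + dil l g2) + e2"
        unfolding y2e y1e dil_plus by (simp add: minus_add add.assoc del: add_uminus_conv_diff)
      then have "rho (- (x + dil l (g1 + g2)) + y2) \<le> rho (- dil l g2 + e1 + dil l g2) + rho e2"
        by (simp only: rho_triangle)
      also have "rho (- dil l g2 + e1 + dil l g2) \<le> P * rho e1 + K * N (hor (dil l g2))"
        unfolding P_def by (rule rho_conj_le_linear[OF K(1)])
      also have "P * rho e1 \<le> P * (d1 * l + C1)" using y1(3) P by (intro mult_left_mono) (auto simp: e1_def)
      also have "K * N (hor (dil l g2)) = (K * N (hor g2)) * l" using l by simp
      also have "\<dots> \<le> \<epsilon> / 4 * l" using K(2) l by (intro mult_right_mono) auto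
      also have "rho e2 \<le> d2 * l + C2" using y2(3) by (simp add: e2_def)
      also have "d2 * l \<le> \<epsilon> / 4 * l" using d2' l by (intro mult_right_mono) auto
      also have "P * (d1 * l + C1) = \<epsilon> / 4 * l + P * C1" using d1(2) by (simp add: distrib_left mult.assoc[symmetric])
      finally show ?thesis using C0 C1(1) C2(1) nn by (simp add: C_def)
    qed
    ultimately show ?thesis using y2(1) by blast
  qed
  moreover have "C \<ge> 0" using C0 C1 C2 by (simp add: C_def)
  ultimately show "\<exists>C\<ge>0. \<forall>x\<in>Zh. \<forall>l\<ge>1. \<exists>y\<in>Zh.
     T x y \<le> (L1 + L2) * l + \<epsilon> * (rho x + l) + C \<and> rho (- (x + dil l (g1 + g2)) + y) \<le> \<epsilon> * l + C" by blast
qed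

lemma reach_closed:
  assumes "\<And>\<eta>. \<eta> > 0 \<Longrightarrow> \<exists>g' L'. reach g' L' \<and> L' \<le> L + \<eta> \<and> rho (- g' + g) \<le> \<eta>"
  shows "reach g L"
proof (rule reachI)
  fix \<epsilon> :: real assume e: "\<epsilon> > 0"
  obtain g' L' where g': "reach g' L'" "L' \<le> L + \<epsilon> / 4" "rho (- g' + g) \<le> \<epsilon> / 4"
    using assms[of "\<epsilon> / 4"] e by auto
  obtain C where C: "C \<ge> 0" "\<forall>x\<in>Zh. \<forall>l\<ge>1. \<exists>y\<in>Zh.
     T x y \<le> L' * l + \<epsilon> / 2 * (rho x + l) + C \<and> rho (- (x + dil l g') + y) \<le> \<epsilon> / 2 * l + C"
    using reachD[OF g'(1) half_gt_zero[OF e]] by blast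
  have "\<exists>y\<in>Zh. T x y \<le> L * l + \<epsilon> * (rho x + l) + C \<and> rho (- (x + dil l g) + y) \<le> \<epsilon> * l + C"
    if x: "x \<in> Zh" and l: "l \<ge> 1" for x l
  proof -
    obtain y where y: "y \<in> Zh" "T x y \<le> L' * l + \<epsilon> / 2 * (rho x + l) + C" "rho (- (x + dil l g') + y) \<le> \<epsilon> / 2 * l + C"
      using C(2) x l by blast
    have nn: "0 \<le> \<epsilon> * rho x" "0 \<le> \<epsilon> * l" using e l by auto
    have "L' * l \<le> (L + \<epsilon> / 4) * l" using g'(2) l by (intro mult_right_mono) auto
    moreover have "(L + \<epsilon> / 4) * l = L * l + (\<epsilon> * l) / 4" by (simp add: algebra_simps)
    moreover have "\<epsilon> / 2 * (rho x + l) = (\<epsilon> * rho x) / 2 + (\<epsilon> * l) / 2"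
      "\<epsilon> * (rho x + l) = \<epsilon> * rho x + \<epsilon> * l" by (simp_all add: field_simps)
    ultimately have "T x y \<le> L * l + \<epsilon> * (rho x + l) + C"
      using y(2) nn by linarith
    moreover have "rho (- (x + dil l g) + y) \<le> \<epsilon> * l + C"
    proof -
      have "- (x + dil l g) + (x + dil l g') = dil l (- g + g')"
        by (simp only: left_cancel dil_plus dil_uminus)
      then have "rho (- (x + dil l g) + (x + dil l g')) = l * rho (- g' + g)"
        using l rho_dil[of l "- g + g'"] rho_minus_commute[of g g'] by simp
      also have "\<dots> \<le> l * (\<epsilon> / 4)" using g'(3) l by (intro mult_left_mono) auto
      also have "\<dots> = (\<epsilon> * l) / 4" by simp
      finally have "rho (- (x + dil l g) + (x + dil l g')) \<le> (\<epsilon> * l) / 4" .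
      moreover have "\<epsilon> / 2 * l = (\<epsilon> * l) / 2" by simp
      ultimately show ?thesis
        using rho_triangle_via[of "x + dil l g" y "x + dil l g'"] y(3) nn by simp
    qed
    ultimately show ?thesis using y(1) by blast
  qed
  then show "\<exists>C\<ge>0. \<forall>x\<in>Zh. \<forall>l\<ge>1. \<exists>y\<in>Zh.
     T x y \<le> L * l + \<epsilon> * (rho x + l) + C \<and> rho (- (x + dil l g) + y) \<le> \<epsilon> * l + C" using C(1) by blast
qed

lemma highway_cost_int:
  assumes e: "\<epsilon> > 0"
  shows "\<exists>C\<ge>0. \<forall>x\<in>Zh. gap k dvd F k x - c k \<longrightarrow>
    (\<forall>n::int. T x (x + smul (of_int n) (period k)) \<le> \<bar>of_int n\<bar> * (N (dir k) + 1 / 2 ^ k) + \<epsilon> * (rho x + \<bar>of_int n\<bar>) + C)"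
proof -
  define \<epsilon>' where "\<epsilon>' = \<epsilon> / (1 + rho (period k))"
  have p: "1 + rho (period k) > 0" using rho_nonneg[of "period k"] by linarith
  have e': "\<epsilon>' > 0" "\<epsilon>' * (1 + rho (period k)) = \<epsilon>" using e p by (auto simp: \<epsilon>'_def)
  have e'': "\<epsilon>' \<le> \<epsilon>"
    using mult_left_mono[of 1 "1 + rho (period k)" \<epsilon>'] e'(1) unfolding e'(2) by simp
  obtain C where C: "C \<ge> 0" "\<forall>x\<in>Zh. gap k dvd F k x - c k \<longrightarrow>
    (\<forall>n. T x (x + smul (real n) (period k)) \<le> real n * (N (dir k) + 1 / 2 ^ k) + \<epsilon>' * (rho x + real n) + C)"
    using highway_cost[OF e'(1), of k] by blast
  have "T x (x + smul (of_int n) (period k)) \<le> \<bar>of_int n\<bar> * (N (dir k) + 1 / 2 ^ k) + \<epsilon> * (rho x + \<bar>of_int n\<bar>) + C"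
    if x: "x \<in> Zh" "gap k dvd F k x - c k" for x and n :: int
  proof (cases "n \<ge> 0")
    case True
    then have n: "real_of_int n = real (nat n)" by simp
    have "T x (x + smul (of_int n) (period k)) \<le> \<bar>of_int n\<bar> * (N (dir k) + 1 / 2 ^ k) + \<epsilon>' * (rho x + \<bar>of_int n\<bar>) + C"
      using C(2)[rule_format, OF x, of "nat n"] unfolding n by simp
    also have "\<epsilon>' * (rho x + \<bar>of_int n\<bar>) \<le> \<epsilon> * (rho x + \<bar>of_int n\<bar>)"
      using e'' by (intro mult_right_mono) (auto intro: add_nonneg_nonneg)
    finally show ?thesis by simp
  next
    case False
    define m where "m = nat (- n)"
    have n: "real_of_int n = - real m" using False by (simp add: m_def)
    define y where "y = x + smul (of_int n) (period k)"
    have y: "y \<in> Zh" "y + smul (real m) (period k) = x"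
      using x(1) by (auto simp: y_def n smul_minus)
    have "F k y = F k x" using x(1) by (simp add: y_def n smul_minus)
    then have "T y (y + smul (real m) (period k)) \<le> real m * (N (dir k) + 1 / 2 ^ k) + \<epsilon>' * (rho y + real m) + C"
      using C(2)[rule_format, OF y(1), of m] x(2) by simp
    moreover have "\<epsilon>' * (rho y + real m) \<le> \<epsilon> * (rho x + real m)"
    proof -
      have "rho y \<le> rho x + real m * rho (period k)"
        using rho_triangle[of x "- smul (real m) (period k)"] rho_smul_le[of m "period k"] by (simp add: y_def n smul_minus)
      then have "\<epsilon>' * (rho y + real m) \<le> \<epsilon>' * (rho x + (1 + rho (period k)) * real m)"
        using e'(1) by (intro mult_left_mono) (auto simp: algebra_simps)
      also have "\<dots> = \<epsilon>' * rho x + \<epsilon> * real m" using e'(2) by (simp add: distrib_left mult.assoc[symmetric])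
      also have "\<epsilon>' * rho x \<le> \<epsilon> * rho x" using e'' by (intro mult_right_mono) auto
      finally show ?thesis by (simp add: distrib_left)
    qed
    moreover have "T x y = T y x" using x(1) y(1) by (rule T_sym)
    ultimately show ?thesis using y(2) unfolding n y_def[symmetric, unfolded n] by simp
  qed
  then show ?thesis using C(1) by blast
qed

text \<open>Boundedly many moves by a point on which \<open>F k\<close> is \<open>1\<close> lead to a base point of the highway. Then follow it for the
integer part of \<open>l * \<tau>\<close> periods. Conjugating by \<open>shift k\<close> turns the periods into the straight segment, so the
endpoint is missed by a bounded element conjugated by a long one.\<close>

lemma reach_highway: "reach (Heis (\<tau> *\<^sub>R dir k) 0) (\<bar>\<tau>\<bar> * (N (dir k) + 1 / 2 ^ k))"
proof (rule reachI)
  fix \<epsilon> :: real assume e: "\<epsilon> > 0"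
  define W where "W = N (dir k) + 1 / 2 ^ k"
  have W: "W \<ge> 0" by (simp add: W_def)
  define \<epsilon>1 where "\<epsilon>1 = \<epsilon> / (2 + \<bar>\<tau>\<bar>)"
  have e1: "\<epsilon>1 > 0" "\<epsilon>1 * (2 + \<bar>\<tau>\<bar>) = \<epsilon>" using e by (auto simp: \<epsilon>1_def)
  define M where "M = nat (gap k)"
  obtain b where b: "b \<in> Zh" "F k b = 1" using F_surj[of k] by blast
  define R where "R = (\<Sum>r<M. rho (smul (real r) b))"
  have R: "rho (smul (real r) b) \<le> R" if "r < M" for r
    unfolding R_def using that by (intro member_le_sum[of r _ "\<lambda>r. rho (smul (real r) b)"]) auto
  have R0: "R \<ge> 0" by (simp add: R_def sum_nonneg)
  have "\<forall>r. \<exists>C\<ge>0. \<forall>x\<in>Zh. T x (x + smul (real r) b) \<le> \<epsilon>1 * rho x + C"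
    using T_bounded_move[OF Zh_smul_nat[OF b(1)] e1(1)] by blast
  then obtain Cr where Cr: "\<And>r. 0 \<le> Cr r" "\<And>r x. x \<in> Zh \<Longrightarrow> T x (x + smul (real r) b) \<le> \<epsilon>1 * rho x + Cr r"
    by metis
  define C1 where "C1 = (\<Sum>r<M. Cr r)"
  have C1: "0 \<le> C1" "\<And>r. r < M \<Longrightarrow> Cr r \<le> C1"
    unfolding C1_def using Cr(1) by (auto intro!: sum_nonneg member_le_sum[of _ "{..<M}" Cr])
  obtain C2 where C2: "C2 \<ge> 0" "\<forall>x\<in>Zh. gap k dvd F k x - c k \<longrightarrow>
    (\<forall>n::int. T x (x + smul (of_int n) (period k)) \<le> \<bar>of_int n\<bar> * (N (dir k) + 1 / 2 ^ k) + \<epsilon>1 * (rho x + \<bar>of_int n\<bar>) + C2)"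
    using highway_cost_int[OF e1(1), of k] by blast
  define K where "K = \<epsilon> / (1 + \<bar>\<tau>\<bar> * N (dir k))"
  have p: "1 + \<bar>\<tau>\<bar> * N (dir k) > 0" by (intro add_pos_nonneg) auto
  have K: "K > 0" "K * (\<bar>\<tau>\<bar> * N (dir k)) \<le> \<epsilon>"
  proof -
    show K0: "K > 0" using e p by (simp add: K_def)
    have "K * (1 + \<bar>\<tau>\<bar> * N (dir k)) = \<epsilon>" using p by (simp add: K_def)
    then show "K * (\<bar>\<tau>\<bar> * N (dir k)) \<le> \<epsilon>" using K0 by (simp add: distrib_left)
  qed
  define P where "P = 1 + conj_const\<^sup>2 / K"
  have P: "P \<ge> 1" using K(1) by (simp add: P_def)
  define D where "D s = Heis (s *\<^sub>R dir k) 0" for s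
  define Ca where "Ca = C1 + W + \<epsilon>1 * (R + 1) + C2"
  define Cb where "Cb = P * (R + rho (shift k)) + N (dir k) + rho (shift k)"
  have Cab: "Ca \<ge> 0" "Cb \<ge> 0"
    using C1(1) C2(1) W R0 e1(1) P by (auto simp: Ca_def Cb_def intro!: add_nonneg_nonneg mult_nonneg_nonneg)
  have per: "smul (of_int n) (period k) = shift k + D (of_int n) - shift k" for n
  proof -
    have "period k = shift k + D 1 - shift k"
      using period_shift[of k] by (simp add: D_def eq_diff_eq)
    then have "smul (of_int n) (period k) = shift k + smul (of_int n) (D 1) - shift k"
      using smul_conj[of "of_int n" "shift k" "D 1"] by simp
    moreover have "smul (of_int n) (D 1) = D (of_int n)" by (rule heis_eqI) (auto simp: D_def)
    ultimately show ?thesis by simp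
  qed
  have "\<exists>y\<in>Zh. T x y \<le> \<bar>\<tau>\<bar> * W * l + \<epsilon> * (rho x + l) + (Ca + Cb) \<and> rho (- (x + dil l (D \<tau>)) + y) \<le> \<epsilon> * l + (Ca + Cb)"
    if x: "x \<in> Zh" and l: "l \<ge> 1" for x l
  proof -
    define r where "r = nat ((c k - F k x) mod gap k)"
    have r: "r < M" "int r = (c k - F k x) mod gap k" using gap_props(1)[of k] by (auto simp: r_def M_def nat_less_iff)
    define a where "a = smul (real r) b"
    define x' where "x' = x + a"
    have x': "x' \<in> Zh" using x b by (simp add: x'_def a_def)
    have "F k x' - c k = int r - (c k - F k x)" using x b by (simp add: x'_def a_def)
    then have on: "gap k dvd F k x' - c k"
      unfolding r(2) by (metis dvd_minus_mod dvd_diff_commute)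
    define n where "n = \<lfloor>l * \<tau>\<rfloor>"
    have n: "\<bar>real_of_int n - l * \<tau>\<bar> \<le> 1" unfolding n_def by linarith
    moreover have "\<bar>l * \<tau>\<bar> = l * \<bar>\<tau>\<bar>" using l by (simp add: abs_mult)
    ultimately have n': "\<bar>real_of_int n\<bar> \<le> l * \<bar>\<tau>\<bar> + 1" by linarith
    define y where "y = x' + smul (of_int n) (period k)"
    have y: "y \<in> Zh" using x' by (simp add: y_def)
    have rx': "rho x' \<le> rho x + R" using rho_triangle[of x a] R[OF r(1)] by (simp add: x'_def a_def)
    have "T x y \<le> T x x' + T x' y" using x x' y by (rule T_triangle)
    also have "T x x' \<le> \<epsilon>1 * rho x + C1" using Cr(2)[OF x, of r] C1(2)[OF r(1)] by (simp add: x'_def a_def)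
    also have "T x' y \<le> \<bar>of_int n\<bar> * W + \<epsilon>1 * (rho x' + \<bar>of_int n\<bar>) + C2"
      unfolding y_def W_def using C2(2) x' on by blast
    also have "\<bar>of_int n\<bar> * W \<le> (l * \<bar>\<tau>\<bar> + 1) * W" using n' W by (intro mult_right_mono) auto
    also have "\<epsilon>1 * (rho x' + \<bar>of_int n\<bar>) \<le> \<epsilon>1 * (rho x + R + (l * \<bar>\<tau>\<bar> + 1))"
      using rx' n' e1 by (intro mult_left_mono) auto
    finally have "T x y \<le> \<bar>\<tau>\<bar> * W * l + (\<epsilon>1 * 2 * rho x + \<epsilon>1 * \<bar>\<tau>\<bar> * l) + Ca"
      by (simp add: Ca_def algebra_simps)
    moreover have "\<epsilon>1 * 2 * rho x \<le> \<epsilon> * rho x" using e1 by (intro mult_right_mono) (auto simp: distrib_left)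
    moreover have "\<epsilon>1 * \<bar>\<tau>\<bar> * l \<le> \<epsilon> * l" using e1 l by (intro mult_right_mono) (auto simp: distrib_left)
    ultimately have "T x y \<le> \<bar>\<tau>\<bar> * W * l + \<epsilon> * (rho x + l) + (Ca + Cb)"
      using Cab by (simp add: distrib_left)
    moreover have "rho (- (x + dil l (D \<tau>)) + y) \<le> \<epsilon> * l + (Ca + Cb)"
    proof -
      have dD: "dil l (D \<tau>) = D (l * \<tau>)" by (rule heis_eqI) (auto simp: D_def)
      have nD: "D (of_int n) = D (l * \<tau>) + D (of_int n - l * \<tau>)"
        by (rule heis_eqI) (auto simp: D_def algebra_simps)
      have "- (x + dil l (D \<tau>)) + y = ((- D (l * \<tau>) + (a + shift k) + D (l * \<tau>)) + D (of_int n - l * \<tau>)) + - shift k"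
        unfolding y_def x'_def per nD dD
        by (simp add: minus_add add.assoc diff_conv_add_uminus del: add_uminus_conv_diff)
      then have "rho (- (x + dil l (D \<tau>)) + y)
          \<le> rho (- D (l * \<tau>) + (a + shift k) + D (l * \<tau>)) + rho (D (of_int n - l * \<tau>)) + rho (- shift k)"
        using rho_triangle[of "(- D (l * \<tau>) + (a + shift k) + D (l * \<tau>)) + D (of_int n - l * \<tau>)" "- shift k"]
          rho_triangle[of "- D (l * \<tau>) + (a + shift k) + D (l * \<tau>)" "D (of_int n - l * \<tau>)"] by simp
      also have "rho (- D (l * \<tau>) + (a + shift k) + D (l * \<tau>)) \<le> P * rho (a + shift k) + K * N (hor (D (l * \<tau>)))"
        unfolding P_def by (rule rho_conj_le_linear[OF K(1)])
      also have "P * rho (a + shift k) \<le> P * (R + rho (shift k))"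
        using rho_triangle[of a "shift k"] R[OF r(1)] P by (intro mult_left_mono) (auto simp: a_def)
      also have "K * N (hor (D (l * \<tau>))) = K * (\<bar>\<tau>\<bar> * N (dir k)) * l" using l by (simp add: D_def abs_mult)
      also have "\<dots> \<le> \<epsilon> * l" using K(2) l by (intro mult_right_mono) auto
      also have "rho (D (of_int n - l * \<tau>)) \<le> N (dir k)"
        using rho_hor_le[of "(of_int n - l * \<tau>) *\<^sub>R dir k"] mult_right_mono[OF n N_nonneg[of "dir k"]] by (simp add: D_def)
      finally show ?thesis using Cab by (simp add: Cb_def)
    qed
    ultimately show ?thesis using y by blast
  qed
  then show "\<exists>C\<ge>0. \<forall>x\<in>Zh. \<forall>l\<ge>1. \<exists>y\<in>Zh.
     T x y \<le> \<bar>\<tau>\<bar> * (N (dir k) + 1 / 2 ^ k) * l + \<epsilon> * (rho x + l) + C \<and>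
     rho (- (x + dil l (Heis (\<tau> *\<^sub>R dir k) 0)) + y) \<le> \<epsilon> * l + C"
    using Cab unfolding W_def D_def by (intro exI[of _ "Ca + Cb"]) auto
qed

text \<open>Approximate \<open>v\<close> by multiples of highway directions of higher and higher level, whose
surcharge \<open>1 / 2 ^ k\<close> tends to \<open>0\<close>.\<close>

lemma reach_horizontal: "reach (Heis v 0) (N v)"
proof (rule reach_closed)
  fix \<eta> :: real assume e: "\<eta> > 0"
  obtain d where d: "d > 0" "\<And>g. N (hor g) \<le> d \<Longrightarrow> \<bar>ver g\<bar> \<le> d \<Longrightarrow> rho g \<le> \<eta>"
    using rho_small[OF e] by blast
  define B where "B = N (hor s1) + N (hor s2) + 1"
  define B' where "B' = B * (1 + det2_const * N v)"
  have B: "B \<ge> 1" by (simp add: B_def)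
  have sv: "0 \<le> det2_const * N v" using det2_const_pos by simp
  have B': "B' \<ge> 1" using B sv mult_mono[of 1 B 1 "1 + det2_const * N v"] by (simp add: B'_def)
  define \<delta> where "\<delta> = min d (\<eta> / 2) / B'"
  have \<delta>: "\<delta> > 0" "\<delta> * B' \<le> d" "\<delta> * B' \<le> \<eta> / 2" using d e B' by (auto simp: \<delta>_def)
  have \<delta>B: "\<delta> * B \<le> d" "\<delta> * B \<le> \<eta> / 2" "det2_const * (\<delta> * B * N v) \<le> d"
  proof -
    have "\<delta> * B' = \<delta> * B + det2_const * (\<delta> * B * N v)" by (simp add: B'_def algebra_simps)
    moreover have "0 \<le> \<delta> * B" "0 \<le> det2_const * (\<delta> * B * N v)"
      using \<delta>(1) B det2_const_pos by auto
    ultimately show "\<delta> * B \<le> d" "\<delta> * B \<le> \<eta> / 2" "det2_const * (\<delta> * B * N v) \<le> d" using \<delta> by linarith+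
  qed
  define a b where "a = det2 v (hor s2) / \<Delta>" and "b = det2 (hor s1) v / \<Delta>"
  have v: "v = a *\<^sub>R hor s1 + b *\<^sub>R hor s2" unfolding a_def b_def by (rule det2_basis_expansion[OF independent])
  \<comment> \<open>A vector parallel to \<open>s2\<close> has no finite slope; it is tilted slightly.\<close>
  define a' where "a' = (if a = 0 then \<delta> else a)"
  have a': "a' \<noteq> 0" "\<bar>a - a'\<bar> \<le> \<delta>" using \<delta>(1) by (auto simp: a'_def)
  obtain K where K: "2 * \<bar>a'\<bar> / \<eta> < 2 ^ K" using real_arch_pow[of 2 "2 * \<bar>a'\<bar> / \<eta>"] by auto
  obtain k where k: "k \<ge> K" "\<bar>real_of_int (\<beta> k) / real_of_int (\<alpha> k) - b / a'\<bar> < \<delta> / \<bar>a'\<bar>"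
    using slope_dense[of "\<delta> / \<bar>a'\<bar>" K "b / a'"] \<delta>(1) a'(1) by auto
  define \<tau> where "\<tau> = a' / \<alpha> k"
  define w where "w = \<tau> *\<^sub>R dir k"
  have \<alpha>0: "real_of_int (\<alpha> k) \<ge> 1" using \<alpha>_pos[of k] by linarith
  have w: "w = a' *\<^sub>R hor s1 + (a' * (\<beta> k / \<alpha> k)) *\<^sub>R hor s2"
    using \<alpha>0 by (simp add: w_def \<tau>_def dir_def scaleR_add_right)
  have "\<bar>b - a' * (\<beta> k / \<alpha> k)\<bar> \<le> \<delta>"
  proof -
    have "b - a' * (\<beta> k / \<alpha> k) = - (a' * (\<beta> k / \<alpha> k - b / a'))" using a'(1) by (simp add: field_simps)
    then have "\<bar>b - a' * (\<beta> k / \<alpha> k)\<bar> = \<bar>a'\<bar> * \<bar>\<beta> k / \<alpha> k - b / a'\<bar>" by (simp add: abs_mult)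
    also have "\<dots> \<le> \<bar>a'\<bar> * (\<delta> / \<bar>a'\<bar>)" using k(2) by (intro mult_left_mono) auto
    finally show ?thesis using a'(1) by simp
  qed
  moreover have "v - w = (a - a') *\<^sub>R hor s1 + (b - a' * (\<beta> k / \<alpha> k)) *\<^sub>R hor s2"
    unfolding w by (subst v) (simp add: scaleR_left_diff_distrib)
  ultimately have "N (v - w) \<le> \<delta> * N (hor s1) + \<delta> * N (hor s2)"
    using a'(2) by (auto intro!: order_trans[OF N_triangle] add_mono mult_right_mono)
  also have "\<dots> \<le> \<delta> * B" using \<delta>(1) by (simp add: B_def distrib_left)
  finally have vw: "N (v - w) \<le> \<delta> * B" .
  have "\<bar>\<tau>\<bar> * (N (dir k) + 1 / 2 ^ k) \<le> N v + \<eta>"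
  proof -
    have "\<bar>\<tau>\<bar> * N (dir k) = N w" by (simp add: w_def)
    also have "\<dots> \<le> N v + \<eta> / 2" using N_triangle_sub[of v "v - w"] vw \<delta>B(2) by simp
    finally have 1: "\<bar>\<tau>\<bar> * N (dir k) \<le> N v + \<eta> / 2" .
    have "\<bar>\<tau>\<bar> \<le> \<bar>a'\<bar>" using \<alpha>0 by (simp add: \<tau>_def abs_divide divide_le_eq mult_le_cancel_left1)
    moreover have "(2::real) ^ K \<le> 2 ^ k" using k(1) by simp
    then have "2 * \<bar>a'\<bar> / \<eta> \<le> 2 ^ k" using K by linarith
    then have "\<bar>a'\<bar> / 2 ^ k \<le> \<eta> / 2" using e by (simp add: field_simps)
    ultimately have "\<bar>\<tau>\<bar> / 2 ^ k \<le> \<eta> / 2" by (meson divide_right_mono order_trans zero_le_numeral zero_le_power)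
    moreover have "\<bar>\<tau>\<bar> * (N (dir k) + 1 / 2 ^ k) = \<bar>\<tau>\<bar> * N (dir k) + \<bar>\<tau>\<bar> / 2 ^ k" by (simp add: distrib_left)
    ultimately show ?thesis using 1 by linarith
  qed
  moreover have "rho (- Heis w 0 + Heis v 0) \<le> \<eta>"
  proof (rule d(2))
    show "N (hor (- Heis w 0 + Heis v 0)) \<le> d" using vw \<delta>B(1) by simp
    have "\<bar>det2 (v - w) v\<bar> \<le> det2_const * (\<delta> * B * N v)"
      using vw det2_const_pos by (intro order_trans[OF det2_le] mult_left_mono mult_right_mono) auto
    then show "\<bar>ver (- Heis w 0 + Heis v 0)\<bar> \<le> d" using \<delta>B(3) d(1) by simp
  qed
  ultimately show "\<exists>g' L'. reach g' L' \<and> L' \<le> N v + \<eta> \<and> rho (- g' + Heis v 0) \<le> \<eta>"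
    using reach_highway[of \<tau> k] unfolding w_def by blast
qed

lemma reach_rho: "reach g (rho g)"
proof (rule reach_closed)
  fix \<eta> :: real assume e: "\<eta> > 0"
  obtain vs where vs: "polygon vs = g" "plen vs < rho g + \<eta>" using rho_lessD[of g "rho g + \<eta>"] e by auto
  have "reach (polygon vs) (plen vs)" for vs
    by (induction vs) (auto intro: reach_0 reach_add reach_horizontal)
  then have "reach g (plen vs)" using vs(1) by blast
  then show "\<exists>g' L'. reach g' L' \<and> L' \<le> rho g + \<eta> \<and> rho (- g' + g) \<le> \<eta>"
    using vs(2) e by (intro exI[of _ g] exI[of _ "plen vs"]) auto
qed

text \<open>Uniformity over all directions comes from a finite net of the unit ball; the remaining distance to
  the target is covered at bounded speed.\<close>

lemma T_upper:
  assumes e: "\<epsilon> > 0"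
  shows "\<exists>C\<ge>0. \<forall>x\<in>Zh. \<forall>y\<in>Zh. T x y \<le> rho (- x + y) + \<epsilon> * (rho x + rho y) + C"
proof -
  obtain A where A: "A \<ge> 0" "\<forall>\<epsilon>>0. \<exists>C\<ge>0. \<forall>x\<in>Zh. \<forall>y\<in>Zh. T x y \<le> A * rho (- x + y) + \<epsilon> * (rho x + rho (- x + y)) + C"
    using T_lipschitz by blast
  define \<eta> where "\<eta> = min 1 (\<epsilon> / (2 * A + 8))"
  have \<eta>: "\<eta> > 0" "\<eta> \<le> 1" "\<eta> * (2 * A + 8) \<le> \<epsilon>"
  proof -
    show "\<eta> > 0" "\<eta> \<le> 1" using e A(1) by (auto simp: \<eta>_def)
    have "\<eta> * (2 * A + 8) \<le> \<epsilon> / (2 * A + 8) * (2 * A + 8)" using A(1) by (intro mult_right_mono) (auto simp: \<eta>_def)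
    then show "\<eta> * (2 * A + 8) \<le> \<epsilon>" using A(1) by simp
  qed
  obtain G0 where G0: "finite G0" "\<And>g. rho g \<le> 1 \<Longrightarrow> \<exists>g'\<in>G0. rho (- g' + g) \<le> \<eta>"
    using unit_ball_net[OF \<eta>(1)] by blast
  have "\<forall>g. \<exists>C\<ge>0. \<forall>x\<in>Zh. \<forall>l\<ge>1. \<exists>y\<in>Zh.
     T x y \<le> rho g * l + \<eta> * (rho x + l) + C \<and> rho (- (x + dil l g) + y) \<le> \<eta> * l + C"
    using reachD[OF reach_rho \<eta>(1)] by blast
  then obtain Cg where Cg: "\<And>g. 0 \<le> Cg g" "\<And>g x l. x \<in> Zh \<Longrightarrow> l \<ge> 1 \<Longrightarrow> \<exists>y\<in>Zh.
     T x y \<le> rho g * l + \<eta> * (rho x + l) + Cg g \<and> rho (- (x + dil l g) + y) \<le> \<eta> * l + Cg g"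
    by metis
  define C1 where "C1 = (\<Sum>g\<in>G0. Cg g)"
  have C1: "0 \<le> C1" "\<And>g. g \<in> G0 \<Longrightarrow> Cg g \<le> C1"
    unfolding C1_def using Cg(1) G0(1) by (auto intro!: sum_nonneg member_le_sum)
  obtain C2 where C2: "C2 \<ge> 0" "\<forall>x\<in>Zh. \<forall>y\<in>Zh. T x y \<le> A * rho (- x + y) + \<eta> * (rho x + rho (- x + y)) + C2"
    using A(2) \<eta>(1) by blast
  define C where "C = \<epsilon> + C1 + A * C1 + 2 * C1 + C2"
  have "T x y \<le> rho (- x + y) + \<epsilon> * (rho x + rho y) + C" if x: "x \<in> Zh" and y: "y \<in> Zh" for x y
  proof -
    \<comment> \<open>At this scale the displacement lies in the unit ball, and \<open>l \<ge> 1\<close> as \<open>reach\<close> demands.\<close>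
    define l where "l = rho x + rho y + 1"
    have l: "l \<ge> 1" by (simp add: l_def)
    have xl: "rho x \<le> l" "rho y \<le> l" by (auto simp: l_def)
    define h where "h = dil (1 / l) (- x + y)"
    have hl: "dil l h = - x + y" using l by (simp add: h_def dil_dil)
    have rh: "l * rho h = rho (- x + y)" using rho_dil[of l h] l hl by simp
    have "rho (- x + y) \<le> l" using rho_triangle[of "- x" y] by (simp add: l_def)
    then have "l * rho h \<le> l * 1" using rh by simp
    then have "rho h \<le> 1" using l by (simp only: mult_le_cancel_left_pos)
    then obtain g where g: "g \<in> G0" "rho (- g + h) \<le> \<eta>" using G0(2) by blast
    obtain z where z: "z \<in> Zh" "T x z \<le> rho g * l + \<eta> * (rho x + l) + Cg g" "rho (- (x + dil l g) + z) \<le> \<eta> * l + Cg g"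
      using Cg(2)[OF x l, of g] by blast
    have zy: "rho (- z + y) \<le> 2 * \<eta> * l + C1"
    proof -
      have "y = x + dil l h" unfolding hl by simp
      then have "- (x + dil l g) + y = dil l (- g + h)" by (simp only: left_cancel dil_plus dil_uminus)
      then have "rho (- (x + dil l g) + y) = l * rho (- g + h)" using l by (simp add: rho_dil)
      also have "\<dots> \<le> l * \<eta>" using g(2) l by (intro mult_left_mono) auto
      finally show ?thesis
        using rho_triangle_via[of z y "x + dil l g"] rho_minus_commute[of z "x + dil l g"] z(3) C1(2)[OF g(1)]
        by (simp add: algebra_simps)
    qed
    have rz: "rho z \<le> 3 * l + C1"
    proof -
      have "rho z \<le> rho y + rho (- z + y)"
        using rho_triangle[of y "- y + z"] rho_minus_commute[of z y] by simp
      moreover have "2 * \<eta> * l \<le> 2 * l" using \<eta>(2) l by (intro mult_right_mono) auto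
      ultimately show ?thesis using zy xl by linarith
    qed
    have "rho g \<le> rho h + \<eta>"
      using rho_triangle[of h "- h + g"] rho_minus_commute[of g h] g(2) by simp
    then have "rho g * l \<le> (rho h + \<eta>) * l" using l by (intro mult_right_mono) auto
    also have "\<dots> = rho (- x + y) + \<eta> * l" using rh by (simp add: algebra_simps)
    finally have 1: "rho g * l \<le> rho (- x + y) + \<eta> * l" .
    have 2: "\<eta> * (rho x + l) \<le> \<eta> * (2 * l)" using xl \<eta>(1) by (intro mult_left_mono) auto
    have 3: "A * rho (- z + y) \<le> A * (2 * \<eta> * l + C1)" using zy A(1) by (intro mult_left_mono) auto
    have "rho z + rho (- z + y) \<le> 5 * l + 2 * C1"
      using rz zy \<eta>(2) mult_right_mono[of "2 * \<eta>" 2 l] l by linarith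
    then have "\<eta> * (rho z + rho (- z + y)) \<le> \<eta> * (5 * l + 2 * C1)" using \<eta>(1) by (intro mult_left_mono) auto
    also have "\<dots> \<le> 5 * \<eta> * l + 2 * C1" using mult_right_mono[of \<eta> 1 "2 * C1"] \<eta>(2) C1(1) by (simp add: distrib_left)
    finally have 4: "\<eta> * (rho z + rho (- z + y)) \<le> 5 * \<eta> * l + 2 * C1" .
    have "T x y \<le> T x z + T z y" using x z(1) y by (rule T_triangle)
    also have "T z y \<le> A * rho (- z + y) + \<eta> * (rho z + rho (- z + y)) + C2" using C2(2) z(1) y by blast
    finally have "T x y \<le> rho (- x + y) + \<eta> * (2 * A + 8) * l + (C1 + A * C1 + 2 * C1 + C2)"
      using z(2) 1 2 3 4 C1(2)[OF g(1)] by (simp add: algebra_simps)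
    also have "\<eta> * (2 * A + 8) * l \<le> \<epsilon> * l" using \<eta>(3) l by (intro mult_right_mono) auto
    finally show ?thesis by (simp add: C_def l_def algebra_simps)
  qed
  moreover have "C \<ge> 0" using e A C1 C2 by (simp add: C_def)
  ultimately show ?thesis by blast
qed

text \<open>The lower bound combines \<open>T_lower\<close> with the sublinearity of the displacement of \<open>collapse\<close>.\<close>

theorem T_approximates_rho:
  assumes e: "\<epsilon> > 0"
  shows "\<exists>C\<ge>0. \<forall>x\<in>Zh. \<forall>y\<in>Zh. \<bar>T x y - rho (- x + y)\<bar> \<le> \<epsilon> * (rho x + rho y) + C"
proof -
  obtain C where C: "C \<ge> 0" "\<forall>x\<in>Zh. \<forall>y\<in>Zh. T x y \<le> rho (- x + y) + \<epsilon> * (rho x + rho y) + C"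
    using T_upper[OF e] by blast
  obtain D where D: "D \<ge> 0" "\<forall>x\<in>Zh. rho (- x + collapse c x) \<le> \<epsilon> * rho x + D" using collapse_sublinear[OF e] by blast
  have "rho (- x + y) \<le> T x y + \<epsilon> * (rho x + rho y) + 2 * D" if x: "x \<in> Zh" and y: "y \<in> Zh" for x y
  proof -
    have "rho (- x + y) \<le> rho (- collapse c x + x) + rho (- collapse c x + collapse c y) + rho (- collapse c y + y)"
      by (rule rho_between_le)
    then show ?thesis
      using T_lower[OF x y] D(2)[rule_format, OF x] D(2)[rule_format, OF y]
        rho_minus_commute[of "collapse c x" x] rho_minus_commute[of "collapse c y" y]
      unfolding distrib_left by linarith
  qed
  then have "\<bar>T x y - rho (- x + y)\<bar> \<le> \<epsilon> * (rho x + rho y) + (C + 2 * D)" if "x \<in> Zh" "y \<in> Zh" for x y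
    using C(2) that C(1) D(1) by (force simp: abs_le_iff)
  then show ?thesis using C(1) D(1) by (intro exI[of _ "C + 2 * D"]) auto
qed

end

section \<open>Pointed Gromov-Hausdorff convergence\<close>

definition pseudometric_on :: "'a set \<Rightarrow> ('a \<Rightarrow> 'a \<Rightarrow> real) \<Rightarrow> bool" where
  "pseudometric_on X d \<longleftrightarrow> (\<forall>x\<in>X. d x x = 0) \<and> (\<forall>x\<in>X. \<forall>y\<in>X. 0 \<le> d x y \<and> d x y = d y x) \<and>
     (\<forall>x\<in>X. \<forall>y\<in>X. \<forall>z\<in>X. d x z \<le> d x y + d y z)"

lemma pseudometric_on_0_cong:
  assumes "pseudometric_on X d" "x \<in> X" "x' \<in> X" "y \<in> X" "y' \<in> X" "d x x' = 0" "d y y' = 0"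
  shows "d x y = d x' y'"
proof -
  have tri: "\<And>x y z. x \<in> X \<Longrightarrow> y \<in> X \<Longrightarrow> z \<in> X \<Longrightarrow> d x z \<le> d x y + d y z"
    and sym: "\<And>x y. x \<in> X \<Longrightarrow> y \<in> X \<Longrightarrow> d x y = d y x"
    using assms(1) unfolding pseudometric_on_def by blast+
  have "d x y \<le> d x x' + (d x' y' + d y' y)" using tri[of x x' y] tri[of x' y' y] assms by linarith
  moreover have "d x' y' \<le> d x' x + (d x y + d y y')" using tri[of x' x y'] tri[of x y y'] assms by linarith
  ultimately show ?thesis using sym[of x x'] sym[of y y'] assms by linarith
qed

text \<open>The distance does not depend on the representatives, in particular not on the chosen ones.\<close>

lemma quotient_dist_classes:
  assumes pm: "pseudometric_on X d"
    and A: "A \<in> X // zero_dist_rel X d" "x \<in> A" and B: "B \<in> X // zero_dist_rel X d" "y \<in> B"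
  shows "quotient_dist d A B = d x y"
proof -
  have rep: "u \<in> X \<and> (SOME x. x \<in> C) \<in> X \<and> d (SOME x. x \<in> C) u = 0"
    if C: "C \<in> X // zero_dist_rel X d" "u \<in> C" for C u
  proof -
    obtain z where z: "z \<in> X" "C = zero_dist_rel X d `` {z}" using C(1) by (auto simp: quotient_def)
    have s: "(SOME x. x \<in> C) \<in> C" using C(2) by (rule someI)
    have zz: "\<And>x. x \<in> C \<Longrightarrow> x \<in> X \<and> d z x = 0" using z by (auto simp: zero_dist_rel_def)
    have "d (SOME x. x \<in> C) u = d z u"
      using pseudometric_on_0_cong[OF pm, of "SOME x. x \<in> C" z u u] pm zz[OF s] zz[OF C(2)] z(1)
      unfolding pseudometric_on_def by metis
    then show ?thesis using zz[OF s] zz[OF C(2)] by simp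
  qed
  show ?thesis
    unfolding quotient_dist_def using pm rep[OF A] rep[OF B] by (intro pseudometric_on_0_cong[of X d]) auto
qed

text \<open>For pseudometrics it is enough to give the approximating maps between the spaces themselves: a choice
  of representatives that respects the base point turns them into maps between the quotients.\<close>

lemma pointed_GH_tendsto_pseudoI:
  assumes X: "\<And>n. n \<ge> 1 \<Longrightarrow> pseudometric_on (X n) (d n)" "\<And>n. p n \<in> X n"
    and Y: "pseudometric_on Y e" "q \<in> Y"
    and approx: "\<And>r \<epsilon>. r > 0 \<Longrightarrow> \<epsilon> > 0 \<Longrightarrow> \<forall>\<^sub>F n in sequentially. \<exists>f. (\<forall>x\<in>X n. f x \<in> Y) \<and> f (p n) = q \<and>
        (\<forall>x\<in>X n. \<forall>y\<in>X n. d n (p n) x < r \<longrightarrow> d n (p n) y < r \<longrightarrow> \<bar>e (f x) (f y) - d n x y\<bar> < \<epsilon>) \<and>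
        (\<forall>y\<in>Y. e q y < r - \<epsilon> \<longrightarrow> (\<exists>x\<in>X n. d n (p n) x < r \<and> e (f x) y < \<epsilon>))"
  shows "pointed_GH_tendsto_pseudo X d p Y e q"
  unfolding pointed_GH_tendsto_pseudo_def pointed_GH_tendsto_def
proof (intro allI impI)
  fix r \<epsilon> :: real assume r: "r > 0" and \<epsilon>: "\<epsilon> > 0"
  have "\<forall>\<^sub>F n in sequentially. n \<ge> 1" by (rule eventually_ge_at_top)
  with approx[OF r half_gt_zero[OF \<epsilon>]]
  show "\<forall>\<^sub>F n in sequentially.
      let B = {x \<in> X n // zero_dist_rel (X n) (d n). quotient_dist (d n) (zero_dist_rel (X n) (d n) `` {p n}) x < r} in
      \<exists>f\<in>B \<rightarrow> Y // zero_dist_rel Y e.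
        f (zero_dist_rel (X n) (d n) `` {p n}) = zero_dist_rel Y e `` {q} \<and>
        (\<forall>x\<in>B. \<forall>y\<in>B. \<bar>quotient_dist e (f x) (f y) - quotient_dist (d n) x y\<bar> < \<epsilon>) \<and>
        {y \<in> Y // zero_dist_rel Y e. quotient_dist e (zero_dist_rel Y e `` {q}) y < r - \<epsilon>}
          \<subseteq> {y \<in> Y // zero_dist_rel Y e. \<exists>x\<in>B. quotient_dist e (f x) y < \<epsilon>}"
  proof eventually_elim
    case (elim n)
    obtain f where f0: "(\<forall>x\<in>X n. f x \<in> Y) \<and> f (p n) = q \<and>
        (\<forall>x\<in>X n. \<forall>y\<in>X n. d n (p n) x < r \<longrightarrow> d n (p n) y < r \<longrightarrow> \<bar>e (f x) (f y) - d n x y\<bar> < \<epsilon> / 2) \<and>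
        (\<forall>y\<in>Y. e q y < r - \<epsilon> / 2 \<longrightarrow> (\<exists>x\<in>X n. d n (p n) x < r \<and> e (f x) y < \<epsilon> / 2))"
      using elim(1) by (rule exE)
    then have f: "\<And>x. x \<in> X n \<Longrightarrow> f x \<in> Y" "f (p n) = q"
      "\<And>x y. x \<in> X n \<Longrightarrow> y \<in> X n \<Longrightarrow> d n (p n) x < r \<Longrightarrow> d n (p n) y < r \<Longrightarrow> \<bar>e (f x) (f y) - d n x y\<bar> < \<epsilon> / 2"
      "\<And>y. y \<in> Y \<Longrightarrow> e q y < r - \<epsilon> / 2 \<Longrightarrow> \<exists>x\<in>X n. d n (p n) x < r \<and> e (f x) y < \<epsilon> / 2"
      by blast+
    have pmX: "pseudometric_on (X n) (d n)" using X(1) elim(2) by simp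
    have pX: "p n \<in> X n" by (rule X)
    define cX where "cX x = zero_dist_rel (X n) (d n) `` {x}" for x
    define cY where "cY y = zero_dist_rel Y e `` {y}" for y
    define QX where "QX = X n // zero_dist_rel (X n) (d n)"
    define QY where "QY = Y // zero_dist_rel Y e"
    have cX: "x \<in> X n \<Longrightarrow> cX x \<in> QX" "x \<in> X n \<Longrightarrow> x \<in> cX x" for x
      using pmX by (auto simp: cX_def QX_def quotient_def zero_dist_rel_def pseudometric_on_def)
    have cY: "y \<in> Y \<Longrightarrow> cY y \<in> QY" "y \<in> Y \<Longrightarrow> y \<in> cY y" for y
      using Y(1) by (auto simp: cY_def QY_def quotient_def zero_dist_rel_def pseudometric_on_def)
    \<comment> \<open>The base point represents its own class, as the maps must preserve base points.\<close>
    define a where "a A = (if A = cX (p n) then p n else (SOME x. x \<in> A))" for A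
    have QXE: "\<exists>x\<in>X n. A = cX x" if "A \<in> QX" for A using that by (auto simp: QX_def quotient_def cX_def)
    have QYE: "\<exists>y\<in>Y. B = cY y" if "B \<in> QY" for B using that by (auto simp: QY_def quotient_def cY_def)
    have aA: "a A \<in> A \<and> a A \<in> X n" if A: "A \<in> QX" for A
    proof -
      obtain x where x: "x \<in> X n" "A = cX x" using QXE[OF A] by blast
      have "x \<in> A" using x cX by simp
      then have "(SOME x. x \<in> A) \<in> A" by (rule someI)
      moreover have "p n \<in> cX (p n)" using cX pX by blast
      ultimately have "a A \<in> A" by (simp add: a_def)
      moreover have "A \<subseteq> X n" unfolding x(2) cX_def by (auto simp: zero_dist_rel_def)
      ultimately show ?thesis by blast
    qed
    have qdX: "quotient_dist (d n) A B = d n x y" if "A \<in> QX" "B \<in> QX" "x \<in> A" "y \<in> B" for A B x y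
      using quotient_dist_classes[OF pmX] that unfolding QX_def by blast
    have qdY: "quotient_dist e (cY u) (cY v) = e u v" if "u \<in> Y" "v \<in> Y" for u v
      using quotient_dist_classes[OF Y(1)] cY[OF that(1)] cY[OF that(2)] unfolding QY_def by blast
    define B where "B = {x \<in> QX. quotient_dist (d n) (cX (p n)) x < r}"
    define h where "h A = cY (f (a A))" for A
    have BD: "A \<in> QX" "d n (p n) (a A) < r" if "A \<in> B" for A
      using that qdX[of "cX (p n)" A "p n" "a A"] cX pX aA by (auto simp: B_def)
    have "h \<in> B \<rightarrow> QY" using BD(1) aA f(1) cY(1) by (auto simp: h_def)
    moreover have "h (cX (p n)) = cY q" by (simp add: h_def a_def f(2))
    moreover have "\<bar>quotient_dist e (h A) (h A') - quotient_dist (d n) A A'\<bar> < \<epsilon>" if A: "A \<in> B" "A' \<in> B" for A A'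
    proof -
      have "quotient_dist e (h A) (h A') = e (f (a A)) (f (a A'))"
        unfolding h_def using BD(1) A aA f(1) by (intro qdY) auto
      moreover have "quotient_dist (d n) A A' = d n (a A) (a A')" using BD(1) A aA by (intro qdX) auto
      moreover have "\<bar>e (f (a A)) (f (a A')) - d n (a A) (a A')\<bar> < \<epsilon> / 2"
        using BD A aA by (intro f(3)) auto
      ultimately show ?thesis using \<epsilon> by linarith
    qed
    moreover have "\<exists>A\<in>B. quotient_dist e (h A) C < \<epsilon>" if C: "C \<in> QY" "quotient_dist e (cY q) C < r - \<epsilon>" for C
    proof -
      obtain y where y: "y \<in> Y" "C = cY y" using QYE[OF C(1)] by blast
      then have "e q y < r - \<epsilon> / 2" using C(2) qdY[OF Y(2), of y] \<epsilon> by simp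
      then obtain x where x: "x \<in> X n" "d n (p n) x < r" "e (f x) y < \<epsilon> / 2" using f(4) y(1) by blast
      define A where "A = cX x"
      have A: "A \<in> QX" "x \<in> A" using x cX by (auto simp: A_def)
      have AB: "A \<in> B" using A x(2) qdX[of "cX (p n)" A "p n" x] cX pX by (auto simp: B_def)
      have "d n (a A) x = quotient_dist (d n) A A" using qdX[OF A(1) A(1) _ A(2)] aA[OF A(1)] by metis
      also have "\<dots> = d n x x" by (rule qdX[OF A(1) A(1) A(2) A(2)])
      also have "\<dots> = 0" using pmX x(1) by (simp add: pseudometric_on_def)
      finally have "\<bar>e (f (a A)) (f x)\<bar> < \<epsilon> / 2"
        using f(3)[of "a A" x] aA[OF A(1)] BD(2)[OF AB] x by simp
      moreover have "e (f (a A)) y \<le> e (f (a A)) (f x) + e (f x) y"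
        using Y(1) f(1) aA[OF A(1)] x(1) y(1) unfolding pseudometric_on_def by blast
      moreover have "quotient_dist e (h A) C = e (f (a A)) y"
        unfolding h_def y(2) using f(1) aA[OF A(1)] y(1) by (intro qdY) auto
      ultimately have "quotient_dist e (h A) C < \<epsilon>" using x(3) by linarith
      then show ?thesis using AB by blast
    qed
    ultimately show ?case
      unfolding Let_def QX_def[symmetric] QY_def[symmetric] cX_def[symmetric] cY_def[symmetric] B_def[symmetric]
      by (intro bexI[of _ h]) auto
  qed
qed

text \<open>Rounding the coordinates shows that the integer points are within bounded distance of every point.\<close>

lemma (in plane_norm) Zh_dense: "\<exists>x\<in>Zh. rho (- x + g) \<le> N_basis + ver_const"
proof -
  define a b where "a = \<lfloor>fst (hor g)\<rfloor>" and "b = \<lfloor>snd (hor g)\<rfloor>"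
  define v where "v = (real_of_int a, real_of_int b)"
  define t where "t = ver g - det2 v (hor g) / 2"
  define x where "x = Heis v (of_int \<lfloor>t + of_int a * of_int b / 2\<rfloor> - of_int a * of_int b / 2)"
  have "x \<in> Zh" by (simp add: Zh_def x_def v_def)
  moreover have "rho (- x + g) \<le> N_basis + ver_const"
  proof -
    have "N (hor g - v) \<le> \<bar>fst (hor g) - a\<bar> * N (1, 0) + \<bar>snd (hor g) - b\<bar> * N (0, 1)"
      using N_le_coords[of "hor g - v"] by (simp add: v_def)
    also have "\<dots> \<le> 1 * N (1, 0) + 1 * N (0, 1)"
      unfolding a_def b_def by (intro add_mono mult_right_mono N_nonneg; linarith)
    finally have "N (hor (- x + g)) \<le> N_basis" by (simp add: x_def N_basis_def)
    moreover have "ver (- x + g) = t - (of_int \<lfloor>t + of_int a * of_int b / 2\<rfloor> - of_int a * of_int b / 2)"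
      by (simp add: x_def t_def)
    then have "\<bar>ver (- x + g)\<bar> \<le> 1" by linarith
    then have "ver_const * sqrt \<bar>ver (- x + g)\<bar> \<le> ver_const * 1"
      using ver_const_pos by (intro mult_left_mono) auto
    ultimately show ?thesis using rho_le[of "- x + g"] by linarith
  qed
  ultimately show ?thesis by blast
qed

lemma (in plane_norm) pseudometric_on_rho: "pseudometric_on A (\<lambda>x y. rho (- x + y))"
  unfolding pseudometric_on_def
  by (intro conjI ballI rho_triangle_via rho_minus_commute rho_nonneg) simp

text \<open>If the distances between integer points are asymptotic to the Carnot-Caratheodory distance, then dilating by
\<open>1 / n\<close> is an approximate isometry.\<close>

lemma (in plane_norm) rescaled_approximation:
  assumes T: "pseudometric_on Zh T"
    and near: "\<And>\<epsilon>. \<epsilon> > 0 \<Longrightarrow> \<exists>C\<ge>0. \<forall>x\<in>Zh. \<forall>y\<in>Zh. \<bar>T x y - rho (- x + y)\<bar> \<le> \<epsilon> * (rho x + rho y) + C"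
    and r: "r > 0" and \<epsilon>: "\<epsilon> > 0"
  shows "\<forall>\<^sub>F n in sequentially.
        (\<forall>x\<in>Zh. \<forall>y\<in>Zh. 1 / real n * T 0 x < r \<longrightarrow> 1 / real n * T 0 y < r \<longrightarrow>
           \<bar>rho (- dil (1 / real n) x + dil (1 / real n) y) - 1 / real n * T x y\<bar> < \<epsilon>) \<and>
        (\<forall>g. rho g < r - \<epsilon> \<longrightarrow> (\<exists>x\<in>Zh. 1 / real n * T 0 x < r \<and> rho (- dil (1 / real n) x + g) < \<epsilon>))"
proof -
  define \<delta> where "\<delta> = min 1 (\<epsilon> / 4)"
  have \<delta>: "\<delta> > 0" "\<delta> \<le> 1" "\<delta> \<le> \<epsilon> / 4" using \<epsilon> by (auto simp: \<delta>_def)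
  \<comment> \<open>The bound \<open>1 / 2\<close> gives \<open>rho x \<le> 2 T 0 x + 2 C\<close>, so the ball of radius \<open>r n\<close> for \<open>T\<close> lies in a ball for \<open>rho\<close>.\<close>
  define \<eta> where "\<eta> = min (1 / 2) (\<epsilon> / (8 * (r + 1)))"
  have \<eta>: "\<eta> > 0" "\<eta> \<le> 1 / 2" "\<eta> * (8 * (r + 1)) \<le> \<epsilon>"
  proof -
    show "\<eta> > 0" using \<epsilon> r by (simp add: \<eta>_def)
    show "\<eta> \<le> 1 / 2" unfolding \<eta>_def by (rule min.cobounded1)
    have "\<eta> * (8 * (r + 1)) \<le> \<epsilon> / (8 * (r + 1)) * (8 * (r + 1))" using r by (intro mult_right_mono) (auto simp: \<eta>_def)
    then show "\<eta> * (8 * (r + 1)) \<le> \<epsilon>" using r by simp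
  qed
  obtain C where C: "C \<ge> 0" "\<forall>x\<in>Zh. \<forall>y\<in>Zh. \<bar>T x y - rho (- x + y)\<bar> \<le> \<eta> * (rho x + rho y) + C"
    using near[OF \<eta>(1)] by blast
  define B where "B = N_basis + ver_const"
  have B: "B > 0" using N_basis_pos ver_const_pos by (simp add: B_def)
  obtain n0 :: nat where n0: "C + 2 * B < real n0 * \<delta>" using reals_Archimedean3[OF \<delta>(1)] by blast
  have main: "(\<forall>x\<in>Zh. \<forall>y\<in>Zh. 1 / real n * T 0 x < r \<longrightarrow> 1 / real n * T 0 y < r \<longrightarrow>
           \<bar>rho (- dil (1 / real n) x + dil (1 / real n) y) - 1 / real n * T x y\<bar> < \<epsilon>) \<and>
        (\<forall>g. rho g < r - \<epsilon> \<longrightarrow> (\<exists>x\<in>Zh. 1 / real n * T 0 x < r \<and> rho (- dil (1 / real n) x + g) < \<epsilon>))"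
    if n: "n \<ge> max n0 1" for n
  proof -
    define m where "m = real n"
    have m: "m \<ge> 1" using n by (simp add: m_def)
    have Cm: "C + 2 * B < m * \<delta>"
    proof -
      have "real n0 * \<delta> \<le> m * \<delta>" using n \<delta>(1) by (intro mult_right_mono) (auto simp: m_def)
      then show ?thesis using n0 by linarith
    qed
    have C0: "\<bar>T 0 x - rho x\<bar> \<le> \<eta> * rho x + C" if "x \<in> Zh" for x
      using C(2)[rule_format, OF Zh_0 that] by simp
    have ball: "rho x \<le> 2 * m * (r + 1)" if x: "x \<in> Zh" and b: "1 / m * T 0 x < r" for x
    proof -
      have 1: "T 0 x < r * m" using b m by (simp add: field_simps)
      have "\<eta> * rho x \<le> 1 / 2 * rho x" using \<eta>(2) by (intro mult_right_mono) auto
      then have 2: "rho x \<le> 2 * T 0 x + 2 * C" using C0[OF x] by linarith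
      have "m * \<delta> \<le> m * 1" using \<delta>(2) m by (intro mult_left_mono) auto
      then have "C \<le> m" using Cm B by linarith
      then have "rho x \<le> 2 * (r * m) + 2 * m" using 1 2 by linarith
      then show ?thesis by (simp add: algebra_simps)
    qed
    have first: "\<bar>rho (- dil (1 / m) x + dil (1 / m) y) - 1 / m * T x y\<bar> < \<epsilon>"
      if x: "x \<in> Zh" "1 / m * T 0 x < r" and y: "y \<in> Zh" "1 / m * T 0 y < r" for x y
    proof -
      have "rho (- dil (1 / m) x + dil (1 / m) y) = 1 / m * rho (- x + y)"
        using m rho_dil[of "1 / m" "- x + y"] by (simp add: dil_plus dil_uminus)
      then have "\<bar>rho (- dil (1 / m) x + dil (1 / m) y) - 1 / m * T x y\<bar> = 1 / m * \<bar>T x y - rho (- x + y)\<bar>"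
        using m by (simp add: right_diff_distrib[symmetric] abs_mult abs_minus_commute del: times_divide_eq_left)
      also have "\<dots> \<le> 1 / m * (\<eta> * (rho x + rho y) + C)"
        using C(2) x(1) y(1) m by (intro mult_left_mono) auto
      also have "\<dots> < 1 / m * (m * \<epsilon>)"
      proof (rule mult_strict_left_mono)
        have "\<eta> * (rho x + rho y) \<le> \<eta> * (4 * m * (r + 1))"
          using ball[OF x] ball[OF y] \<eta>(1) by (intro mult_left_mono) auto
        also have "\<dots> = m * (\<eta> * (8 * (r + 1))) / 2" by simp
        also have "\<dots> \<le> m * \<epsilon> / 2" using \<eta>(3) m by (intro divide_right_mono mult_left_mono) auto
        finally have "\<eta> * (rho x + rho y) \<le> m * \<epsilon> / 2" .
        moreover have "m * \<delta> \<le> m * (\<epsilon> / 4)" using \<delta>(3) m by (intro mult_left_mono) auto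
        moreover have "m * (\<epsilon> / 4) = (m * \<epsilon>) / 4" "0 < m * \<epsilon>" using m \<epsilon> by auto
        ultimately show "\<eta> * (rho x + rho y) + C < m * \<epsilon>" using Cm B by linarith
      qed (use m in simp)
      also have "\<dots> = \<epsilon>" using m by simp
      finally show ?thesis .
    qed
    have second: "\<exists>x\<in>Zh. 1 / m * T 0 x < r \<and> rho (- dil (1 / m) x + g) < \<epsilon>" if g: "rho g < r - \<epsilon>" for g
    proof -
      obtain x where x: "x \<in> Zh" "rho (- x + dil m g) \<le> B" using Zh_dense[of "dil m g"] unfolding B_def by blast
      have rd: "rho (dil m g) = m * rho g" using m by (intro rho_dil) auto
      have mg: "m * rho g \<le> m * (r - \<epsilon>)" using g m by (intro mult_left_mono) auto
      have xr: "rho x \<le> m * rho g + B"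
        using rho_triangle[of "dil m g" "- dil m g + x"] x(2) rho_minus_commute[of x "dil m g"] rd by simp
      have "T 0 x \<le> rho x + \<eta> * rho x + C" using C0[OF x(1)] by linarith
      also have "\<eta> * rho x \<le> \<eta> * (m * (r + 1)) + B"
      proof -
        have "m * (r - \<epsilon>) \<le> m * (r + 1)" using m \<epsilon> by (intro mult_left_mono) auto
        then have "rho x \<le> m * (r + 1) + B" using xr mg by linarith
        then have "\<eta> * rho x \<le> \<eta> * (m * (r + 1) + B)" using \<eta>(1) by (intro mult_left_mono) auto
        moreover have "\<eta> * B \<le> 1 * B" using \<eta>(2) B by (intro mult_right_mono) auto
        ultimately show ?thesis by (simp add: distrib_left)
      qed
      also have "\<eta> * (m * (r + 1)) = m * (\<eta> * (8 * (r + 1))) / 8" by simp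
      also have "\<dots> \<le> m * \<epsilon> / 8" using \<eta>(3) m by (intro divide_right_mono mult_left_mono) auto
      finally have "T 0 x \<le> m * (r - \<epsilon>) + B + (m * \<epsilon> / 8 + B) + C" using xr mg by linarith
      moreover have "m * \<delta> \<le> m * (\<epsilon> / 4)" using \<delta>(3) m by (intro mult_left_mono) auto
      moreover have "m * (\<epsilon> / 4) = (m * \<epsilon>) / 4" "0 < m * \<epsilon>" "m * (r - \<epsilon>) = m * r - m * \<epsilon>"
        using m \<epsilon> by (auto simp: algebra_simps)
      ultimately have "T 0 x < m * r" using Cm by linarith
      then have "1 / m * T 0 x < r" using m by (simp add: field_simps)
      moreover have "rho (- dil (1 / m) x + g) < \<epsilon>"
      proof -
        have "- dil (1 / m) x + g = dil (1 / m) (- x + dil m g)"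
          using m by (simp add: dil_plus dil_uminus dil_dil)
        then have "rho (- dil (1 / m) x + g) = 1 / m * rho (- x + dil m g)" using m by (simp add: rho_dil)
        also have "\<dots> \<le> 1 / m * B" using x(2) m by (intro mult_left_mono) auto
        also have "\<dots> < 1 / m * (m * \<delta>)" using Cm C(1) B m by (intro mult_strict_left_mono) auto
        also have "\<dots> = \<delta>" using m by simp
        finally show ?thesis using \<delta>(3) \<epsilon> by linarith
      qed
      ultimately show ?thesis using x(1) by blast
    qed
    show ?thesis using first second unfolding m_def by blast
  qed
  show ?thesis using main unfolding eventually_sequentially by blast
qed

section \<open>Passage times\<close>

lemma edge_path_append: "edge_path E x \<gamma> y \<Longrightarrow> edge_path E y \<gamma>' z \<Longrightarrow> edge_path E x (\<gamma> @ \<gamma>') z"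
  by (induction \<gamma> arbitrary: x) auto

lemma edge_path_rev: "edge_path E x \<gamma> y \<Longrightarrow> edge_path E y (rev \<gamma>) x"
proof (induction \<gamma> arbitrary: x)
  case (Cons f \<gamma>)
  then obtain z where z: "f \<in> E" "f = {x, z}" "edge_path E z \<gamma> y" by auto
  have "edge_path E z [f] x" using z by (auto simp: insert_commute)
  then show ?case using Cons.IH[OF z(3)] edge_path_append by fastforce
qed simp

lemma edge_path_edges: "edge_path E x \<gamma> y \<Longrightarrow> set \<gamma> \<subseteq> E"
  by (induction \<gamma> arbitrary: x) auto

locale nonneg_weights =
  fixes E :: "'g set set" and w :: "'g set \<Rightarrow> real"
  assumes w_nonneg: "f \<in> E \<Longrightarrow> 0 \<le> w f"
begin

lemma path_weight_nonneg: "edge_path E x \<gamma> y \<Longrightarrow> 0 \<le> sum_list (map w \<gamma>)"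
  using edge_path_edges[of E x \<gamma> y] w_nonneg by (intro sum_list_nonneg) auto

lemma passage_time_le: "edge_path E x \<gamma> y \<Longrightarrow> passage_time E w x y \<le> sum_list (map w \<gamma>)"
  unfolding passage_time_def
  by (rule cInf_lower) (auto intro!: bdd_belowI[of _ 0] path_weight_nonneg)

lemma passage_time_greatest:
  assumes "edge_path E x \<gamma>0 y" "\<And>\<gamma>. edge_path E x \<gamma> y \<Longrightarrow> L \<le> sum_list (map w \<gamma>)"
  shows "L \<le> passage_time E w x y"
  unfolding passage_time_def using assms by (intro cInf_greatest) auto

lemma passage_time_approx:
  assumes "edge_path E x \<gamma>0 y" "e > 0"
  shows "\<exists>\<gamma>. edge_path E x \<gamma> y \<and> sum_list (map w \<gamma>) < passage_time E w x y + e"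
proof (rule ccontr)
  assume "\<not> ?thesis"
  then have "passage_time E w x y + e \<le> passage_time E w x y"
    by (intro passage_time_greatest[OF assms(1)]) force
  then show False using assms(2) by simp
qed

lemma passage_time_triangle:
  assumes "edge_path E x \<gamma>1 y" "edge_path E y \<gamma>2 z"
  shows "passage_time E w x z \<le> passage_time E w x y + passage_time E w y z"
proof (rule field_le_epsilon)
  fix e :: real assume e: "e > 0"
  obtain \<gamma> where \<gamma>: "edge_path E x \<gamma> y" "sum_list (map w \<gamma>) < passage_time E w x y + e / 2"
    using passage_time_approx[OF assms(1) half_gt_zero[OF e]] by blast
  obtain \<gamma>' where \<gamma>': "edge_path E y \<gamma>' z" "sum_list (map w \<gamma>') < passage_time E w y z + e / 2"
    using passage_time_approx[OF assms(2) half_gt_zero[OF e]] by blast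
  show "passage_time E w x z \<le> passage_time E w x y + passage_time E w y z + e"
    using passage_time_le[OF edge_path_append[OF \<gamma>(1) \<gamma>'(1)]] \<gamma>(2) \<gamma>'(2) by simp
qed

lemma passage_time_refl: "passage_time E w x x = 0"
proof (rule antisym)
  show "passage_time E w x x \<le> 0" using passage_time_le[of x "[]" x] by simp
  show "0 \<le> passage_time E w x x" by (rule passage_time_greatest[of x "[]"]) (auto intro: path_weight_nonneg)
qed

end

lemma passage_time_sym: "passage_time E w x y = passage_time E w y x"
proof -
  have "{sum_list (map w \<gamma>) | \<gamma>. edge_path E x \<gamma> y} \<subseteq> {sum_list (map w \<gamma>) | \<gamma>. edge_path E y \<gamma> x}" for x y
  proof
    fix s assume "s \<in> {sum_list (map w \<gamma>) | \<gamma>. edge_path E x \<gamma> y}"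
    then obtain \<gamma> where "s = sum_list (map w \<gamma>)" "edge_path E x \<gamma> y" by blast
    then show "s \<in> {sum_list (map w \<gamma>) | \<gamma>. edge_path E y \<gamma> x}"
      using edge_path_rev[of E x \<gamma> y] by (auto simp: rev_map[symmetric] sum_list_rev intro!: exI[of _ "rev \<gamma>"])
  qed
  then have "{sum_list (map w \<gamma>) | \<gamma>. edge_path E x \<gamma> y} = {sum_list (map w \<gamma>) | \<gamma>. edge_path E y \<gamma> x}" by blast
  then show ?thesis by (simp add: passage_time_def)
qed

section \<open>The random weights\<close>

text \<open>The edges are sets of matrices; \<open>E_mem\<close> translates adjacency to exponential coordinates.\<close>

locale cayley_graph = highways +
  fixes E :: "(real^3^3) set set"
  assumes E_mem: "x \<in> Zh \<Longrightarrow> y \<in> Zh \<Longrightarrow> {mat_of x, mat_of y} \<in> E \<longleftrightarrow> - x + y \<in> G"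
    and E_vertices: "f \<in> E \<Longrightarrow> \<exists>x\<in>Zh. \<exists>y\<in>Zh. f = {mat_of x, mat_of y}"
begin

text \<open>The orientation of the edge is immaterial by symmetry of \<open>rho\<close>; see \<open>weight_eq\<close>.\<close>

definition weight :: "(nat \<Rightarrow> int) \<Rightarrow> (real^3^3) set \<Rightarrow> real" where
  "weight c f = (THE r. \<exists>x y. f = {mat_of x, mat_of y} \<and> r = rho (- collapse c x + collapse c y))"

lemma weight_eq: "weight c {mat_of x, mat_of y} = rho (- collapse c x + collapse c y)"
  unfolding weight_def
  by (rule the_equality) (auto simp: doubleton_eq_iff rho_minus_commute)

sublocale W: nonneg_weights E "weight c" for c
  by standard (use E_vertices weight_eq in force)

definition T :: "(nat \<Rightarrow> int) \<Rightarrow> heis \<Rightarrow> heis \<Rightarrow> real" where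
  "T c x y = passage_time E (weight c) (mat_of x) (mat_of y)"

lemma edge_path_step: "x \<in> Zh \<Longrightarrow> s \<in> G \<Longrightarrow> edge_path E (mat_of x) [{mat_of x, mat_of (x + s)}] (mat_of (x + s))"
  using E_mem[of x "x + s"] G_Zh by auto

lemma connected:
  assumes x: "x \<in> Zh" and y: "y \<in> Zh"
  shows "\<exists>\<gamma>. edge_path E (mat_of x) \<gamma> (mat_of y)"
proof -
  obtain xs where xs: "set xs \<subseteq> G" "sum_list xs = - x + y" using generating[of "- x + y"] x y by auto
  have "\<exists>\<gamma>. edge_path E (mat_of x) \<gamma> (mat_of (x + sum_list xs))" using xs(1) x
  proof (induction xs arbitrary: x)
    case Nil
    then show ?case by (auto intro: exI[of _ "[]"])
  next
    case (Cons s xs)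
    have s: "s \<in> G" "x + s \<in> Zh" using Cons.prems G_Zh by auto
    obtain \<gamma> where "edge_path E (mat_of (x + s)) \<gamma> (mat_of (x + s + sum_list xs))"
      using Cons.IH[of "x + s"] Cons.prems s by auto
    then have "edge_path E (mat_of x) ([{mat_of x, mat_of (x + s)}] @ \<gamma>) (mat_of (x + s + sum_list xs))"
      using edge_path_append[OF edge_path_step[OF Cons.prems(2) s(1)]] by blast
    then have "edge_path E (mat_of x) ([{mat_of x, mat_of (x + s)}] @ \<gamma>) (mat_of (x + sum_list (s # xs)))"
      by (simp only: add.assoc sum_list.Cons)
    then show ?case by (rule exI)
  qed
  then show ?thesis using xs(2) by simp
qed

lemma weight_path_ge:
  assumes "edge_path E (mat_of x) \<gamma> (mat_of y)" "x \<in> Zh"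
  shows "rho (- collapse c x + collapse c y) \<le> sum_list (map (weight c) \<gamma>)"
  using assms
proof (induction \<gamma> arbitrary: x)
  case (Cons f \<gamma>)
  then obtain z where z: "f \<in> E" "f = {mat_of x, z}" "edge_path E z \<gamma> (mat_of y)" by auto
  obtain a b where ab: "a \<in> Zh" "b \<in> Zh" "f = {mat_of a, mat_of b}" using E_vertices[OF z(1)] by blast
  then obtain u where u: "u \<in> Zh" "z = mat_of u" using z(2) by (auto simp: doubleton_eq_iff)
  have "rho (- collapse c u + collapse c y) \<le> sum_list (map (weight c) \<gamma>)"
    using Cons.IH[of u] z(3) u by simp
  moreover have "weight c f = rho (- collapse c x + collapse c u)" using z(2) u(2) weight_eq by simp
  ultimately show ?case using rho_triangle_via[of "collapse c x" "collapse c y" "collapse c u"] by simp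
qed simp

lemma traveller:
  assumes "good c" shows "traveller N G s1 s2 c (T c)"
proof
  show "good c" by fact
  show "T c x x = 0" for x unfolding T_def by (rule W.passage_time_refl)
  show "T c x y = T c y x" for x y unfolding T_def by (rule passage_time_sym)
  show "T c x z \<le> T c x y + T c y z" if "x \<in> Zh" "y \<in> Zh" "z \<in> Zh" for x y z
    unfolding T_def using connected[OF that(1,2)] connected[OF that(2,3)] W.passage_time_triangle by blast
  show "T c x (x + s) \<le> rho (- collapse c x + collapse c (x + s))" if "x \<in> Zh" "s \<in> G" for x s
    using W.passage_time_le[OF edge_path_step[OF that], of c] by (simp add: T_def weight_eq)
  show "rho (- collapse c x + collapse c y) \<le> T c x y" if "x \<in> Zh" "y \<in> Zh" for x y
    unfolding T_def using connected[OF that] W.passage_time_greatest weight_path_ge[OF _ that(1)] by metis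
qed

section \<open>Random positions of the walls\<close>

definition offsets :: "nat \<Rightarrow> int pmf" where "offsets j = pmf_of_set {0..<gap j}"

definition \<Omega> :: "(nat \<Rightarrow> int) measure" where "\<Omega> = Pi\<^sub>M UNIV (\<lambda>j. measure_pmf (offsets j))"

sublocale P: product_prob_space "\<lambda>j. measure_pmf (offsets j)" UNIV
  by (rule product_prob_spaceI) (rule measure_pmf.prob_space_axioms)

lemma space_\<Omega> [simp]: "space \<Omega> = UNIV"
  by (auto simp: \<Omega>_def space_PiM)

lemma prob_space_\<Omega>: "prob_space \<Omega>"
  unfolding \<Omega>_def by (rule P.P.prob_space_axioms)

lemma gap_set: "{0..<gap j} \<noteq> {}" "finite {0..<gap j}"
  using gap_props(1)[of j] by auto

lemma component_measurable: "(\<lambda>c. c j) \<in> measurable \<Omega> (count_space UNIV)"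
proof -
  have "(\<lambda>c. c j) \<in> measurable \<Omega> (measure_pmf (offsets j))"
    unfolding \<Omega>_def by (rule measurable_component_singleton) simp
  then show ?thesis by (simp cong: measurable_cong_sets)
qed

definition wall_offset :: "nat \<Rightarrow> heis \<Rightarrow> int \<Rightarrow> bool" where
  "wall_offset j x a \<longleftrightarrow> (\<exists>i<len j. gap j dvd F j x - a - F j (stair j i))"

lemma wall_offset: "wall c j x \<longleftrightarrow> wall_offset j x (c j)"
  by (simp add: wall_def at_wall_def wall_offset_def)

text \<open>Near the origin \<open>F j\<close> takes few values, so few offsets put a wall there, and \<open>gap j\<close> exceeds their number by the
factor \<open>2 ^ j\<close>.\<close>

lemma prob_near_wall:
  "measure \<Omega> {c. \<exists>x\<in>Zh. rho x < 2 ^ j * toll j \<and> wall c j x} \<le> (1 / 2) ^ j"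
proof -
  define B where "B = {a. \<exists>x\<in>Zh. rho x < 2 ^ j * toll j \<and> wall_offset j x a}"
  define m where "m = \<lfloor>F_bound j * (2 ^ j * toll j)\<rfloor>"
  have t: "0 \<le> F_bound j * (2 ^ j * toll j)"
    using F_bound_nonneg[of j] toll_ge(1)[of j] by (intro mult_nonneg_nonneg) auto
  have m0: "m \<ge> 0" using t by (simp add: m_def)
  have "measure \<Omega> {c. \<exists>x\<in>Zh. rho x < 2 ^ j * toll j \<and> wall c j x} = measure (offsets j) B"
  proof -
    have "emeasure \<Omega> {c \<in> space \<Omega>. c j \<in> B} = emeasure (measure_pmf (offsets j)) B"
      unfolding \<Omega>_def by (rule P.emeasure_PiM_Collect_single) auto
    moreover have "{c. \<exists>x\<in>Zh. rho x < 2 ^ j * toll j \<and> wall c j x} = {c \<in> space \<Omega>. c j \<in> B}"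
      by (auto simp: B_def wall_offset)
    ultimately show ?thesis by (simp add: measure_def)
  qed
  also have "\<dots> = card ({0..<gap j} \<inter> B) / card {0..<gap j}"
    unfolding offsets_def by (rule measure_pmf_of_set[OF gap_set])
  also have "\<dots> \<le> (card ({-m..m} \<times> {..<len j})) / card {0..<gap j}"
  proof (intro divide_right_mono of_nat_mono)
    \<comment> \<open>The offset is determined by the value \<open>n\<close> of \<open>F j\<close> at the nearby wall and the position \<open>i\<close> on it.\<close>
    define h where "h = (\<lambda>(n, i). (n - F j (stair j i)) mod gap j)"
    have "{0..<gap j} \<inter> B \<subseteq> h ` ({-m..m} \<times> {..<len j})"
    proof
      fix a assume a: "a \<in> {0..<gap j} \<inter> B"
      then obtain x i where x: "x \<in> Zh" "rho x < 2 ^ j * toll j" "i < len j" "gap j dvd F j x - a - F j (stair j i)"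
        by (auto simp: B_def wall_offset_def)
      have "\<bar>of_int (F j x)\<bar> \<le> F_bound j * rho x" by (rule F_le[OF x(1)])
      also have "\<dots> \<le> F_bound j * (2 ^ j * toll j)" using x(2) F_bound_nonneg by (intro mult_left_mono) auto
      finally have "F j x \<in> {-m..m}" unfolding m_def by (simp add: abs_le_iff le_floor_iff) linarith
      moreover have "h (F j x, i) = a"
      proof -
        have "gap j dvd (F j x - F j (stair j i)) - a" using x(4) by (simp add: algebra_simps)
        then have "(F j x - F j (stair j i)) mod gap j = a mod gap j" by (simp add: mod_eq_dvd_iff)
        then show ?thesis using a by (simp add: h_def)
      qed
      ultimately show "a \<in> h ` ({-m..m} \<times> {..<len j})" using x(3) by force
    qed
    then have "card ({0..<gap j} \<inter> B) \<le> card (h ` ({-m..m} \<times> {..<len j}))" by (intro card_mono) auto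
    also have "\<dots> \<le> card ({-m..m} \<times> {..<len j})" by (intro card_image_le) auto
    finally show "card ({0..<gap j} \<inter> B) \<le> card ({-m..m} \<times> {..<len j})" .
  qed simp
  also have "\<dots> = (2 * m + 1) * len j / gap j"
    using m0 gap_props(1)[of j] by (simp add: card_cartesian_product)
  also have "\<dots> \<le> (len j * (2 * F_bound j * (2 ^ j * toll j) + 1)) / gap j"
  proof (intro divide_right_mono)
    have "2 * real_of_int m + 1 \<le> 2 * F_bound j * (2 ^ j * toll j) + 1" unfolding m_def by linarith
    then show "(2 * m + 1) * len j \<le> len j * (2 * F_bound j * (2 ^ j * toll j) + 1)"
      by (simp add: mult.commute mult_left_mono)
  qed (use gap_props(1)[of j] in simp)
  also have "\<dots> \<le> (gap j / 2 ^ j) / gap j"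
    using gap_props(6)[of j] gap_props(1)[of j] by (intro divide_right_mono) auto
  also have "\<dots> = (1 / 2) ^ j" using gap_props(1)[of j] by (simp add: power_one_over)
  finally show ?thesis .
qed

text \<open>By the Borel-Cantelli lemma.\<close>

lemma AE_good: "AE c in \<Omega>. good c"
proof -
  define A where "A j = {c \<in> space \<Omega>. \<exists>x\<in>Zh. rho x < 2 ^ j * toll j \<and> wall c j x}" for j
  interpret prob_space \<Omega> by (rule prob_space_\<Omega>)
  have "AE c in \<Omega>. eventually (\<lambda>j. c \<in> space \<Omega> - A j) sequentially"
  proof (rule borel_cantelli_AE1)
    show "A j \<in> sets \<Omega>" for j
    proof -
      have "A j = (\<lambda>c. c j) -` {a. \<exists>x\<in>Zh. rho x < 2 ^ j * toll j \<and> wall_offset j x a} \<inter> space \<Omega>"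
        by (auto simp: A_def wall_offset)
      also have "\<dots> \<in> sets \<Omega>" by (rule measurable_sets[OF component_measurable]) simp
      finally show ?thesis .
    qed
    show "emeasure \<Omega> (A j) < \<infinity>" for j by (simp add: less_top[symmetric])
    show "summable (\<lambda>j. measure \<Omega> (A j))"
    proof (rule summable_comparison_test)
      show "\<exists>M. \<forall>j\<ge>M. norm (measure \<Omega> (A j)) \<le> (1 / 2) ^ j"
        using prob_near_wall by (simp add: A_def)
      show "summable (\<lambda>j. (1 / 2 :: real) ^ j)" by (rule summable_geometric) simp
    qed
  qed
  then show ?thesis
  proof eventually_elim
    case (elim c)
    then obtain J where J: "\<And>j. j \<ge> J \<Longrightarrow> c \<notin> A j" by (auto simp: eventually_sequentially)
    show ?case unfolding good_def
    proof (intro exI[of _ J] allI ballI impI)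
      fix j x assume *: "J \<le> j" "x \<in> Zh" "wall c j x"
      show "2 ^ j * toll j \<le> rho x"
      proof (rule ccontr)
        assume "\<not> ?thesis"
        then have "rho x < 2 ^ j * toll j" by simp
        then have "c \<in> A j" unfolding A_def using *(2,3) by simp blast
        then show False using J[OF *(1)] by blast
      qed
    qed
  qed
qed

subsection \<open>Stationarity\<close>

text \<open>The effect on the positions of the walls of a left translation by \<open>g\<close>, normalised to the
residues \<open>{0..<gap j}\<close>.\<close>

definition translate :: "heis \<Rightarrow> (nat \<Rightarrow> int) \<Rightarrow> (nat \<Rightarrow> int)" where
  "translate g c = (\<lambda>j. (c j + F j g) mod gap j)"

lemma at_wall_translate:
  assumes "g \<in> Zh" "x \<in> Zh" shows "at_wall (translate g c) j i (g + x) \<longleftrightarrow> at_wall c j i x"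
proof -
  have eq: "(F j (g + x) - translate g c j - F j (stair j i)) - (F j x - c j - F j (stair j i))
      = (c j + F j g) - (c j + F j g) mod gap j"
    using assms by (simp add: translate_def)
  have "gap j dvd (F j (g + x) - translate g c j - F j (stair j i)) - (F j x - c j - F j (stair j i))"
    unfolding eq by (rule dvd_minus_mod)
  from dvd_add_right_iff[OF this, of "F j x - c j - F j (stair j i)"] show ?thesis
    unfolding at_wall_def by (simp only: diff_add_cancel)
qed

lemma collapse_translate:
  assumes "g \<in> Zh" "x \<in> Zh" shows "collapse (translate g c) (g + x) = g + collapse c x"
proof -
  have w: "wall (translate g c) j (g + x) \<longleftrightarrow> wall c j x" for j
    by (simp add: wall_def at_wall_translate[OF assms])
  have "level (translate g c) (g + x) = level c x" by (simp add: level_def w)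
  moreover have "foot (translate g c) j (g + x) = g + foot c j x" for j
    by (simp add: foot_def at_wall_translate[OF assms] add.assoc diff_conv_add_uminus del: add_uminus_conv_diff)
  ultimately show ?thesis by (simp add: collapse_def split: nat.split)
qed

lemma translate_measurable: "translate g \<in> measurable \<Omega> \<Omega>"
proof -
  have "(\<lambda>c. \<lambda>j\<in>UNIV. (c j + F j g) mod gap j) \<in> measurable \<Omega> (Pi\<^sub>M UNIV (\<lambda>j. measure_pmf (offsets j)))"
    by (intro measurable_restrict measurable_compose[OF component_measurable]) simp
  then show ?thesis by (simp add: \<Omega>_def translate_def[abs_def] restrict_def)
qed

text \<open>A rotation permutes the residues, so it preserves the uniform distribution of each offset and the product of these.\<close>

lemma distr_translate: "distr \<Omega> \<Omega> (translate g) = \<Omega>"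
proof -
  define \<theta> where "\<theta> j a = (a + F j g) mod gap j" for j a
  have bij: "bij_betw (\<theta> j) {0..<gap j} {0..<gap j}" for j
  proof -
    have inj: "inj_on (\<theta> j) {0..<gap j}"
    proof (rule inj_onI)
      fix a b assume ab: "a \<in> {0..<gap j}" "b \<in> {0..<gap j}" "\<theta> j a = \<theta> j b"
      then have "gap j dvd (a + F j g) - (b + F j g)" unfolding \<theta>_def by (simp only: mod_eq_dvd_iff)
      then have "a mod gap j = b mod gap j" by (simp add: mod_eq_dvd_iff)
      then show "a = b" using ab by simp
    qed
    moreover have "\<theta> j ` {0..<gap j} \<subseteq> {0..<gap j}" using gap_props(1)[of j] by (auto simp: \<theta>_def)
    ultimately show ?thesis by (simp add: bij_betw_def endo_inj_surj)
  qed
  have "distr \<Omega> \<Omega> (translate g) = Pi\<^sub>M UNIV (\<lambda>j. measure_pmf (offsets j))"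
  proof (rule P.PiM_eq)
    show "sets (distr \<Omega> \<Omega> (translate g)) = sets (Pi\<^sub>M UNIV (\<lambda>j. measure_pmf (offsets j)))" by (simp add: \<Omega>_def)
    fix J :: "nat set" and X assume J: "finite J"
    define Y where "Y = prod_emb UNIV (\<lambda>j. measure_pmf (offsets j)) J (Pi\<^sub>E J X)"
    have Y: "Y \<in> sets \<Omega>" unfolding Y_def \<Omega>_def using J by (intro sets_PiM_I) auto
    have "translate g -` Y \<inter> space \<Omega> = {c \<in> space (Pi\<^sub>M UNIV (\<lambda>j. measure_pmf (offsets j))). \<forall>j\<in>J. c j \<in> \<theta> j -` X j}"
      unfolding Y_def by (subst prod_emb_PiE) (auto simp: space_PiM translate_def \<theta>_def PiE_iff split: if_splits)
    then have "emeasure (distr \<Omega> \<Omega> (translate g)) Y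
       = emeasure (Pi\<^sub>M UNIV (\<lambda>j. measure_pmf (offsets j))) {c \<in> space (Pi\<^sub>M UNIV (\<lambda>j. measure_pmf (offsets j))). \<forall>j\<in>J. c j \<in> \<theta> j -` X j}"
      using emeasure_distr[OF translate_measurable Y] by (simp add: \<Omega>_def)
    also have "\<dots> = (\<Prod>j\<in>J. emeasure (measure_pmf (offsets j)) (\<theta> j -` X j))"
      using J by (intro P.emeasure_PiM_Collect) auto
    also have "\<dots> = (\<Prod>j\<in>J. emeasure (measure_pmf (offsets j)) (X j))"
    proof (rule prod.cong[OF refl])
      fix j
      have "emeasure (measure_pmf (offsets j)) (\<theta> j -` X j) = emeasure (measure_pmf (map_pmf (\<theta> j) (offsets j))) (X j)"
        by simp
      also have "map_pmf (\<theta> j) (offsets j) = offsets j"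
        unfolding offsets_def by (rule map_pmf_of_set_bij_betw[OF bij gap_set])
      finally show "emeasure (measure_pmf (offsets j)) (\<theta> j -` X j) = emeasure (measure_pmf (offsets j)) (X j)" .
    qed
    finally show "emeasure (distr \<Omega> \<Omega> (translate g)) (prod_emb UNIV (\<lambda>j. measure_pmf (offsets j)) J (Pi\<^sub>E J X))
       = (\<Prod>j\<in>J. emeasure (measure_pmf (offsets j)) (X j))" unfolding Y_def .
  qed
  then show ?thesis by (simp add: \<Omega>_def)
qed

lemma level_measurable: "(\<lambda>c. level c x) \<in> measurable \<Omega> (count_space UNIV)"
proof -
  have [measurable]: "Measurable.pred \<Omega> (\<lambda>c. wall c j x)" for j
    unfolding wall_offset by (rule measurable_compose[OF component_measurable]) simp
  show ?thesis unfolding level_def by measurable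
qed

text \<open>The collapsed point as a function of the level and of one offset. Both take countably many values, so
\<open>collapse\<close> is measurable.\<close>

definition collapse_offset :: "heis \<Rightarrow> nat \<Rightarrow> int \<Rightarrow> heis" where
  "collapse_offset x n a = (case n of 0 \<Rightarrow> x | Suc j \<Rightarrow>
     x - stair j (LEAST i. i < len j \<and> gap j dvd F j x - a - F j (stair j i)) + shift j)"

lemma collapse_eq_offset: "collapse c x = collapse_offset x (level c x) (c (level c x - 1))"
  by (simp add: collapse_def collapse_offset_def foot_def at_wall_def split: nat.split)

lemma weight_measurable: "f \<in> E \<Longrightarrow> (\<lambda>c. weight c f) \<in> borel_measurable \<Omega>"
proof -
  assume "f \<in> E"
  then obtain x y where f: "f = {mat_of x, mat_of y}" using E_vertices by blast
  have "(\<lambda>c. rho (- collapse_offset x (level c x) (c (level c x - 1)) + collapse_offset y (level c y) (c (level c y - 1)))) \<in> borel_measurable \<Omega>"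
  proof (rule measurable_compose_countable[where g = "\<lambda>c. level c x" and
      f = "\<lambda>n c. rho (- collapse_offset x n (c (n - 1)) + collapse_offset y (level c y) (c (level c y - 1)))", OF _ level_measurable])
    fix n
    show "(\<lambda>c. rho (- collapse_offset x n (c (n - 1)) + collapse_offset y (level c y) (c (level c y - 1)))) \<in> borel_measurable \<Omega>"
    proof (rule measurable_compose_countable[where g = "\<lambda>c. c (n - 1)" and
        f = "\<lambda>a c. rho (- collapse_offset x n a + collapse_offset y (level c y) (c (level c y - 1)))", OF _ component_measurable])
      fix a
      show "(\<lambda>c. rho (- collapse_offset x n a + collapse_offset y (level c y) (c (level c y - 1)))) \<in> borel_measurable \<Omega>"
      proof (rule measurable_compose_countable[where g = "\<lambda>c. level c y" and
          f = "\<lambda>m c. rho (- collapse_offset x n a + collapse_offset y m (c (m - 1)))", OF _ level_measurable])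
        fix m
        show "(\<lambda>c. rho (- collapse_offset x n a + collapse_offset y m (c (m - 1)))) \<in> borel_measurable \<Omega>"
          by (rule measurable_compose[OF component_measurable]) simp
      qed
    qed
  qed
  then show ?thesis unfolding f weight_eq collapse_eq_offset .
qed

end

section \<open>The group of integer matrices\<close>

lemma HZ_mult [simp]: "x \<otimes>\<^bsub>HZ\<^esub> y = x ** y" and HZ_one [simp]: "\<one>\<^bsub>HZ\<^esub> = mat_of 0"
  and HR_one: "\<one>\<^bsub>HR\<^esub> = mat_of 0"
  by (auto simp: heisenberg_group_def mat_of_0)

lemma group_HZ: "group HZ"
proof (rule groupI)
  fix x assume "x \<in> carrier HZ"
  then obtain g where "g \<in> Zh" "x = mat_of g" by (auto simp: mat_of_Zh[symmetric])
  then show "\<exists>y\<in>carrier HZ. y \<otimes>\<^bsub>HZ\<^esub> x = \<one>\<^bsub>HZ\<^esub>"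
    by (auto simp: mat_of_Zh[symmetric] mat_of_plus[symmetric] intro!: bexI[of _ "- g"])
qed (auto simp: mat_of_Zh[symmetric] mat_of_plus[symmetric] add.assoc)

lemma inv_HZ:
  assumes "g \<in> Zh" shows "inv\<^bsub>HZ\<^esub> (mat_of g) = mat_of (- g)"
proof -
  have "mat_of (- g) \<otimes>\<^bsub>HZ\<^esub> mat_of g = \<one>\<^bsub>HZ\<^esub>" by (simp add: mat_of_plus[symmetric])
  then show ?thesis
    using assms by (intro group.inv_equality[OF group_HZ]) (auto simp: mat_of_Zh[symmetric])
qed

lemma generate_HZ_word:
  assumes S: "S = mat_of ` S'" "S' \<subseteq> Zh" and M: "M \<in> generate HZ S"
  shows "\<exists>xs. set xs \<subseteq> S' \<union> uminus ` S' \<and> mat_of (sum_list xs) = M"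
  using M
proof (induction rule: generate.induct)
  case one
  then show ?case by (intro exI[of _ "[]"]) simp
next
  case (incl h)
  then obtain s where "s \<in> S'" "h = mat_of s" using S by auto
  then show ?case by (intro exI[of _ "[s]"]) auto
next
  case (inv h)
  then obtain s where s: "s \<in> S'" "h = mat_of s" using S by auto
  then have "inv\<^bsub>HZ\<^esub> h = mat_of (- s)" using S inv_HZ by auto
  then show ?case using s by (intro exI[of _ "[- s]"]) auto
next
  case (eng h1 h2)
  then obtain xs ys where "set xs \<subseteq> S' \<union> uminus ` S'" "mat_of (sum_list xs) = h1"
    "set ys \<subseteq> S' \<union> uminus ` S'" "mat_of (sum_list ys) = h2" by blast
  then show ?case by (intro exI[of _ "xs @ ys"]) (auto simp: mat_of_plus)
qed

text \<open>Otherwise all of \<open>G\<close> would be perpendicular to everything that it generates, that is, to the whole plane.\<close>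

lemma generating_independent:
  assumes gen: "\<And>h. h \<in> Zh \<Longrightarrow> \<exists>xs. set xs \<subseteq> G \<and> sum_list xs = h"
  shows "\<exists>s\<in>G. \<exists>t\<in>G. det2 (hor s) (hor t) \<noteq> 0"
proof (rule ccontr)
  assume "\<not> ?thesis"
  then have no: "det2 (hor s) (hor t) = 0" if "s \<in> G" "t \<in> G" for s t using that by blast
  have Z: "Heis (1, 0) 0 \<in> Zh" "Heis (0, 1) 0 \<in> Zh" by (auto simp: Zh_def)
  have perp: "det2 (hor s) (hor h) = 0" if s: "s \<in> G" and h: "h \<in> Zh" for s h
  proof -
    obtain xs where xs: "set xs \<subseteq> G" "sum_list xs = h" using gen[OF h] by blast
    have "det2 (hor s) (hor (sum_list xs)) = 0" using xs(1) by (induction xs) (auto simp: no[OF s])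
    then show ?thesis using xs(2) by simp
  qed
  have hor0: "hor s = 0" if "s \<in> G" for s
    using perp[OF that Z(1)] perp[OF that Z(2)] by (simp add: det2_def prod_eq_iff)
  obtain xs where xs: "set xs \<subseteq> G" "sum_list xs = Heis (1, 0) 0" using gen[OF Z(1)] by blast
  have "hor (sum_list xs) = 0" using xs(1) by (induction xs) (auto simp: hor0)
  then show False using xs(2) by (simp add: zero_prod_def)
qed

lemma cayley_edges_HZ:
  assumes S: "S = mat_of ` S'" "S' \<subseteq> Zh"
  shows "cayley_edges HZ S = {{mat_of x, mat_of (x + s)} | x s. x \<in> Zh \<and> s \<in> S'}"
proof -
  have "cayley_edges HZ S = {{g, g ** s} | g s. g \<in> mat_of ` Zh \<and> s \<in> mat_of ` S'}"
    unfolding cayley_edges_def S(1) mat_of_Zh by simp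
  also have "\<dots> = {{mat_of x, mat_of (x + s)} | x s. x \<in> Zh \<and> s \<in> S'}"
    by (auto simp: mat_of_plus)
  finally show ?thesis .
qed

section \<open>Carrying the offsets to another sample space\<close>

text \<open>Infinitely many of the coordinates of a function on sets of matrices carry the offsets as
real numbers; taking integer parts recovers them.\<close>

lemma ex_sample_space:
  fixes \<Omega> :: "(nat \<Rightarrow> int) measure"
  assumes "prob_space \<Omega>" "space \<Omega> = UNIV"
  shows "\<exists>(M :: ((real^3^3) set \<Rightarrow> real) measure) \<kappa>. prob_space M \<and> \<kappa> \<in> measurable M \<Omega> \<and> distr M \<Omega> \<kappa> = \<Omega>"
proof -
  define \<upsilon> :: "nat \<Rightarrow> (real^3^3) set" where "\<upsilon> j = {mat (real j)}" for j
  have inj: "inj \<upsilon>" by (auto simp: \<upsilon>_def inj_on_def mat_def vec_eq_iff forall_3)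
  define \<iota> :: "(nat \<Rightarrow> int) \<Rightarrow> (real^3^3) set \<Rightarrow> real" where "\<iota> c = (\<lambda>A. real_of_int (c (the_inv \<upsilon> A)))" for c
  define \<kappa> :: "((real^3^3) set \<Rightarrow> real) \<Rightarrow> nat \<Rightarrow> int" where "\<kappa> \<omega> = (\<lambda>j. \<lfloor>\<omega> (\<upsilon> j)\<rfloor>)" for \<omega>
  have \<kappa>\<iota>: "\<kappa> (\<iota> c) = c" for c by (simp add: \<kappa>_def \<iota>_def the_inv_f_f[OF inj])
  define V where "V = vimage_algebra UNIV \<kappa> \<Omega>"
  have m\<iota>: "\<iota> \<in> measurable \<Omega> V"
    unfolding V_def by (rule measurable_vimage_algebra2) (auto simp: \<kappa>\<iota>)
  have m\<kappa>: "\<kappa> \<in> measurable V \<Omega>"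
    unfolding V_def by (rule measurable_vimage_algebra1) (simp add: assms)
  define M where "M = distr \<Omega> V \<iota>"
  have "distr M \<Omega> \<kappa> = distr \<Omega> \<Omega> (\<kappa> \<circ> \<iota>)" unfolding M_def by (rule distr_distr[OF m\<kappa> m\<iota>])
  also have "\<dots> = \<Omega>" using distr_id[of \<Omega>] by (simp add: o_def \<kappa>\<iota> id_def)
  finally have "distr M \<Omega> \<kappa> = \<Omega>" .
  moreover have "prob_space M" unfolding M_def by (rule prob_space.prob_space_distr[OF assms(1) m\<iota>])
  moreover have "\<kappa> \<in> measurable M \<Omega>" using m\<kappa> by (simp add: M_def)
  ultimately show ?thesis by blast
qed

lemma ball_image: "(\<forall>y\<in>f ` A. P y) \<longleftrightarrow> (\<forall>x\<in>A. P (f x))"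
  and bex_image: "(\<exists>y\<in>f ` A. P y) \<longleftrightarrow> (\<exists>x\<in>A. P (f x))"
  by blast+

lemma pseudometric_on_image: "pseudometric_on (f ` A) d \<longleftrightarrow> pseudometric_on A (\<lambda>x y. d (f x) (f y))"
  unfolding pseudometric_on_def by auto

context cayley_graph
begin

text \<open>Translating the walls and the edge together changes nothing, as \<open>rho\<close> is evaluated at left differences.\<close>

lemma weight_translate:
  assumes g: "g \<in> Zh" and f: "f \<in> E"
  shows "weight (translate g c) f = weight c (translate_edge HZ (inv\<^bsub>HZ\<^esub> (mat_of g)) f)"
proof -
  obtain x y where xy: "x \<in> Zh" "y \<in> Zh" "f = {mat_of x, mat_of y}" using E_vertices[OF f] by blast
  have "translate_edge HZ (inv\<^bsub>HZ\<^esub> (mat_of g)) f = {mat_of (- g + x), mat_of (- g + y)}"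
    by (simp add: translate_edge_def xy(3) inv_HZ[OF g] mat_of_plus)
  moreover have "collapse (translate g c) x = g + collapse c (- g + x)" "collapse (translate g c) y = g + collapse c (- g + y)"
    using collapse_translate[of g "- g + x" c] collapse_translate[of g "- g + y" c] g xy by (simp_all add: add.assoc[symmetric])
  ultimately show ?thesis by (simp only: xy(3) weight_eq left_cancel)
qed

lemma stationary_weights:
  assumes \<kappa>: "\<kappa> \<in> measurable M \<Omega>" and distr: "distr M \<Omega> \<kappa> = \<Omega>"
  shows "stationary HZ E M (\<lambda>f \<omega>. weight (\<kappa> \<omega>) f)"
  unfolding stationary_def
proof (intro allI ballI impI)
  fix k :: nat and f g
  assume "g \<in> carrier HZ" and f: "\<forall>i<k. f i \<in> E"
  then obtain h where h: "h \<in> Zh" "g = mat_of h" by (auto simp: mat_of_Zh[symmetric])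
  define B :: "(nat \<Rightarrow> real) measure" where "B = (\<Pi>\<^sub>M i\<in>{..<k}. borel)"
  define H where "H c = (\<lambda>i\<in>{..<k}. weight c (f i))" for c
  have H: "H \<in> measurable \<Omega> B"
    unfolding H_def B_def using f by (intro measurable_restrict weight_measurable) auto
  have "(\<lambda>\<omega>. \<lambda>i\<in>{..<k}. weight (\<kappa> \<omega>) (translate_edge HZ (inv\<^bsub>HZ\<^esub> g) (f i))) = (H \<circ> translate h) \<circ> \<kappa>"
    using f h by (auto simp: H_def fun_eq_iff weight_translate restrict_def)
  then have "distr M B (\<lambda>\<omega>. \<lambda>i\<in>{..<k}. weight (\<kappa> \<omega>) (translate_edge HZ (inv\<^bsub>HZ\<^esub> g) (f i))) = distr (distr M \<Omega> \<kappa>) B (H \<circ> translate h)"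
    using distr_distr[OF measurable_comp[OF translate_measurable H] \<kappa>] by simp
  also have "\<dots> = distr (distr \<Omega> \<Omega> (translate h)) B H"
    unfolding distr by (rule distr_distr[OF H translate_measurable, symmetric])
  also have "\<dots> = distr (distr M \<Omega> \<kappa>) B H" by (simp add: distr_translate distr)
  also have "\<dots> = distr M B (\<lambda>\<omega>. \<lambda>i\<in>{..<k}. weight (\<kappa> \<omega>) (f i))"
    using distr_distr[OF H \<kappa>] by (simp add: o_def H_def)
  finally show "distr M (\<Pi>\<^sub>M i\<in>{..<k}. borel) (\<lambda>\<omega>. \<lambda>i\<in>{..<k}. weight (\<kappa> \<omega>) (f i)) =
      distr M (\<Pi>\<^sub>M i\<in>{..<k}. borel) (\<lambda>\<omega>. \<lambda>i\<in>{..<k}. weight (\<kappa> \<omega>) (translate_edge HZ (inv\<^bsub>HZ\<^esub> g) (f i)))"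
    by (simp add: B_def)
qed

lemma good_imp_convergence:
  assumes c: "good c" and \<Phi>: "\<And>v. \<Phi> (hmat v) = N v"
  shows "pointed_GH_tendsto_pseudo (\<lambda>n. carrier HZ) (\<lambda>n x y. 1 / real n * passage_time E (weight c) x y)
    (\<lambda>n. \<one>\<^bsub>HZ\<^esub>) (carrier HR) (cc_dist \<Phi>) \<one>\<^bsub>HR\<^esub>"
proof (rule pointed_GH_tendsto_pseudoI)
  interpret traveller N G s1 s2 c "T c" by (rule traveller[OF c])
  have e: "cc_dist \<Phi> (mat_of x) (mat_of y) = rho (- x + y)" for x y by (rule cc_dist_eq_rho[of \<Phi>, OF \<Phi>])
  have pt: "passage_time E (weight c) (mat_of x) (mat_of y) = T c x y" for x y by (simp add: T_def)
  have pm: "pseudometric_on Zh (T c)"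
    unfolding pseudometric_on_def
  proof (intro conjI ballI)
    show "T c x x = 0" if "x \<in> Zh" for x using that by (rule T_refl)
    show "T c x y = T c y x" if "x \<in> Zh" "y \<in> Zh" for x y using that by (rule T_sym)
    show "T c x z \<le> T c x y + T c y z" if "x \<in> Zh" "y \<in> Zh" "z \<in> Zh" for x y z
      using that by (rule T_triangle)
    show "0 \<le> T c x y" if "x \<in> Zh" "y \<in> Zh" for x y
      using T_lower[OF that] rho_nonneg[of "- collapse c x + collapse c y"] by linarith
  qed
  show "pseudometric_on (carrier HZ) (\<lambda>x y. 1 / real n * passage_time E (weight c) x y)" if "n \<ge> 1" for n
    unfolding mat_of_Zh[symmetric] pseudometric_on_image pt unfolding pseudometric_on_def
  proof (intro conjI ballI)
    have n: "0 \<le> 1 / real n" by simp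
    show "1 / real n * T c x x = 0" if x: "x \<in> Zh" for x by (simp only: T_refl[OF x] mult_zero_right)
    show "0 \<le> 1 / real n * T c x y" if "x \<in> Zh" "y \<in> Zh" for x y
      using pm that unfolding pseudometric_on_def by (intro mult_nonneg_nonneg[OF n]) blast
    show "1 / real n * T c x y = 1 / real n * T c y x" if "x \<in> Zh" "y \<in> Zh" for x y
      by (simp only: T_sym[OF that])
    show "1 / real n * T c x z \<le> 1 / real n * T c x y + 1 / real n * T c y z"
      if "x \<in> Zh" "y \<in> Zh" "z \<in> Zh" for x y z
      using mult_left_mono[OF T_triangle[OF that] n] by (simp only: distrib_left)
  qed
  show "\<one>\<^bsub>HZ\<^esub> \<in> carrier HZ" by (simp add: mat_of_Zh[symmetric])
  show "pseudometric_on (carrier HR) (cc_dist \<Phi>)"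
    using pseudometric_on_rho[of UNIV] by (simp only: carrier_HR pseudometric_on_image e)
  show "\<one>\<^bsub>HR\<^esub> \<in> carrier HR" by (simp add: carrier_HR HR_one)
  fix r \<epsilon> :: real assume r: "r > 0" "\<epsilon> > 0"
  show "\<forall>\<^sub>F n in sequentially. \<exists>f. (\<forall>x\<in>carrier HZ. f x \<in> carrier HR) \<and> f \<one>\<^bsub>HZ\<^esub> = \<one>\<^bsub>HR\<^esub> \<and>
      (\<forall>x\<in>carrier HZ. \<forall>y\<in>carrier HZ. 1 / real n * passage_time E (weight c) \<one>\<^bsub>HZ\<^esub> x < r \<longrightarrow>
         1 / real n * passage_time E (weight c) \<one>\<^bsub>HZ\<^esub> y < r \<longrightarrow>
         \<bar>cc_dist \<Phi> (f x) (f y) - 1 / real n * passage_time E (weight c) x y\<bar> < \<epsilon>) \<and>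
      (\<forall>y\<in>carrier HR. cc_dist \<Phi> \<one>\<^bsub>HR\<^esub> y < r - \<epsilon> \<longrightarrow>
         (\<exists>x\<in>carrier HZ. 1 / real n * passage_time E (weight c) \<one>\<^bsub>HZ\<^esub> x < r \<and> cc_dist \<Phi> (f x) y < \<epsilon>))"
  proof (rule eventually_mono[OF rescaled_approximation[OF pm _ r]], rule T_approximates_rho, assumption)
    fix n
    assume elim: "(\<forall>x\<in>Zh. \<forall>y\<in>Zh. 1 / real n * T c 0 x < r \<longrightarrow> 1 / real n * T c 0 y < r \<longrightarrow>
          \<bar>rho (- dil (1 / real n) x + dil (1 / real n) y) - 1 / real n * T c x y\<bar> < \<epsilon>) \<and>
        (\<forall>g. rho g < r - \<epsilon> \<longrightarrow> (\<exists>x\<in>Zh. 1 / real n * T c 0 x < r \<and> rho (- dil (1 / real n) x + g) < \<epsilon>))"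
    show "\<exists>f. (\<forall>x\<in>carrier HZ. f x \<in> carrier HR) \<and> f \<one>\<^bsub>HZ\<^esub> = \<one>\<^bsub>HR\<^esub> \<and>
      (\<forall>x\<in>carrier HZ. \<forall>y\<in>carrier HZ. 1 / real n * passage_time E (weight c) \<one>\<^bsub>HZ\<^esub> x < r \<longrightarrow>
         1 / real n * passage_time E (weight c) \<one>\<^bsub>HZ\<^esub> y < r \<longrightarrow>
         \<bar>cc_dist \<Phi> (f x) (f y) - 1 / real n * passage_time E (weight c) x y\<bar> < \<epsilon>) \<and>
      (\<forall>y\<in>carrier HR. cc_dist \<Phi> \<one>\<^bsub>HR\<^esub> y < r - \<epsilon> \<longrightarrow>
         (\<exists>x\<in>carrier HZ. 1 / real n * passage_time E (weight c) \<one>\<^bsub>HZ\<^esub> x < r \<and> cc_dist \<Phi> (f x) y < \<epsilon>))"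
      unfolding mat_of_Zh[symmetric] carrier_HR HZ_one HR_one
    proof (intro exI[of _ "\<lambda>M. mat_of (dil (1 / real n) (of_mat M))"] conjI)
      show "\<forall>x\<in>mat_of ` Zh. \<forall>y\<in>mat_of ` Zh. 1 / real n * passage_time E (weight c) (mat_of 0) x < r \<longrightarrow>
         1 / real n * passage_time E (weight c) (mat_of 0) y < r \<longrightarrow>
         \<bar>cc_dist \<Phi> (mat_of (dil (1 / real n) (of_mat x))) (mat_of (dil (1 / real n) (of_mat y)))
           - 1 / real n * passage_time E (weight c) x y\<bar> < \<epsilon>"
        unfolding ball_image pt e of_mat_mat_of using elim by (rule conjunct1)
      show "\<forall>y\<in>range mat_of. cc_dist \<Phi> (mat_of 0) y < r - \<epsilon> \<longrightarrow>
         (\<exists>x\<in>mat_of ` Zh. 1 / real n * passage_time E (weight c) (mat_of 0) x < r \<and>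
            cc_dist \<Phi> (mat_of (dil (1 / real n) (of_mat x))) y < \<epsilon>)"
        unfolding ball_image bex_image pt e of_mat_mat_of using elim by simp
    qed auto
  qed
qed

end

theorem theorem2:
  fixes \<Phi> :: "real^3^3 \<Rightarrow> real" and S :: "(real^3^3) set"
  assumes "norm_on horizontal \<Phi>"
    and "finite S" and "S \<subseteq> carrier HZ" and "generate HZ S = carrier HZ"
  shows "\<exists>(M :: ((real^3^3) set \<Rightarrow> real) measure) w.
    prob_space M \<and>
    random_weights (cayley_edges HZ S) M w \<and>
    stationary HZ (cayley_edges HZ S) M w \<and>
    (AE \<omega> in M.
      pointed_GH_tendsto_pseudo
        (\<lambda>n. carrier HZ)
        (\<lambda>n x y. 1 / real n * passage_time (cayley_edges HZ S) (\<lambda>f. w f \<omega>) x y)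
        (\<lambda>n. \<one>\<^bsub>HZ\<^esub>)
        (carrier HR) (cc_dist \<Phi>) \<one>\<^bsub>HR\<^esub>)"
proof -
  define N where "N v = \<Phi> (hmat v)" for v
  have "norm_on UNIV N"
    using assms(1) unfolding norm_on_def horizontal_eq N_def ball_simps hmat_linear
    by (simp add: hmat_eq_0_iff del: split_paired_All)
  then interpret plane_norm N by unfold_locales
  define S' where "S' = of_mat ` S"
  have S: "S = mat_of ` S'" "S' \<subseteq> Zh"
  proof -
    have 1: "\<exists>g\<in>Zh. M = mat_of g" if "M \<in> S" for M using assms(3) that by (auto simp: mat_of_Zh[symmetric])
    show "S' \<subseteq> Zh" using 1 by (force simp: S'_def)
    have "mat_of (of_mat M) = M" if "M \<in> S" for M using 1[OF that] by auto
    then show "S = mat_of ` S'" by (force simp: S'_def image_image)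
  qed
  define G where "G = S' \<union> uminus ` S'"
  have gen: "\<exists>xs. set xs \<subseteq> G \<and> sum_list xs = h" if h: "h \<in> Zh" for h
  proof -
    have "mat_of h \<in> generate HZ S" using h assms(4) by (simp add: mat_of_Zh[symmetric])
    from generate_HZ_word[OF S this] obtain xs where xs: "set xs \<subseteq> S' \<union> uminus ` S'" "mat_of (sum_list xs) = mat_of h"
      by (elim exE conjE)
    have "sum_list xs = h" using arg_cong[OF xs(2), of of_mat] by (simp only: of_mat_mat_of)
    with xs(1) show ?thesis by (intro exI[of _ xs] conjI) (simp_all only: G_def)
  qed
  obtain s1 s2 where s: "s1 \<in> G" "s2 \<in> G" "det2 (hor s1) (hor s2) \<noteq> 0"
  proof -
    have "\<exists>s\<in>G. \<exists>t\<in>G. det2 (hor s) (hor t) \<noteq> 0" by (rule generating_independent) (rule gen)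
    then show ?thesis by (elim bexE) (rule that)
  qed
  have "highways N G s1 s2"
  proof
    show "G \<subseteq> Zh" using S(2) by (auto simp: G_def)
    show "- t \<in> G" if "t \<in> G" for t using that by (auto simp: G_def)
    show "\<exists>xs. set xs \<subseteq> G \<and> sum_list xs = h" if "h \<in> Zh" for h using that by (rule gen)
  qed (rule s)+
  then interpret highways N G s1 s2 .
  define E where "E = cayley_edges HZ S"
  have E: "E = {{mat_of x, mat_of (x + t)} | x t. x \<in> Zh \<and> t \<in> S'}"
    unfolding E_def by (rule cayley_edges_HZ[OF S])
  have "cayley_graph N G s1 s2 E"
  proof
    fix x y assume xy: "x \<in> Zh" "y \<in> Zh"
    show "{mat_of x, mat_of y} \<in> E \<longleftrightarrow> - x + y \<in> G"
    proof
      assume "{mat_of x, mat_of y} \<in> E"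
      then obtain a t where a: "t \<in> S'" "{mat_of x, mat_of y} = {mat_of a, mat_of (a + t)}" unfolding E by blast
      then consider "x = a" "y = a + t" | "x = a + t" "y = a" by (auto simp: doubleton_eq_iff)
      then show "- x + y \<in> G"
        using a(1) by cases (auto simp: G_def minus_add add.assoc)
    next
      assume "- x + y \<in> G"
      then consider t where "t \<in> S'" "- x + y = t" | t where "t \<in> S'" "- x + y = - t" by (auto simp: G_def)
      then show "{mat_of x, mat_of y} \<in> E"
      proof cases
        case 1
        then have "y = x + t" by auto
        then show ?thesis unfolding E using 1(1) xy(1) by blast
      next
        case 2
        then have "t = - (- x + y)" by simp
        then have "x = y + t" by (simp add: minus_add)
        then have "{mat_of x, mat_of y} = {mat_of y, mat_of (y + t)}" by (simp add: insert_commute)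
        then show ?thesis unfolding E using 2(1) xy(2) by blast
      qed
    qed
  next
    fix f assume "f \<in> E"
    then show "\<exists>x\<in>Zh. \<exists>y\<in>Zh. f = {mat_of x, mat_of y}" unfolding E using S(2) by blast
  qed
  then interpret cayley_graph N G s1 s2 E .
  obtain M :: "((real^3^3) set \<Rightarrow> real) measure" and \<kappa>
    where M: "prob_space M" "\<kappa> \<in> measurable M \<Omega>" "distr M \<Omega> \<kappa> = \<Omega>"
    using ex_sample_space[OF prob_space_\<Omega> space_\<Omega>] by blast
  define w where "w f \<omega> = weight (\<kappa> \<omega>) f" for f \<omega>
  have "random_weights E M w"
    unfolding random_weights_def w_def
    using W.w_nonneg measurable_compose[OF M(2) weight_measurable] by auto
  moreover have "stationary HZ E M w"
    using stationary_weights[OF M(2,3)] by (simp add: w_def[abs_def])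
  moreover have "AE \<omega> in M. good (\<kappa> \<omega>)"
    by (rule AE_distrD[OF M(2)]) (unfold M(3), rule AE_good)
  then have "AE \<omega> in M. pointed_GH_tendsto_pseudo (\<lambda>n. carrier HZ)
      (\<lambda>n x y. 1 / real n * passage_time E (\<lambda>f. w f \<omega>) x y) (\<lambda>n. \<one>\<^bsub>HZ\<^esub>) (carrier HR) (cc_dist \<Phi>) \<one>\<^bsub>HR\<^esub>"
  proof eventually_elim
    case (elim \<omega>)
    have "(\<lambda>f. w f \<omega>) = weight (\<kappa> \<omega>)" by (simp add: w_def fun_eq_iff)
    then show ?case using good_imp_convergence[OF elim, of \<Phi>] by (simp only: N_def)
  qed
  ultimately show ?thesis using M(1) unfolding E_def by blast
qed

end
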